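(* Let $n\ge1$, let $u_0=0$ and $u_1\in L^2(\mathbf{R}^n)\cap L^{1,1}(\mathbf{R}^n)$. Then the unique solution $u$ of $$u_{tt}+Lu+Lu_t=0\ \text{ in }(0,\infty)\times\mathbf{R}^n,\qquad u(0,x)=u_0(x)=0,\quad u_t(0,x)=u_1(x),$$ satisfies, for all sufficiently large $t$, $$\left\|u(t,\cdot)-\left(\int_{\mathbf{R}^n}u_1(x)\,dx\right)\mathcal{F}^{-1}_{\xi\to x}\left((1+|\xi|^2)^{-\frac t2}\,\frac{\sin\left(t\sqrt{\log(1+|\xi|^2)}\right)}{\sqrt{\log(1+|\xi|^2)}}\right)\right\|_{L^2}\le I_0\,t^{-\frac n4},$$ where $I_0:=\|u_1\|_{L^2}+\|(1+|x|)u_1\|_{L^1}$.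
   Context: The Fourier transform is $\hat f(\xi)=\int_{\mathbf{R}^n}e^{-ix\cdot\xi}f(x)\,dx$, and $\mathcal{F}^{-1}_{\xi\to x}$ is its inverse. $L^{1,1}(\mathbf{R}^n)=\{f\in L^1(\mathbf{R}^n):\int_{\mathbf{R}^n}(1+|x|)|f(x)|dx<\infty\}$. The operator $L=\log(I-\Delta)$ is the nonnegative self-adjoint operator on $L^2(\mathbf{R}^n)$ given by $Lf=\mathcal{F}^{-1}_{\xi\to x}(\log(1+|\xi|^2)\hat f(\xi))$ with domain $D(L)=\{f\in L^2(\mathbf{R}^n):\int_{\mathbf{R}^n}(\log(1+|\xi|^2))^2|\hat f|^2d\xi<\infty\}$; $L^{1/2}$ is the multiplier with symbol $\sqrt{\log(1+|\xi|^2)}$, with domain $D(L^{1/2})=\{f\in L^2(\mathbf{R}^n):\int_{\mathbf{R}^n}\log(1+|\xi|^2)|\hat f|^2d\xi<\infty\}$. The solution is the unique mild solution $u\in C([0,\infty);D(L^{1/2}))\cap C^1([0,\infty);L^2(\mathbf{R}^n))$; equivalently, for a.e. $\xi$, $\hat u(\cdot,\xi)$ solves $\hat u_{tt}+\log(1+|\xi|^2)\hat u+\log(1+|\xi|^2)\hat u_t=0$ with $\hat u(0,\xi)=\hat u_0(\xi)$, $\hat u_t(0,\xi)=\hat u_1(\xi)$. *)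

theory Defs
  imports "HOL-Analysis.Analysis"
begin

text \<open>
  Elements of \<open>L\<^sup>2\<close> are represented by functions, so equality in \<open>L\<^sup>2\<close> is equality almost
  everywhere and no definition below depends on the choice of representatives.
\<close>

definition L2_space :: "('a::euclidean_space \<Rightarrow> complex) set" where
  "L2_space = {f \<in> borel_measurable lebesgue. integrable lebesgue (\<lambda>x. (norm (f x))\<^sup>2)}"

text \<open>Meaningful only for members of \<open>L2_space\<close> (a divergent Bochner integral has value 0).\<close>

definition L2_norm :: "('a::euclidean_space \<Rightarrow> complex) \<Rightarrow> real" where
  "L2_norm f = sqrt (\<integral>x. (norm (f x))\<^sup>2 \<partial>lebesgue)"

text \<open>
  Convergence in \<open>L\<^sup>2\<close>; the nonnegative integral is used because it is infinite when the
  difference is not square integrable.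
\<close>

definition L2_tendsto ::
  "('b \<Rightarrow> 'a::euclidean_space \<Rightarrow> complex) \<Rightarrow> ('a \<Rightarrow> complex) \<Rightarrow> 'b filter \<Rightarrow> bool" where
  "L2_tendsto u v F \<longleftrightarrow>
     ((\<lambda>s. \<integral>\<^sup>+x. ennreal ((norm (u s x - v x))\<^sup>2) \<partial>lebesgue) \<longlongrightarrow> 0) F"

definition L11_space :: "('a::euclidean_space \<Rightarrow> complex) set" where
  "L11_space = {f. integrable lebesgue f \<and> integrable lebesgue (\<lambda>x. (1 + norm x) * norm (f x))}"

definition fourier_integral :: "('a::euclidean_space \<Rightarrow> complex) \<Rightarrow> 'a \<Rightarrow> complex" where
  "fourier_integral f \<xi> = (\<integral>x. exp (- \<i> * complex_of_real (x \<bullet> \<xi>)) * f x \<partial>lebesgue)"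

text \<open>
  The Fourier transform on \<open>L\<^sup>2\<close> is the usual Plancherel extension: \<open>g\<close> is the Fourier transform
  of \<open>f\<close> if it is the \<open>L\<^sup>2\<close> limit, as \<open>R \<rightarrow> \<infinity>\<close>, of the Fourier integrals of the truncations of
  \<open>f\<close> to the ball of radius \<open>R\<close>. The operators \<open>fourier_L2\<close> and \<open>inv_fourier_L2\<close> pick
  one representative.
\<close>

definition has_fourier_L2 ::
  "('a::euclidean_space \<Rightarrow> complex) \<Rightarrow> ('a \<Rightarrow> complex) \<Rightarrow> bool" where
  "has_fourier_L2 f g \<longleftrightarrow> f \<in> L2_space \<and> g \<in> L2_space \<and>
     L2_tendsto (\<lambda>R::real. fourier_integral (\<lambda>x. indicator (cball 0 R) x * f x)) g at_top"

definition fourier_L2 :: "('a::euclidean_space \<Rightarrow> complex) \<Rightarrow> 'a \<Rightarrow> complex" where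
  "fourier_L2 f = (SOME g. has_fourier_L2 f g)"

definition inv_fourier_L2 :: "('a::euclidean_space \<Rightarrow> complex) \<Rightarrow> 'a \<Rightarrow> complex" where
  "inv_fourier_L2 g = (SOME f. has_fourier_L2 f g)"

definition L_symbol :: "'a::euclidean_space \<Rightarrow> real" where
  "L_symbol \<xi> = ln (1 + (norm \<xi>)\<^sup>2)"

definition L_half_domain :: "('a::euclidean_space \<Rightarrow> complex) set" where
  "L_half_domain =
     {f \<in> L2_space. integrable lebesgue (\<lambda>\<xi>. L_symbol \<xi> * (norm (fourier_L2 f \<xi>))\<^sup>2)}"

definition L_half :: "('a::euclidean_space \<Rightarrow> complex) \<Rightarrow> 'a \<Rightarrow> complex" where
  "L_half f = inv_fourier_L2 (\<lambda>\<xi>. complex_of_real (sqrt (L_symbol \<xi>)) * fourier_L2 f \<xi>)"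

text \<open>Only the values of the curve \<open>u\<close> at times \<open>t \<ge> 0\<close> matter in the next three definitions.\<close>

definition C0_L2 :: "(real \<Rightarrow> 'a::euclidean_space \<Rightarrow> complex) \<Rightarrow> bool" where
  "C0_L2 u \<longleftrightarrow> (\<forall>t\<ge>0. u t \<in> L2_space \<and> L2_tendsto u (u t) (at t within {0..}))"

text \<open>Continuity with respect to the graph norm of \<open>L\<^bsup>1/2\<^esup>\<close>.\<close>

definition C0_L_half :: "(real \<Rightarrow> 'a::euclidean_space \<Rightarrow> complex) \<Rightarrow> bool" where
  "C0_L_half u \<longleftrightarrow> (\<forall>t\<ge>0. u t \<in> L_half_domain) \<and> C0_L2 u \<and> C0_L2 (\<lambda>t. L_half (u t))"

definition C1_L2 :: "(real \<Rightarrow> 'a::euclidean_space \<Rightarrow> complex) \<Rightarrow> bool" where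
  "C1_L2 u \<longleftrightarrow> C0_L2 u \<and>
     (\<exists>u'. C0_L2 u' \<and>
        (\<forall>t\<ge>0. L2_tendsto (\<lambda>s x. (u s x - u t x) / complex_of_real (s - t)) (u' t)
                 (at t within {0..})))"

text \<open>
  Mild solutions of \<open>u\<^sub>t\<^sub>t + L u + L u\<^sub>t = 0\<close>, \<open>u(0) = u0\<close>, \<open>u\<^sub>t(0) = u1\<close>, through the equation
  for almost every frequency. As the Fourier transform of \<open>u t\<close> is determined only up to a null
  set depending on \<open>t\<close>, the equation is required of a family \<open>v\<close> of representatives; \<open>w\<close> is the
  time derivative of \<open>v\<close>, one-sided at \<open>t = 0\<close>.
\<close>

definition mild_solution ::
  "('a::euclidean_space \<Rightarrow> complex) \<Rightarrow> ('a \<Rightarrow> complex) \<Rightarrow> (real \<Rightarrow> 'a \<Rightarrow> complex) \<Rightarrow> bool" where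
  "mild_solution u0 u1 u \<longleftrightarrow> C0_L_half u \<and> C1_L2 u \<and>
     (\<exists>v w :: real \<Rightarrow> 'a \<Rightarrow> complex.
        (\<forall>t\<ge>0. AE \<xi> in lebesgue. v t \<xi> = fourier_L2 (u t) \<xi>) \<and>
        (AE \<xi> in lebesgue.
           v 0 \<xi> = fourier_L2 u0 \<xi> \<and> w 0 \<xi> = fourier_L2 u1 \<xi> \<and>
           (\<forall>t\<ge>0.
              ((\<lambda>s. v s \<xi>) has_vector_derivative w t \<xi>) (at t within {0..}) \<and>
              ((\<lambda>s. w s \<xi>) has_vector_derivative
                 - complex_of_real (L_symbol \<xi>) * v t \<xi>
                 - complex_of_real (L_symbol \<xi>) * w t \<xi>) (at t within {0..}))))"

end

theory Submission
  imports Defs "HOL-Probability.Probability" "HOL-Real_Asymp.Real_Asymp"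
begin


text \<open>
  By Plancherel it suffices to bound \<open>(2 \<pi>)\<^sup>-\<^sup>n\<close> times the integral of the squared difference of the
  Fourier transforms. For almost every frequency the transform of \<open>u\<close> solves a damped oscillator
  with \<open>l = log (1 + |\<xi>|\<^sup>2)\<close>. Where \<open>|\<xi>|\<^sup>2 \<le> 1/8\<close>, the solution is
  \<open>exp (- l t / 2) sin (t \<omega>) / \<omega>\<close> times the transform of \<open>u1\<close>, with \<open>\<omega>\<^sup>2 = l - l\<^sup>2 / 4\<close>. Replacing that
  transform by its value at \<open>0\<close> costs at most \<open>|\<xi>|\<close> times the first moment of \<open>u1\<close>, and replacing \<open>\<omega>\<close>
  by the square root of \<open>l\<close> costs a factor \<open>O(1 + l t)\<close>, so the difference is at most
  \<open>5/4 exp (- l t / 4)\<close> times the weighted \<open>L\<^sup>1\<close> norm. As \<open>l \<ge> 8/9 |\<xi>|\<^sup>2\<close> there, a Gaussian integral gives at most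
  \<open>25/32 t\<^bsup>-n/2\<^esup>\<close>, and the strict inequality \<open>25/32 < 1\<close> absorbs the remaining frequencies, where both
  terms decay exponentially in \<open>t\<close>.
\<close>

section \<open>Fourier integrals and Gaussians\<close>

text \<open>\<open>fourier_L2\<close> and \<open>inv_fourier_L2\<close> are arbitrary choices among
  functions characterised by a limit of truncated integrals. Before any estimate, a transform must
  be known to exist for every square integrable function, to be unique almost everywhere, and to
  take the value \<open>profile t\<close> somewhere. The last point is an inversion theorem, proved
  for kernels that are integrable and square integrable. As the symbol is logarithmic,
  \<open>profile t\<close> decays only like a power of |\<xi>| whose exponent grows with
  \<open>t\<close>, one reason for taking \<open>t\<close> large. The claimed bound has constant 1,
  so constants are tracked: 25/32 is (5/4)^2 from the pointwise estimate times 1/2 from the Gaussian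
  integral after division by (2 pi)^n, which uses 9 \<le> 4 pi. The threshold 1/8 is small enough to
  give 5/4. At high frequencies the damping rate stays bounded, because the slower characteristic
  root tends to -1 as l grows; there integrability in \<xi> of the bound for the solution comes from
  \<open>u1\<close> being square integrable. The characteristic roots coincide for l = 4, which is a
  sphere and hence a null set.\<close>

lemma lebesgue_AE_eq_borel:
  fixes f :: "'a::euclidean_space \<Rightarrow> complex"
  assumes "f \<in> borel_measurable lebesgue"
  obtains g where "g \<in> borel_measurable borel" "AE x in lebesgue. f x = g x"
proof -
  have "(\<lambda>x. Re (f x)) \<in> borel_measurable lebesgue" "(\<lambda>x. Im (f x)) \<in> borel_measurable lebesgue"
    using assms by auto
  from this[THEN completion_ex_borel_measurable_real] obtain r i
    where ri: "r \<in> borel_measurable lborel" "i \<in> borel_measurable lborel"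
      "AE x in lborel. Re (f x) = r x" "AE x in lborel. Im (f x) = i x"
    by blast
  show ?thesis
  proof
    show "(\<lambda>x. Complex (r x) (i x)) \<in> borel_measurable borel"
      using ri(1,2) by (auto simp: Complex_eq)
    show "AE x in lebesgue. f x = Complex (r x) (i x)"
      unfolding AE_completion_iff using ri(3,4) by eventually_elim (simp add: complex_eq_iff)
  qed
qed

lemma borel_measurable_lebesgueI: "f \<in> borel_measurable borel \<Longrightarrow> f \<in> borel_measurable lebesgue"
  by (rule measurable_completion) simp

lemma fourier_integral_cong_AE:
  assumes "f \<in> borel_measurable lebesgue" "g \<in> borel_measurable lebesgue"
    and "AE x in lebesgue. f x = g x"
  shows "fourier_integral f = fourier_integral g"
proof
  fix \<xi> :: 'a
  have "(\<lambda>x. exp (- \<i> * complex_of_real (x \<bullet> \<xi>))) \<in> borel_measurable lebesgue"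
    by (rule borel_measurable_lebesgueI) measurable
  note * = borel_measurable_times[OF this]
  show "fourier_integral f \<xi> = fourier_integral g \<xi>"
    unfolding fourier_integral_def
    using assms by (intro integral_cong_AE *) auto
qed

lemma fourier_integral_lborel:
  assumes "f \<in> borel_measurable borel"
  shows "fourier_integral f \<xi> = (\<integral>x. exp (- \<i> * complex_of_real (x \<bullet> \<xi>)) * f x \<partial>lborel)"
  unfolding fourier_integral_def using assms by (intro integral_completion) simp

lemma norm_exp_minus_ii [simp]: "norm (exp (- (\<i> * complex_of_real a))) = 1"
  by (simp add: norm_exp_eq_Re)

lemma integrable_fourier_integrand:
  assumes "integrable lborel f"
  shows "integrable lborel (\<lambda>x. exp (- \<i> * complex_of_real (x \<bullet> \<xi>)) * f x)"
  by (rule Bochner_Integration.integrable_bound[OF assms])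
     (use assms in \<open>auto simp: norm_mult\<close>)

lemma borel_measurable_fourier_integral [measurable]:
  assumes "f \<in> borel_measurable borel"
  shows "fourier_integral f \<in> borel_measurable borel"
proof -
  have "(\<lambda>\<xi>. \<integral>x. exp (- \<i> * complex_of_real (x \<bullet> \<xi>)) * f x \<partial>lborel) \<in> borel_measurable borel"
    by (rule lborel.borel_measurable_lebesgue_integral) (use assms in measurable)
  then show ?thesis using assms by (subst fourier_integral_lborel[THEN ext]) auto
qed

lemma norm_fourier_integral_le:
  assumes "integrable lborel f"
  shows "norm (fourier_integral f \<xi>) \<le> (\<integral>x. norm (f x) \<partial>lborel)"
proof -
  have "norm (fourier_integral f \<xi>) \<le> (\<integral>x. norm (exp (- \<i> * complex_of_real (x \<bullet> \<xi>)) * f x) \<partial>lborel)"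
    using assms by (subst fourier_integral_lborel) (auto intro: integral_norm_bound)
  then show ?thesis by (simp add: norm_mult)
qed

text \<open>Fubini, for a kernel that is symmetric in its two variables. Moving the transform from
  one factor to the other replaces pointwise inversion, both in Plancherel's identity and in the
  inversion theorem.\<close>

lemma fourier_integral_multiplication:
  fixes f g :: "'a::euclidean_space \<Rightarrow> complex"
  assumes f: "integrable lborel f" and g: "integrable lborel g"
  shows "(\<integral>\<xi>. fourier_integral f \<xi> * g \<xi> \<partial>lborel) = (\<integral>x. f x * fourier_integral g x \<partial>lborel)"
proof -
  have [measurable]: "f \<in> borel_measurable borel" "g \<in> borel_measurable borel"
    using f g by (auto dest: borel_measurable_integrable)
  have fg: "integrable (lborel \<Otimes>\<^sub>M lborel) (\<lambda>(x,\<xi>). exp (- \<i> * complex_of_real (x \<bullet> \<xi>)) * f x * g \<xi>)"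
  proof (rule lborel_pair.Fubini_integrable)
    show "integrable lborel (\<lambda>x. \<integral>\<xi>. norm (case (x,\<xi>) of (x,\<xi>) \<Rightarrow> exp (- \<i> * complex_of_real (x \<bullet> \<xi>)) * f x * g \<xi>) \<partial>lborel)"
      using f g by (auto simp: norm_mult)
    show "AE x in lborel. integrable lborel (\<lambda>\<xi>. case (x,\<xi>) of (x,\<xi>) \<Rightarrow> exp (- \<i> * complex_of_real (x \<bullet> \<xi>)) * f x * g \<xi>)"
    proof (rule AE_I2, simp only: prod.case)
      fix x
      have "integrable lborel (\<lambda>\<xi>. f x * (exp (- \<i> * complex_of_real (\<xi> \<bullet> x)) * g \<xi>))"
        by (intro integrable_mult_right integrable_fourier_integrand g)
      then show "integrable lborel (\<lambda>\<xi>. exp (- \<i> * complex_of_real (x \<bullet> \<xi>)) * f x * g \<xi>)"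
        by (simp add: mult_ac inner_commute)
    qed
  qed measurable
  have "(\<integral>\<xi>. fourier_integral f \<xi> * g \<xi> \<partial>lborel) =
      (\<integral>\<xi>. (\<integral>x. exp (- \<i> * complex_of_real (x \<bullet> \<xi>)) * f x * g \<xi> \<partial>lborel) \<partial>lborel)"
    by (simp add: fourier_integral_lborel)
  also have "\<dots> = (\<integral>x. (\<integral>\<xi>. exp (- \<i> * complex_of_real (x \<bullet> \<xi>)) * f x * g \<xi> \<partial>lborel) \<partial>lborel)"
    by (rule lborel_pair.Fubini_integral[OF fg])
  also have "\<dots> = (\<integral>x. (\<integral>\<xi>. f x * (exp (- \<i> * complex_of_real (\<xi> \<bullet> x)) * g \<xi>) \<partial>lborel) \<partial>lborel)"
    by (simp add: mult_ac inner_commute)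
  also have "\<dots> = (\<integral>x. f x * fourier_integral g x \<partial>lborel)"
    by (simp add: fourier_integral_lborel del: mult_minus_left)
  finally show ?thesis .
qed

section \<open>Affine substitutions and products of one-dimensional integrals\<close>

lemma lborel_integral_affine:
  fixes f :: "'a::euclidean_space \<Rightarrow> 'b::{banach,second_countable_topology}"
  assumes c: "c \<noteq> 0" and [measurable]: "f \<in> borel_measurable borel"
  shows "(\<integral>x. f x \<partial>lborel) = \<bar>c\<bar>^DIM('a) *\<^sub>R (\<integral>x. f (t + c *\<^sub>R x) \<partial>lborel)"
  by (subst lborel_affine[OF c, of t])
     (simp add: integral_density integral_distr)

lemma lborel_nn_integral_affine:
  fixes f :: "'a::euclidean_space \<Rightarrow> ennreal"
  assumes c: "c \<noteq> 0" and [measurable]: "f \<in> borel_measurable borel"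
  shows "(\<integral>\<^sup>+x. f x \<partial>lborel) = ennreal (\<bar>c\<bar>^DIM('a)) * (\<integral>\<^sup>+x. f (t + c *\<^sub>R x) \<partial>lborel)"
  by (subst lborel_affine[OF c, of t])
     (simp add: nn_integral_density nn_integral_distr nn_integral_cmult)

lemma lborel_integrable_affine:
  fixes f :: "'a::euclidean_space \<Rightarrow> 'b::{banach,second_countable_topology}"
  assumes c: "c \<noteq> 0" and f: "integrable lborel f"
  shows "integrable lborel (\<lambda>x. f (t + c *\<^sub>R x))"
proof -
  have [measurable]: "f \<in> borel_measurable borel" using f by auto
  have "(\<integral>\<^sup>+x. norm (f x) \<partial>lborel) < \<infinity>" using f by (simp add: integrable_iff_bounded)
  then have "(\<integral>\<^sup>+x. norm (f (t + c *\<^sub>R x)) \<partial>lborel) < \<infinity>"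
    using c by (subst (asm) lborel_nn_integral_affine[OF c, of _ t]) (auto simp: ennreal_mult_less_top)
  then show ?thesis by (simp add: integrable_iff_bounded)
qed

text \<open>\<open>lborel\<close> is the image of a product measure under the map from coordinates
  to vectors. The factors used later are Gaussians and
  \<open>inverse (1 + y\<^sup>2)\<close>.\<close>

lemma lborel_integrable_prod:
  fixes g :: "'a::euclidean_space \<Rightarrow> real \<Rightarrow> 'b::{real_normed_field,banach,second_countable_topology}"
  assumes g: "\<And>b. b \<in> Basis \<Longrightarrow> integrable lborel (g b)"
  shows "integrable lborel (\<lambda>x::'a. \<Prod>b\<in>Basis. g b (x \<bullet> b))" (is ?A)
    and "(\<integral>x. (\<Prod>b\<in>Basis. g b (x \<bullet> b)) \<partial>lborel) = (\<Prod>b\<in>Basis. \<integral>y. g b y \<partial>lborel)" (is ?B)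
proof -
  interpret product_sigma_finite "\<lambda>_::'a. lborel :: real measure" ..
  have [measurable]: "g b \<in> borel_measurable borel" if "b \<in> Basis" for b
    using g[OF that] by auto
  have eq: "(\<Prod>b\<in>Basis. g b ((\<Sum>b\<in>Basis. f b *\<^sub>R b) \<bullet> b)) = (\<Prod>b\<in>Basis. g b (f b))" for f
    by (intro prod.cong) auto
  have "integrable (\<Pi>\<^sub>M b\<in>(Basis::'a set). lborel) (\<lambda>f. \<Prod>b\<in>Basis. g b (f b))"
    using g by (intro product_integrable_prod) auto
  then show ?A
    by (subst lborel_eq, subst integrable_distr_eq) (auto simp: eq)
  have "(\<integral>f. (\<Prod>b\<in>Basis. g b (f b)) \<partial>(\<Pi>\<^sub>M b\<in>(Basis::'a set). lborel)) = (\<Prod>b\<in>Basis. \<integral>y. g b y \<partial>lborel)"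
    using g by (intro product_integral_prod) auto
  then show ?B
    by (subst lborel_eq, subst integral_distr) (auto simp: eq)
qed

text \<open>\<open>s\<close> is the reciprocal of a standard deviation. With this normalisation the
  transform of \<open>gauss s\<close> is a multiple of \<open>gauss (1 / s)\<close>, and
  \<open>gauss s\<close> increases to 1 as \<open>s\<close> decreases to 0.\<close>

definition gauss :: "real \<Rightarrow> 'a::euclidean_space \<Rightarrow> real" where
  "gauss s x = exp (- (s * norm x)\<^sup>2 / 2)"

lemma borel_measurable_gauss [measurable]: "gauss s \<in> borel_measurable borel"
  unfolding gauss_def by measurable

lemma gauss_pos: "0 < gauss s x" by (simp add: gauss_def)

lemma gauss_prod: "gauss s x = (\<Prod>b\<in>Basis. exp (- (s * (x \<bullet> b))\<^sup>2 / 2))"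
proof -
  have "(norm x)\<^sup>2 = (\<Sum>b\<in>Basis. (x \<bullet> b)\<^sup>2)"
    by (subst power2_norm_eq_inner, subst euclidean_inner) (simp add: power2_eq_square)
  then show ?thesis
    by (simp add: gauss_def exp_sum[symmetric] power_mult_distrib sum_negf sum_divide_distrib sum_distrib_left)
qed

text \<open>In the variable \<open>s * y\<close> the integrand is a multiple of \<open>iexp\<close>
  times the standard normal density, so the value is the characteristic function of that
  distribution at \<open>\<eta> / s\<close>.\<close>

lemma gauss_1d:
  fixes s \<eta> :: real
  assumes s: "0 < s"
  shows "integrable lborel (\<lambda>y. iexp (\<eta> * y) * complex_of_real (exp (- (s * y)\<^sup>2 / 2)))" (is ?A)
    and "(\<integral>y. iexp (\<eta> * y) * complex_of_real (exp (- (s * y)\<^sup>2 / 2)) \<partial>lborel)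
      = complex_of_real (sqrt (2 * pi) / s * exp (- (\<eta> / s)\<^sup>2 / 2))" (is ?B)
proof -
  let ?h = "\<lambda>t y::real. iexp (t * y) * complex_of_real (std_normal_density y)"
  have int: "integrable lborel (?h t)" for t
    by (rule Bochner_Integration.integrable_bound[OF integrable_normal_density[where \<mu>=0 and \<sigma>=1]])
       (auto simp: norm_mult normal_density_nonneg)
  have val: "(\<integral>y. ?h t y \<partial>lborel) = exp (- (t^2) / 2)" for t
    using char_std_normal_distribution[THEN fun_cong, of t]
    by (simp add: char_def fun_eq_iff integral_density normal_density_nonneg mult_ac scaleR_conv_of_real)
  have eq: "iexp (\<eta> * y) * complex_of_real (exp (- (s * y)\<^sup>2 / 2)) = sqrt (2 * pi) * ?h (\<eta> / s) (0 + s * y)" for y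
    using s by (simp add: normal_density_def)
  have i2: "integrable lborel (\<lambda>y. ?h (\<eta>/s) (0 + s * y))"
    using s by (intro lborel_integrable_real_affine int) auto
  then show ?A unfolding eq by (rule integrable_mult_right)
  have "(\<integral>y. ?h (\<eta>/s) y \<partial>lborel) = s *\<^sub>R (\<integral>y. ?h (\<eta>/s) (0 + s * y) \<partial>lborel)"
    using s by (subst lborel_integral_real_affine[where c=s and t=0]) auto
  then have "(\<integral>y. ?h (\<eta>/s) (0 + s * y) \<partial>lborel) = exp (- ((\<eta>/s)^2) / 2) / s"
    using s unfolding val by (simp add: field_simps scaleR_conv_of_real)
  then show ?B unfolding eq integral_mult_right_zero by simp
qed

lemma
  fixes \<xi> :: "'a::euclidean_space"
  assumes s: "0 < s"
  shows integrable_gauss: "integrable lborel (gauss s :: 'a \<Rightarrow> real)"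
    and fourier_integral_gauss: "fourier_integral (\<lambda>x. complex_of_real (gauss s x)) \<xi>
      = complex_of_real ((sqrt (2 * pi) / s) ^ DIM('a) * gauss (1 / s) \<xi>)"
proof -
  let ?g = "\<lambda>(\<xi>::'a) b y. iexp (- (\<xi> \<bullet> b) * y) * complex_of_real (exp (- (s * y)\<^sup>2 / 2))"
  have eq: "exp (- \<i> * complex_of_real (x \<bullet> \<xi>)) * complex_of_real (gauss s x) = (\<Prod>b\<in>Basis. ?g \<xi> b (x \<bullet> b))" for x \<xi> :: 'a
    unfolding gauss_prod of_real_prod prod.distrib
    by (subst euclidean_inner) (simp add: exp_sum[symmetric] sum_distrib_left sum_negf mult_ac)
  have i: "integrable lborel (\<lambda>x. exp (- \<i> * complex_of_real (x \<bullet> \<xi>)) * complex_of_real (gauss s x))" for \<xi> :: 'a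
    unfolding eq using s by (intro lborel_integrable_prod gauss_1d)
  show "integrable lborel (gauss s :: 'a \<Rightarrow> real)"
    using integrable_Re[OF i[of 0]] by simp
  have "fourier_integral (\<lambda>x. complex_of_real (gauss s x)) \<xi> = (\<Prod>b\<in>Basis. \<integral>y. ?g \<xi> b y \<partial>lborel)"
    using s by (subst fourier_integral_lborel) (auto simp only: eq intro!: lborel_integrable_prod gauss_1d, measurable)
  also have "\<dots> = (\<Prod>b\<in>Basis. complex_of_real (sqrt (2 * pi) / s * exp (- (1 / s * (\<xi> \<bullet> b))\<^sup>2 / 2)))"
    by (subst gauss_1d[OF s]) simp
  also have "\<dots> = complex_of_real ((sqrt (2 * pi) / s) ^ DIM('a) * gauss (1 / s) \<xi>)"
    unfolding gauss_prod of_real_prod[symmetric] prod.distrib prod_constant by simp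
  finally show "fourier_integral (\<lambda>x. complex_of_real (gauss s x)) \<xi>
      = complex_of_real ((sqrt (2 * pi) / s) ^ DIM('a) * gauss (1 / s) \<xi>)" .
qed



section \<open>Square integrable functions and translations\<close>

text \<open>The squared distance takes values in \<open>ennreal\<close>, as in
  \<open>L2_tendsto\<close>, so that it can be estimated before square integrability is known. The
  price is the factor 2 in its triangle inequality, harmless wherever only convergence to 0
  matters.\<close>

definition L2_dist2 :: "('a::euclidean_space \<Rightarrow> complex) \<Rightarrow> ('a \<Rightarrow> complex) \<Rightarrow> ennreal" where
  "L2_dist2 f g = (\<integral>\<^sup>+x. ennreal ((norm (f x - g x))\<^sup>2) \<partial>lebesgue)"

lemma L2_dist2_lborel: "L2_dist2 f g = (\<integral>\<^sup>+x. ennreal ((norm (f x - g x))\<^sup>2) \<partial>lborel)"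
  by (simp add: L2_dist2_def nn_integral_completion)

lemma L2_tendsto_iff: "L2_tendsto u v F \<longleftrightarrow> ((\<lambda>s. L2_dist2 (u s) v) \<longlongrightarrow> 0) F"
  by (simp add: L2_tendsto_def L2_dist2_def)

lemma L2_dist2_commute: "L2_dist2 f g = L2_dist2 g f"
  by (simp add: L2_dist2_def norm_minus_commute)

lemma norm_add_square_le: "(norm (a + b))\<^sup>2 \<le> 2 * (norm a)\<^sup>2 + 2 * (norm b)\<^sup>2"
proof -
  have "(norm (a + b))\<^sup>2 \<le> (norm a + norm b)\<^sup>2"
    by (intro power_mono norm_triangle_ineq) auto
  also have "\<dots> \<le> 2 * (norm a)\<^sup>2 + 2 * (norm b)\<^sup>2"
    using sum_squares_bound[of "norm a" "norm b"] by (simp add: power2_sum)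
  finally show ?thesis .
qed

lemma L2_dist2_triangle:
  assumes [measurable]: "f \<in> borel_measurable lebesgue" "g \<in> borel_measurable lebesgue" "h \<in> borel_measurable lebesgue"
  shows "L2_dist2 f h \<le> 2 * L2_dist2 f g + 2 * L2_dist2 g h"
proof -
  have "L2_dist2 f h \<le> (\<integral>\<^sup>+x. 2 * ennreal ((norm (f x - g x))\<^sup>2) + 2 * ennreal ((norm (g x - h x))\<^sup>2) \<partial>lebesgue)"
    unfolding L2_dist2_def
  proof (rule nn_integral_mono)
    fix x
    have "ennreal ((norm (f x - h x))\<^sup>2) \<le> ennreal (2 * (norm (f x - g x))\<^sup>2 + 2 * (norm (g x - h x))\<^sup>2)"
      using norm_add_square_le[of "f x - g x" "g x - h x"] by (intro ennreal_leI) simp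
    then show "ennreal ((norm (f x - h x))\<^sup>2) \<le> 2 * ennreal ((norm (f x - g x))\<^sup>2) + 2 * ennreal ((norm (g x - h x))\<^sup>2)"
      by (simp add: ennreal_plus ennreal_mult)
  qed
  also have "\<dots> = 2 * L2_dist2 f g + 2 * L2_dist2 g h"
    unfolding L2_dist2_def by (simp add: nn_integral_add nn_integral_cmult)
  finally show ?thesis .
qed

text \<open>The shape of a density argument: \<open>e\<close> bounds the error of an approximation,
  uniformly along the filter, and \<open>c\<close>, which may depend on \<open>e\<close>, is the
  quantity that tends to 0 for the approximating function.\<close>

lemma ennreal_tendsto_0I:
  fixes f :: "'b \<Rightarrow> ennreal"
  assumes "\<And>e::real. 0 < e \<Longrightarrow> \<exists>c. (c \<longlongrightarrow> 0) F \<and> (\<forall>\<^sub>F x in F. f x \<le> ennreal e + c x)"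
  shows "(f \<longlongrightarrow> 0) F"
proof (rule order_tendstoI)
  fix a :: ennreal assume "0 < a"
  then obtain e where e: "0 < e" "ennreal e < a"
    by (metis dense ennreal_cases ennreal_less_zero_iff infinity_ennreal_def not_top_less)
  then have e2: "0 < e / 2" "ennreal (e/2) + ennreal (e/2) < a" by (auto simp: ennreal_plus[symmetric] simp del: ennreal_plus)
  obtain c where c: "(c \<longlongrightarrow> 0) F" "\<forall>\<^sub>F x in F. f x \<le> ennreal (e/2) + c x"
    using assms[OF e2(1)] by blast
  have "\<forall>\<^sub>F x in F. c x < ennreal (e/2)" using order_tendstoD(2)[OF c(1)] e2(1) by simp
  with c(2) show "\<forall>\<^sub>F x in F. f x < a"
  proof eventually_elim
    case (elim x)
    then have "f x \<le> ennreal (e/2) + ennreal (e/2)" by (meson add_left_mono less_imp_le order_trans)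
    then show ?case using e2(2) by simp
  qed
qed simp

text \<open>Members of \<open>L2_space\<close> are only Lebesgue measurable, whereas Fubini and
  affine substitutions are used for \<open>lborel\<close>. Each member has a representative in
  \<open>L2_borel\<close>, where the analysis is done.\<close>

definition L2_borel :: "('a::euclidean_space \<Rightarrow> complex) set" where
  "L2_borel = {f \<in> borel_measurable borel. integrable lborel (\<lambda>x. (norm (f x))\<^sup>2)}"

lemma L2_borelD:
  assumes "f \<in> L2_borel"
  shows "f \<in> borel_measurable borel" "f \<in> borel_measurable lebesgue" "integrable lborel (\<lambda>x. (norm (f x))\<^sup>2)"
    "(\<integral>\<^sup>+x. ennreal ((norm (f x))\<^sup>2) \<partial>lborel) < \<infinity>"
    "(\<integral>\<^sup>+x. ennreal ((norm (f x))\<^sup>2) \<partial>lborel) = ennreal (\<integral>x. (norm (f x))\<^sup>2 \<partial>lborel)"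
proof -
  show *: "f \<in> borel_measurable borel" "integrable lborel (\<lambda>x. (norm (f x))\<^sup>2)"
    using assms by (auto simp: L2_borel_def)
  then show "f \<in> borel_measurable lebesgue" by (intro borel_measurable_lebesgueI)
  show **: "(\<integral>\<^sup>+x. ennreal ((norm (f x))\<^sup>2) \<partial>lborel) = ennreal (\<integral>x. (norm (f x))\<^sup>2 \<partial>lborel)"
    using * by (intro nn_integral_eq_integral) auto
  show "(\<integral>\<^sup>+x. ennreal ((norm (f x))\<^sup>2) \<partial>lborel) < \<infinity>" unfolding ** by simp
qed

lemma L2_borelI:
  assumes [measurable]: "f \<in> borel_measurable borel" and "(\<integral>\<^sup>+x. ennreal ((norm (f x))\<^sup>2) \<partial>lborel) < \<infinity>"
  shows "f \<in> L2_borel"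
  using assms by (auto simp: L2_borel_def integrable_iff_bounded)

text \<open>Continuous functions converging to \<open>f\<close> almost everywhere need not converge
  in the mean. Therefore \<open>f\<close> is bounded in size and cut off in space, and the same two
  operations are applied to the continuous approximants; this provides a dominating function for
  both limits.\<close>

lemma L2_borel_dense:
  fixes f :: "'a::euclidean_space \<Rightarrow> complex"
  assumes f: "f \<in> L2_borel" and e: "0 < (e::real)"
  obtains g R where "continuous_on UNIV g" "\<And>x. R < norm x \<Longrightarrow> g x = 0" "L2_dist2 f g < ennreal e"
proof -
  have [measurable]: "f \<in> borel_measurable borel" and fL: "f \<in> borel_measurable lebesgue" using L2_borelD f by auto
  have [measurable]: "cball (0::'a) r \<in> sets borel" for r by simp
  \<comment> \<open>\<open>clip k\<close> is the radial retraction onto the disc of radius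
    \<open>k + 1\<close>; \<open>cut k\<close> equals 1 on the ball of radius \<open>k\<close> and 0
    outside radius \<open>k + 1\<close>. Both are continuous, so they preserve continuity of the
    approximants.\<close>
  define clip where "clip k z = z /\<^sub>R max 1 (norm z / real (Suc k))" for k and z :: complex
  define cut where "cut k x = max 0 (min 1 (real k + 1 - norm x))" for k and x :: 'a
  have clip_le: "norm (clip k z) \<le> real (Suc k)" "norm (clip k z) \<le> norm z" for k z
  proof -
    define m where "m = max 1 (norm z / real (Suc k))"
    have m: "1 \<le> m" "norm z / real (Suc k) \<le> m" by (auto simp: m_def)
    have n: "norm (clip k z) = norm z / m"
      using m(1) unfolding clip_def m_def[symmetric] by (simp add: divide_inverse mult.commute)
    have "norm z \<le> real (Suc k) * m" using m(2) by (simp add: pos_divide_le_eq mult.commute del: of_nat_Suc)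
    then show "norm (clip k z) \<le> real (Suc k)" unfolding n using m(1) by (simp add: pos_divide_le_eq del: of_nat_Suc)
    show "norm (clip k z) \<le> norm z" unfolding n using m(1) by (simp add: divide_le_eq mult_le_cancel_left1 mult_left_mono[of 1, simplified])
  qed
  have clip_cont: "continuous_on UNIV (clip k)" for k
    unfolding clip_def by (intro continuous_intros) (auto simp: max_def)
  have cut_cont: "continuous_on UNIV (cut k)" for k
    unfolding cut_def by (intro continuous_intros)
  have cut01: "0 \<le> cut k x" "cut k x \<le> 1" for k x by (auto simp: cut_def)
  have [measurable]: "clip k \<in> borel_measurable borel" "cut k \<in> borel_measurable borel" for k
    using clip_cont cut_cont by (auto intro: borel_measurable_continuous_onI)
  define fk where "fk k x = cut k x *\<^sub>R clip k (f x)" for k x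
  have [measurable]: "fk k \<in> borel_measurable borel" for k unfolding fk_def by measurable
  have fk_le: "norm (fk k x) \<le> norm (f x)" for k x
    using clip_le(2)[of k "f x"] cut01[of k x] mult_mono[of "cut k x" 1 "norm (clip k (f x))" "norm (f x)"]
    by (simp add: fk_def)
  have "(\<lambda>k. L2_dist2 (fk k) f) \<longlonglongrightarrow> (\<integral>\<^sup>+x. 0 \<partial>(lborel::'a measure))"
    unfolding L2_dist2_lborel
  proof (rule nn_integral_dominated_convergence[where w="\<lambda>x. 4 * ennreal ((norm (f x))\<^sup>2)"])
    show "(\<integral>\<^sup>+x. 4 * ennreal ((norm (f x))\<^sup>2) \<partial>lborel) < \<infinity>"
      using L2_borelD(4)[OF f] by (simp add: nn_integral_cmult ennreal_mult_less_top)
    show "AE x in lborel. ennreal ((norm (fk k x - f x))\<^sup>2) \<le> 4 * ennreal ((norm (f x))\<^sup>2)" for k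
    proof (rule AE_I2)
      fix x
      have "norm (fk k x - f x) \<le> 2 * norm (f x)" using fk_le[of k x] norm_triangle_ineq4[of "fk k x" "f x"] by linarith
      then have "(norm (fk k x - f x))\<^sup>2 \<le> 4 * (norm (f x))\<^sup>2" using power_mono[of _ _ 2] by fastforce
      then show "ennreal ((norm (fk k x - f x))\<^sup>2) \<le> 4 * ennreal ((norm (f x))\<^sup>2)"
        by (metis ennreal_leI ennreal_mult ennreal_numeral zero_le_numeral zero_le_power2)
    qed
    show "AE x in lborel. (\<lambda>k. ennreal ((norm (fk k x - f x))\<^sup>2)) \<longlonglongrightarrow> 0"
    proof (rule AE_I2)
      fix x
      obtain K where K: "norm (f x) + norm x \<le> real K" using real_arch_simple by blast
      have "fk k x = f x" if "K \<le> k" for k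
      proof -
        have "real K \<le> real k" using that by simp
        then have *: "norm (f x) \<le> real (Suc k)" "norm x \<le> real k" using K norm_ge_zero[of x] norm_ge_zero[of "f x"] by linarith+
        then have "norm (f x) / real (Suc k) \<le> 1" by (simp add: divide_simps)
        then show ?thesis using * by (simp add: fk_def cut_def clip_def max_def)
      qed
      then have "\<forall>\<^sub>F k in sequentially. ennreal ((norm (fk k x - f x))\<^sup>2) = 0"
        by (auto simp: eventually_sequentially)
      then show "(\<lambda>k. ennreal ((norm (fk k x - f x))\<^sup>2)) \<longlonglongrightarrow> 0" by (rule tendsto_eventually)
    qed
  qed (measurable)
  then have "\<forall>\<^sub>F k in sequentially. L2_dist2 (fk k) f < ennreal (e/4)"
    using e by (intro order_tendstoD(2)) auto
  then obtain k where k: "L2_dist2 (fk k) f < ennreal (e/4)" by (auto simp: eventually_sequentially)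
  \<comment> \<open>\<open>measurable_on\<close> is defined by continuous functions that converge
    off a negligible set; these are the \<open>F n\<close>.\<close>
  have "f measurable_on UNIV" using fL by (simp add: measurable_on_iff_borel_measurable)
  then obtain N F where N: "negligible N" and F: "\<And>n. continuous_on UNIV (F n)"
    and lim: "\<And>x. x \<notin> N \<Longrightarrow> (\<lambda>n. F n x) \<longlonglongrightarrow> f x"
    by (auto simp: measurable_on_def)
  have AEN: "AE x in lborel. x \<notin> N"
    using N by (metis AE_completion_iff AE_not_in negligible_iff_null_sets)
  define g where "g n x = cut k x *\<^sub>R clip k (F n x)" for n x
  have g_cont: "continuous_on UNIV (g n)" for n
    unfolding g_def by (intro continuous_intros cut_cont continuous_on_compose2[OF clip_cont F]) auto
  have [measurable]: "g n \<in> borel_measurable borel" for n using g_cont by (rule borel_measurable_continuous_onI)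
  have g0: "g n x = 0" if "real k + 1 < norm x" for n x using that by (simp add: g_def cut_def)
  have "(\<lambda>n. L2_dist2 (g n) (fk k)) \<longlonglongrightarrow> (\<integral>\<^sup>+x. 0 \<partial>(lborel::'a measure))"
    unfolding L2_dist2_lborel
  proof (rule nn_integral_dominated_convergence[where w="\<lambda>x. ennreal ((2 * real (Suc k))\<^sup>2) * indicator (cball 0 (real k + 1)) x"])
    show "(\<integral>\<^sup>+x. ennreal ((2 * real (Suc k))\<^sup>2) * indicator (cball 0 (real k + 1)) x \<partial>(lborel::'a measure)) < \<infinity>"
      using emeasure_lborel_cball_finite[of "0::'a" "real k + 1"]
      by (subst nn_integral_cmult_indicator) (auto simp: ennreal_mult_less_top)
    show "AE x in lborel. ennreal ((norm (g n x - fk k x))\<^sup>2) \<le> ennreal ((2 * real (Suc k))\<^sup>2) * indicator (cball 0 (real k + 1)) x" for n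
    proof (rule AE_I2)
      fix x
      show "ennreal ((norm (g n x - fk k x))\<^sup>2) \<le> ennreal ((2 * real (Suc k))\<^sup>2) * indicator (cball 0 (real k + 1)) x"
      proof (cases "norm x \<le> real k + 1")
        case True
        have "norm (g n x) \<le> real (Suc k)" "norm (fk k x) \<le> real (Suc k)"
          using clip_le(1)[of k] cut01[of k x] mult_mono[of "cut k x" 1 "norm (clip k _)" "real (Suc k)"]
          by (simp_all add: g_def fk_def)
        then have "norm (g n x - fk k x) \<le> 2 * real (Suc k)"
          using norm_triangle_ineq4 add_mono order_trans unfolding mult_2 by blast
        then have "(norm (g n x - fk k x))\<^sup>2 \<le> (2 * real (Suc k))\<^sup>2" by (intro power_mono) auto
        then show ?thesis using True by (simp add: ennreal_leI indicator_def del: of_nat_Suc)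
      next
        case False
        then have "g n x = 0" "fk k x = 0" by (auto simp: g_def fk_def cut_def)
        then show ?thesis by simp
      qed
    qed
    show "AE x in lborel. (\<lambda>n. ennreal ((norm (g n x - fk k x))\<^sup>2)) \<longlonglongrightarrow> 0"
      using AEN
    proof eventually_elim
      case (elim x)
      have "(\<lambda>n. clip k (F n x)) \<longlonglongrightarrow> clip k (f x)"
        using continuous_on_tendsto_compose[OF clip_cont lim[OF elim]] by simp
      then have "(\<lambda>n. (norm (g n x - fk k x))\<^sup>2) \<longlonglongrightarrow> (norm (cut k x *\<^sub>R clip k (f x) - fk k x))\<^sup>2"
        unfolding g_def by (intro tendsto_intros)
      then show ?case using tendsto_ennrealI by (fastforce simp: fk_def)
    qed
  qed (measurable)
  then have "\<forall>\<^sub>F n in sequentially. L2_dist2 (g n) (fk k) < ennreal (e/4)"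
    using e by (intro order_tendstoD(2)) auto
  then obtain n where n: "L2_dist2 (g n) (fk k) < ennreal (e/4)" by (auto simp: eventually_sequentially)
  have "L2_dist2 f (g n) \<le> 2 * L2_dist2 f (fk k) + 2 * L2_dist2 (fk k) (g n)"
    by (intro L2_dist2_triangle borel_measurable_lebesgueI) measurable
  also have "\<dots> < 2 * ennreal (e/4) + 2 * ennreal (e/4)"
    using k n by (intro add_strict_mono) (auto simp: L2_dist2_commute ennreal_mult_strict_left_mono)
  also have "\<dots> = ennreal e" using e
    by (simp add: ennreal_mult[symmetric] ennreal_plus[symmetric] ennreal_numeral[symmetric] del: ennreal_plus ennreal_numeral)
  finally show ?thesis using that[of "g n" "real k + 1"] g_cont g0 by blast
qed

lemma L2_dist2_translate:
  fixes f g :: "'a::euclidean_space \<Rightarrow> complex"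
  assumes [measurable]: "f \<in> borel_measurable borel" "g \<in> borel_measurable borel"
  shows "L2_dist2 (\<lambda>x. f (x + h)) (\<lambda>x. g (x + h)) = L2_dist2 f g"
  unfolding L2_dist2_lborel
proof -
  have "(\<integral>\<^sup>+x. ennreal ((norm (f x - g x))\<^sup>2) \<partial>lborel)
      = ennreal (\<bar>1\<bar> ^ DIM('a)) * (\<integral>\<^sup>+x. ennreal ((norm (f (h + 1 *\<^sub>R x) - g (h + 1 *\<^sub>R x)))\<^sup>2) \<partial>lborel)"
    by (rule lborel_nn_integral_affine) auto
  then show "(\<integral>\<^sup>+x. ennreal ((norm (f (x + h) - g (x + h)))\<^sup>2) \<partial>lborel) = (\<integral>\<^sup>+x. ennreal ((norm (f x - g x))\<^sup>2) \<partial>lborel)"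
    by (simp add: add.commute)
qed

text \<open>A convergent sequence of shifts is bounded, so all shifted supports lie in the ball of
  radius \<open>R + H\<close>, and the constant \<open>(2 * \<bar>B\<bar>)\<^sup>2\<close> on that
  ball dominates.\<close>

lemma continuous_translate_L2:
  fixes g :: "'a::euclidean_space \<Rightarrow> complex"
  assumes g: "continuous_on UNIV g" "\<And>x. R < norm x \<Longrightarrow> g x = 0" and h: "h \<longlonglongrightarrow> 0"
  shows "(\<lambda>k. L2_dist2 (\<lambda>x. g (x + h k)) g) \<longlonglongrightarrow> 0"
proof -
  have [measurable]: "g \<in> borel_measurable borel" using g by (intro borel_measurable_continuous_onI)
  obtain H where H: "\<And>k. norm (h k) \<le> H"
    using convergent_imp_Bseq[OF convergentI[OF h]] by (elim BseqE) blast
  have [measurable]: "cball (0::'a) r \<in> sets borel" for r by simp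
  have "bounded (g ` cball 0 R)" using g(1) by (meson compact_cball compact_continuous_image compact_imp_bounded continuous_on_subset subset_UNIV)
  then obtain B where B: "\<forall>x\<in>cball 0 R. norm (g x) \<le> B" unfolding bounded_iff by auto
  have B': "norm (g x) \<le> \<bar>B\<bar>" for x using bspec[OF B, of x] g(2)[of x] by (cases "norm x \<le> R") auto
  have "(\<lambda>k. L2_dist2 (\<lambda>x. g (x + h k)) g) \<longlonglongrightarrow> (\<integral>\<^sup>+x. 0 \<partial>(lborel::'a measure))"
    unfolding L2_dist2_lborel
  proof (rule nn_integral_dominated_convergence[where w="\<lambda>x. ennreal ((2 * \<bar>B\<bar>)\<^sup>2) * indicator (cball 0 (R + H)) x"])
    show "(\<integral>\<^sup>+x. ennreal ((2 * \<bar>B\<bar>)\<^sup>2) * indicator (cball 0 (R + H)) x \<partial>(lborel::'a measure)) < \<infinity>"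
      using emeasure_lborel_cball_finite[of "0::'a" "R + H"]
      by (subst nn_integral_cmult_indicator) (auto simp: ennreal_mult_less_top)
    show "AE x in lborel. ennreal ((norm (g (x + h k) - g x))\<^sup>2) \<le> ennreal ((2 * \<bar>B\<bar>)\<^sup>2) * indicator (cball 0 (R + H)) x" for k
    proof (rule AE_I2)
      fix x
      show "ennreal ((norm (g (x + h k) - g x))\<^sup>2) \<le> ennreal ((2 * \<bar>B\<bar>)\<^sup>2) * indicator (cball 0 (R + H)) x"
      proof (cases "norm x \<le> R + H")
        case True
        have "norm (g (x + h k) - g x) \<le> 2 * \<bar>B\<bar>"
          using norm_triangle_ineq4[of "g (x + h k)" "g x"] B'[of x] B'[of "x + h k"] by linarith
        then have "(norm (g (x + h k) - g x))\<^sup>2 \<le> (2 * \<bar>B\<bar>)\<^sup>2" by (intro power_mono) auto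
        then show ?thesis using True by (simp add: ennreal_leI indicator_def)
      next
        case False
        have "norm x \<le> norm (x + h k) + norm (h k)" using norm_triangle_ineq4[of "x + h k" "h k"] by simp
        then have "R < norm (x + h k)" "R < norm x" using False H[of k] norm_ge_zero[of "h k"] by linarith+
        then show ?thesis using g(2) by simp
      qed
    qed
    show "AE x in lborel. (\<lambda>k. ennreal ((norm (g (x + h k) - g x))\<^sup>2)) \<longlonglongrightarrow> 0"
    proof (rule AE_I2)
      fix x
      have "(\<lambda>k. x + h k) \<longlonglongrightarrow> x" using tendsto_add[OF tendsto_const h, of x] by simp
      then have "(\<lambda>k. g (x + h k)) \<longlonglongrightarrow> g x" using continuous_on_tendsto_compose[OF g(1)] by simp
      then have "(\<lambda>k. (norm (g (x + h k) - g x))\<^sup>2) \<longlonglongrightarrow> (norm (g x - g x))\<^sup>2" by (intro tendsto_intros)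
      then show "(\<lambda>k. ennreal ((norm (g (x + h k) - g x))\<^sup>2)) \<longlonglongrightarrow> 0" using tendsto_ennrealI by fastforce
    qed
  qed (measurable)
  then show ?thesis by simp
qed

lemma translate_L2_tendsto:
  fixes f :: "'a::euclidean_space \<Rightarrow> complex"
  assumes f: "f \<in> L2_borel" and h: "h \<longlonglongrightarrow> 0"
  shows "(\<lambda>k. L2_dist2 (\<lambda>x. f (x + h k)) f) \<longlonglongrightarrow> 0"
proof (rule ennreal_tendsto_0I)
  fix e :: real assume e: "0 < e"
  have [measurable]: "f \<in> borel_measurable borel" using L2_borelD f by auto
  \<comment> \<open>Two uses of the triangle inequality with factor 2 count the distance from
    \<open>f\<close> to \<open>g\<close> 2 + 4 = 6 times, hence \<open>e/6\<close>.\<close>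
  obtain g R where g: "continuous_on UNIV g" "\<And>x. R < norm x \<Longrightarrow> g x = 0" and fg: "L2_dist2 f g < ennreal (e/6)"
    using L2_borel_dense[OF f, of "e/6"] e by auto
  have [measurable]: "g \<in> borel_measurable borel" using g by (intro borel_measurable_continuous_onI)
  let ?T = "\<lambda>k. L2_dist2 (\<lambda>x. g (x + h k)) g"
  have le: "L2_dist2 (\<lambda>x. f (x + h k)) f \<le> ennreal e + 2 * (2 * ?T k)" for k
  proof -
    have "L2_dist2 (\<lambda>x. f (x + h k)) f \<le> 2 * L2_dist2 (\<lambda>x. f (x + h k)) (\<lambda>x. g (x + h k)) + 2 * L2_dist2 (\<lambda>x. g (x + h k)) f"
      by (intro L2_dist2_triangle borel_measurable_lebesgueI) measurable
    also have "\<dots> \<le> 2 * L2_dist2 f g + 2 * (2 * ?T k + 2 * L2_dist2 g f)"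
      by (intro add_mono mult_left_mono L2_dist2_triangle borel_measurable_lebesgueI)
         (simp_all add: L2_dist2_translate)
    also have "\<dots> = (2 * L2_dist2 f g + 2 * (2 * L2_dist2 f g)) + 2 * (2 * ?T k)"
      by (simp only: L2_dist2_commute[of g f] distrib_left add_ac)
    also have "\<dots> \<le> (2 * ennreal (e/6) + 2 * (2 * ennreal (e/6))) + 2 * (2 * ?T k)"
      using fg by (intro add_mono mult_left_mono) auto
    also have "2 * ennreal (e/6) + 2 * (2 * ennreal (e/6)) = ennreal e" using e
      by (simp add: ennreal_mult[symmetric] ennreal_plus[symmetric] ennreal_numeral[symmetric] del: ennreal_numeral ennreal_plus)
    finally show ?thesis .
  qed
  have "(\<lambda>k. 2 * (2 * ?T k)) \<longlonglongrightarrow> 2 * (2 * 0)"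
    by (intro ennreal_tendsto_cmult continuous_translate_L2[OF g h]) auto
  then show "\<exists>c. c \<longlonglongrightarrow> 0 \<and> (\<forall>\<^sub>F k in sequentially. L2_dist2 (\<lambda>x. f (x + h k)) f \<le> ennreal e + c k)"
    using le by (intro exI[of _ "\<lambda>k. 2 * (2 * ?T k)"]) auto
qed


lemma borel_measurable_cnj [measurable]: "cnj \<in> borel_measurable borel"
  by (intro borel_measurable_continuous_onI continuous_intros)

section \<open>Plancherel's theorem on \<open>L\<^sup>1 \<inter> L\<^sup>2\<close>\<close>

lemma integrable_mult_L2:
  assumes f: "f \<in> L2_borel" and g: "g \<in> L2_borel"
  shows "integrable lborel (\<lambda>x. f x * g x)"
proof (rule Bochner_Integration.integrable_bound)
  show "integrable lborel (\<lambda>x. (norm (f x))\<^sup>2 + (norm (g x))\<^sup>2)"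
    using L2_borelD f g by (intro Bochner_Integration.integrable_add) auto
  show "(\<lambda>x. f x * g x) \<in> borel_measurable lborel"
    using L2_borelD(1)[OF f] L2_borelD(1)[OF g] by measurable
  have "norm a * norm b \<le> (norm a)\<^sup>2 + (norm b)\<^sup>2" for a b :: complex
    using sum_squares_bound[of "norm a" "norm b"] mult_nonneg_nonneg[of "norm a" "norm b"]
      norm_ge_zero[of a] norm_ge_zero[of b] by linarith
  then show "AE x in lborel. norm (f x * g x) \<le> norm ((norm (f x))\<^sup>2 + (norm (g x))\<^sup>2)"
    by (simp add: norm_mult)
qed

lemma L2_borel_cnj: "f \<in> L2_borel \<Longrightarrow> (\<lambda>x. cnj (f x)) \<in> L2_borel"
  unfolding L2_borel_def by (auto intro: measurable_compose[OF _ borel_measurable_cnj])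

lemma L2_borel_translate:
  assumes f: "f \<in> L2_borel"
  shows "(\<lambda>x. f (x + h)) \<in> L2_borel" "(\<integral>x. (norm (f (x + h)))\<^sup>2 \<partial>lborel) = (\<integral>x. (norm (f x))\<^sup>2 \<partial>lborel)"
proof -
  have [measurable]: "f \<in> borel_measurable borel" using L2_borelD f by auto
  show "(\<lambda>x. f (x + h)) \<in> L2_borel"
    using lborel_integrable_affine[of 1 "\<lambda>x. (norm (f x))\<^sup>2" h] L2_borelD(3)[OF f]
    by (simp add: L2_borel_def add.commute)
  show "(\<integral>x. (norm (f (x + h)))\<^sup>2 \<partial>lborel) = (\<integral>x. (norm (f x))\<^sup>2 \<partial>lborel)"
    using lborel_integral_affine[of 1 "\<lambda>x. (norm (f x))\<^sup>2" h] by (simp add: add.commute)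
qed

text \<open>Up to a reflection this is the convolution of \<open>f\<close> with its reflected
  conjugate. For integrable \<open>f\<close> its Fourier transform at \<open>\<xi>\<close> is the
  squared modulus of that of \<open>f\<close> at \<open>- \<xi>\<close>.\<close>

definition autocorr :: "('a::euclidean_space \<Rightarrow> complex) \<Rightarrow> 'a \<Rightarrow> complex" where
  "autocorr f h = (\<integral>x. f x * cnj (f (x + h)) \<partial>lborel)"

lemma borel_measurable_autocorr:
  assumes [measurable]: "f \<in> borel_measurable borel"
  shows "autocorr f \<in> borel_measurable borel"
  unfolding autocorr_def by (rule lborel.borel_measurable_lebesgue_integral) measurable

text \<open>Polarisation, \<open>2 * Re (a * cnj b)\<close> being the sum of the squared moduli
  minus that of \<open>b - a\<close>, together with translation invariance of the norm. It turns
  continuity of translation into continuity of the autocorrelation at 0.\<close>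

lemma Re_autocorr:
  assumes f: "f \<in> L2_borel"
  shows "\<bar>Re (autocorr f h)\<bar> \<le> (\<integral>x. (norm (f x))\<^sup>2 \<partial>lborel)"
    and "Re (autocorr f h) = (\<integral>x. (norm (f x))\<^sup>2 \<partial>lborel) - enn2real (L2_dist2 (\<lambda>x. f (x + h)) f) / 2"
proof -
  have fh: "(\<lambda>x. f (x + h)) \<in> L2_borel" using f by (rule L2_borel_translate)
  have [measurable]: "f \<in> borel_measurable borel" using L2_borelD f by auto
  have i: "integrable lborel (\<lambda>x. f x * cnj (f (x + h)))"
    by (rule integrable_mult_L2[OF f L2_borel_cnj[OF fh]])
  have i1: "integrable lborel (\<lambda>x. (norm (f x))\<^sup>2)" "integrable lborel (\<lambda>x. (norm (f (x + h)))\<^sup>2)"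
    using L2_borelD f fh by auto
  have R: "Re (autocorr f h) = (\<integral>x. Re (f x * cnj (f (x + h))) \<partial>lborel)"
    unfolding autocorr_def using i by (rule integral_Re[symmetric])
  have pt: "Re (a * cnj b) = ((norm a)\<^sup>2 + (norm b)\<^sup>2 - (norm (b - a))\<^sup>2) / 2" for a b :: complex
    unfolding cmod_power2 by (simp add: power2_eq_square algebra_simps)
  have pt': "\<bar>Re (a * cnj b)\<bar> \<le> ((norm a)\<^sup>2 + (norm b)\<^sup>2) / 2" for a b :: complex
    using sum_squares_bound[of "norm a" "norm b"] abs_Re_le_cmod[of "a * cnj b"] by (simp add: norm_mult)
  have "integrable lborel (\<lambda>x. (norm (f x))\<^sup>2 + (norm (f (x + h)))\<^sup>2 - 2 * Re (f x * cnj (f (x + h))))"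
    using i i1
    by (intro Bochner_Integration.integrable_diff Bochner_Integration.integrable_add
        integrable_mult_right integrable_Re) auto
  then have i2: "integrable lborel (\<lambda>x. (norm (f (x + h) - f x))\<^sup>2)" unfolding pt by (simp add: diff_divide_distrib add_divide_distrib)
  have "L2_dist2 (\<lambda>x. f (x + h)) f = ennreal (\<integral>x. (norm (f (x + h) - f x))\<^sup>2 \<partial>lborel)"
    unfolding L2_dist2_lborel using i2 by (intro nn_integral_eq_integral) auto
  then have d: "enn2real (L2_dist2 (\<lambda>x. f (x + h)) f) = (\<integral>x. (norm (f (x + h) - f x))\<^sup>2 \<partial>lborel)" by simp
  show "Re (autocorr f h) = (\<integral>x. (norm (f x))\<^sup>2 \<partial>lborel) - enn2real (L2_dist2 (\<lambda>x. f (x + h)) f) / 2"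
    unfolding R d pt using i1 i2 L2_borel_translate(2)[OF f, of h] by simp
  have "\<bar>Re (autocorr f h)\<bar> \<le> (\<integral>x. \<bar>Re (f x * cnj (f (x + h)))\<bar> \<partial>lborel)"
    unfolding R by (rule integral_abs_bound)
  also have "\<dots> \<le> (\<integral>x. ((norm (f x))\<^sup>2 + (norm (f (x + h)))\<^sup>2) / 2 \<partial>lborel)"
    using i1 pt' by (intro integral_mono integrable_abs integrable_Re i) auto
  also have "\<dots> = (\<integral>x. (norm (f x))\<^sup>2 \<partial>lborel)"
    using i1 L2_borel_translate(2)[OF f, of h] by simp
  finally show "\<bar>Re (autocorr f h)\<bar> \<le> (\<integral>x. (norm (f x))\<^sup>2 \<partial>lborel)" .
qed

lemma integral_gauss:
  assumes s: "0 < s"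
  shows "(\<integral>x. gauss s x \<partial>(lborel::'a::euclidean_space measure)) = (sqrt (2 * pi) / s) ^ DIM('a)"
proof -
  have "complex_of_real (\<integral>x. gauss s x \<partial>(lborel::'a measure)) = fourier_integral (\<lambda>x::'a. complex_of_real (gauss s x)) 0"
    by (subst fourier_integral_lborel) auto
  also have "\<dots> = complex_of_real ((sqrt (2 * pi) / s) ^ DIM('a))"
    unfolding fourier_integral_gauss[OF s] by (simp add: gauss_def)
  finally show ?thesis by (simp only: of_real_eq_iff)
qed

lemma fourier_integral_reflect_cnj:
  fixes f :: "'a::euclidean_space \<Rightarrow> complex"
  assumes [measurable]: "f \<in> borel_measurable borel"
  shows "fourier_integral (\<lambda>x. cnj (f (- x))) \<xi> = cnj (fourier_integral f \<xi>)"
proof -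
  have "fourier_integral (\<lambda>x. cnj (f (- x))) \<xi> = (\<integral>x. exp (- \<i> * complex_of_real (x \<bullet> \<xi>)) * cnj (f (- x)) \<partial>lborel)"
    by (rule fourier_integral_lborel) measurable
  also have "\<dots> = (\<integral>x. cnj (exp (- \<i> * complex_of_real (x \<bullet> \<xi>)) * f x) \<partial>lborel)"
    by (subst lborel_integral_affine[where c="-1" and t=0]) (auto simp: exp_cnj)
  also have "\<dots> = cnj (fourier_integral f \<xi>)"
    unfolding fourier_integral_lborel[OF assms] by (rule Bochner_Integration.integral_cnj)
  finally show ?thesis .
qed

lemma fourier_integral_modulate:
  assumes [measurable]: "f \<in> borel_measurable borel"
  shows "fourier_integral (\<lambda>x. exp (- \<i> * complex_of_real (x \<bullet> y)) * f x) \<xi> = fourier_integral f (\<xi> + y)"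
proof -
  have eq: "exp (- \<i> * complex_of_real (x \<bullet> \<xi>)) * (exp (- \<i> * complex_of_real (x \<bullet> y)) * f x) =
      exp (- \<i> * complex_of_real (x \<bullet> (\<xi> + y))) * f x" for x
    by (simp add: inner_add_right exp_add[symmetric] distrib_left mult.assoc[symmetric])
  have m: "(\<lambda>x. exp (- \<i> * complex_of_real (x \<bullet> y)) * f x) \<in> borel_measurable borel" by measurable
  show ?thesis unfolding fourier_integral_lborel[OF m] fourier_integral_lborel[OF assms] eq ..
qed

lemma integrable_reflect_cnj:
  assumes "integrable lborel f"
  shows "integrable lborel (\<lambda>x. cnj (f (- x)))"
  using lborel_integrable_affine[OF _ assms, of "-1" 0] by simp

text \<open>
  The weight makes the \<open>\<xi>\<close>-integral absolutely convergent. As \<open>s \<rightarrow> 0\<close> it increases to \<open>1\<close>, while on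
  the right the autocorrelation tends to its value at \<open>0\<close>, the squared norm of \<open>f\<close>.
\<close>

lemma fourier_gauss_weight:
  fixes f :: "'a::euclidean_space \<Rightarrow> complex"
  assumes f: "f \<in> L2_borel" "integrable lborel f" and s: "0 < s"
  shows "(\<integral>\<xi>. (norm (fourier_integral f \<xi>))\<^sup>2 * gauss s \<xi> \<partial>lborel) =
    sqrt (2 * pi) ^ DIM('a) * (\<integral>z. gauss 1 z * Re (autocorr f (s *\<^sub>R z)) \<partial>lborel)"
    and "integrable lborel (\<lambda>\<xi>. (norm (fourier_integral f \<xi>))\<^sup>2 * gauss s \<xi>)"
proof -
  let ?F = "fourier_integral f" and ?f' = "\<lambda>x. cnj (f (- x))"
  let ?c = "complex_of_real (sqrt (2 * pi) ^ DIM('a))"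
  have [measurable]: "f \<in> borel_measurable borel" using L2_borelD f by auto
  have f': "integrable lborel ?f'" using f(2) by (rule integrable_reflect_cnj)
  let ?B = "\<integral>x. norm (f x) \<partial>lborel"
  have FB: "norm (?F \<xi>) \<le> ?B" for \<xi> by (rule norm_fourier_integral_le[OF f(2)])
  have gi: "integrable lborel (gauss s :: 'a \<Rightarrow> real)" "integrable lborel (gauss 1 :: 'a \<Rightarrow> real)"
    using integrable_gauss[OF s] integrable_gauss[OF zero_less_one] by auto
  have h: "integrable lborel (\<lambda>\<xi>. cnj (?F \<xi>) * complex_of_real (gauss s \<xi>))"
    by (rule Bochner_Integration.integrable_bound[OF integrable_mult_right[OF gi(1), of ?B]])
       (auto simp: norm_mult abs_mult intro!: AE_I2 mult_right_mono FB)
  \<comment> \<open>\<open>cnj (?F \<xi>)\<close> is itself a transform, that of the reflected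
    conjugate \<open>?f'\<close>, so the multiplication formula moves the outer transform onto a
    modulated Gaussian, where it is explicit.\<close>
  have Fh: "fourier_integral (\<lambda>\<xi>. cnj (?F \<xi>) * complex_of_real (gauss s \<xi>)) x
      = ?c * (\<integral>z. cnj (f (x + s *\<^sub>R z)) * complex_of_real (gauss 1 z) \<partial>lborel)" for x
  proof -
    let ?g = "\<lambda>\<xi>. exp (- \<i> * complex_of_real (\<xi> \<bullet> x)) * complex_of_real (gauss s \<xi>)"
    have "fourier_integral (\<lambda>\<xi>. cnj (?F \<xi>) * complex_of_real (gauss s \<xi>)) x
        = (\<integral>\<xi>. fourier_integral ?f' \<xi> * ?g \<xi> \<partial>lborel)"
      by (subst fourier_integral_lborel) (auto simp: fourier_integral_reflect_cnj mult_ac)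
    also have "\<dots> = (\<integral>y. ?f' y * fourier_integral ?g y \<partial>lborel)"
      using gi by (intro fourier_integral_multiplication f' integrable_fourier_integrand) auto
    also have "\<dots> = (\<integral>y. ?f' y * complex_of_real ((sqrt (2 * pi) / s) ^ DIM('a) * gauss (1 / s) (y + x)) \<partial>lborel)"
      by (subst fourier_integral_modulate) (auto simp: fourier_integral_gauss[OF s])
    \<comment> \<open>The substitution \<open>y = - x - s *\<^sub>R z\<close> turns
      \<open>gauss (1 / s) (y + x)\<close> into \<open>gauss 1 z\<close>, and its Jacobian cancels
      the power of \<open>s\<close> in the transform of the Gaussian.\<close>
    also have "\<dots> = \<bar>- s\<bar> ^ DIM('a) *\<^sub>R (\<integral>z. ?f' (- x + (- s) *\<^sub>R z)
        * complex_of_real ((sqrt (2 * pi) / s) ^ DIM('a) * gauss (1 / s) (- x + (- s) *\<^sub>R z + x)) \<partial>lborel)"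
      using s by (intro lborel_integral_affine) auto
    also have "(\<lambda>z. ?f' (- x + (- s) *\<^sub>R z)
        * complex_of_real ((sqrt (2 * pi) / s) ^ DIM('a) * gauss (1 / s) (- x + (- s) *\<^sub>R z + x)))
        = (\<lambda>z. complex_of_real ((sqrt (2 * pi) / s) ^ DIM('a)) * (cnj (f (x + s *\<^sub>R z)) * complex_of_real (gauss 1 z)))"
      using s by (intro ext) (simp add: gauss_def power_mult_distrib mult_ac add_ac)
    finally show ?thesis using s
      by (simp add: power_divide scaleR_conv_of_real)
  qed
  \<comment> \<open>The integral in \<open>x\<close> of the absolute value is at most the squared
    norm of \<open>f\<close> times the Gaussian weight, uniformly in the shift, and the Gaussian is
    integrable in \<open>z\<close>.\<close>
  have prod: "integrable (lborel \<Otimes>\<^sub>M lborel) (\<lambda>(z, x). f x * cnj (f (x + s *\<^sub>R z)) * complex_of_real (gauss 1 z))"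
  proof (rule lborel_pair.Fubini_integrable)
    have ix: "integrable lborel (\<lambda>x. f x * cnj (f (x + s *\<^sub>R z)))" for z
      by (intro integrable_mult_L2 f L2_borel_cnj L2_borel_translate)
    show "AE z in lborel. integrable lborel (\<lambda>x. case (z, x) of (z, x) \<Rightarrow> f x * cnj (f (x + s *\<^sub>R z)) * complex_of_real (gauss 1 z))"
      using ix by (intro AE_I2) (auto intro!: integrable_mult_left)
    show "integrable lborel (\<lambda>z. \<integral>x. norm (case (z, x) of (z, x) \<Rightarrow> f x * cnj (f (x + s *\<^sub>R z)) * complex_of_real (gauss 1 z)) \<partial>lborel)"
    proof (rule Bochner_Integration.integrable_bound[OF integrable_mult_right[OF gi(2), of "\<integral>x. (norm (f x))\<^sup>2 \<partial>lborel"]])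
      have le: "norm a * norm b \<le> ((norm a)\<^sup>2 + (norm b)\<^sup>2) / 2" for a b :: complex
        using sum_squares_bound[of "norm a" "norm b"] by simp
      have b: "(\<integral>x. norm (f x) * norm (f (x + s *\<^sub>R z)) \<partial>lborel) \<le> (\<integral>x. (norm (f x))\<^sup>2 \<partial>lborel)" for z
      proof -
        note i = L2_borelD(3)[OF f(1)] L2_borelD(3)[OF L2_borel_translate(1)[OF f(1), of "s *\<^sub>R z"]]
        have "(\<integral>x. norm (f x) * norm (f (x + s *\<^sub>R z)) \<partial>lborel) \<le> (\<integral>x. ((norm (f x))\<^sup>2 + (norm (f (x + s *\<^sub>R z)))\<^sup>2) / 2 \<partial>lborel)"
          using i integrable_norm[OF ix[of z]] le by (intro integral_mono) (auto simp: norm_mult)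
        also have "\<dots> = (\<integral>x. (norm (f x))\<^sup>2 \<partial>lborel)"
          using i L2_borel_translate(2)[OF f(1), of "s *\<^sub>R z"] by simp
        finally show ?thesis .
      qed
      show "AE z in lborel. norm (\<integral>x. norm (case (z, x) of (z, x) \<Rightarrow> f x * cnj (f (x + s *\<^sub>R z)) * complex_of_real (gauss 1 z)) \<partial>lborel)
          \<le> norm ((\<integral>x. (norm (f x))\<^sup>2 \<partial>lborel) * gauss 1 z)"
      proof (rule AE_I2)
        fix z :: 'a
        have "0 \<le> (\<integral>x. norm (f x) * norm (f (x + s *\<^sub>R z)) \<partial>lborel)" by (rule integral_nonneg_AE) auto
        then show "norm (\<integral>x. norm (case (z, x) of (z, x) \<Rightarrow> f x * cnj (f (x + s *\<^sub>R z)) * complex_of_real (gauss 1 z)) \<partial>lborel)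
          \<le> norm ((\<integral>x. (norm (f x))\<^sup>2 \<partial>lborel) * gauss 1 z)"
          using b[of z] gauss_pos[of 1 z] by (auto simp: norm_mult abs_mult intro!: mult_right_mono)
      qed
    qed measurable
  qed measurable
  have sq: "complex_of_real ((norm z)\<^sup>2 * r) = z * (cnj z * complex_of_real r)" for z r
    by (simp only: of_real_mult complex_norm_square mult.assoc)
  have "complex_of_real (\<integral>\<xi>. (norm (?F \<xi>))\<^sup>2 * gauss s \<xi> \<partial>lborel)
      = (\<integral>\<xi>. ?F \<xi> * (cnj (?F \<xi>) * complex_of_real (gauss s \<xi>)) \<partial>lborel)"
    by (simp only: integral_complex_of_real[symmetric] sq)
  also have "\<dots> = (\<integral>x. f x * (?c * (\<integral>z. cnj (f (x + s *\<^sub>R z)) * complex_of_real (gauss 1 z) \<partial>lborel)) \<partial>lborel)"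
    unfolding fourier_integral_multiplication[OF f(2) h] Fh ..
  also have "\<dots> = ?c * (\<integral>x. (\<integral>z. f x * cnj (f (x + s *\<^sub>R z)) * complex_of_real (gauss 1 z) \<partial>lborel) \<partial>lborel)"
    by (simp add: integral_mult_right_zero[symmetric] mult_ac del: integral_mult_right_zero integral_mult_left_zero)
  also have "\<dots> = ?c * (\<integral>z. (\<integral>x. f x * cnj (f (x + s *\<^sub>R z)) * complex_of_real (gauss 1 z) \<partial>lborel) \<partial>lborel)"
    using lborel_pair.Fubini_integral[OF prod] by simp
  also have "\<dots> = ?c * (\<integral>z. autocorr f (s *\<^sub>R z) * complex_of_real (gauss 1 z) \<partial>lborel)"
    by (simp add: autocorr_def)
  finally have eq: "complex_of_real (\<integral>\<xi>. (norm (?F \<xi>))\<^sup>2 * gauss s \<xi> \<partial>lborel)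
      = ?c * (\<integral>z. autocorr f (s *\<^sub>R z) * complex_of_real (gauss 1 z) \<partial>lborel)" .
  have iz: "integrable lborel (\<lambda>z. autocorr f (s *\<^sub>R z) * complex_of_real (gauss 1 z))"
    using lborel_pair.integrable_fst'[OF prod] by (simp add: autocorr_def)
  have "(\<integral>\<xi>. (norm (?F \<xi>))\<^sup>2 * gauss s \<xi> \<partial>lborel) = Re (?c * (\<integral>z. autocorr f (s *\<^sub>R z) * complex_of_real (gauss 1 z) \<partial>lborel))"
    by (metis eq Re_complex_of_real)
  also have "\<dots> = sqrt (2 * pi) ^ DIM('a) * Re (\<integral>z. autocorr f (s *\<^sub>R z) * complex_of_real (gauss 1 z) \<partial>lborel)"
    by (simp del: of_real_power)
  also have "Re (\<integral>z. autocorr f (s *\<^sub>R z) * complex_of_real (gauss 1 z) \<partial>lborel) = (\<integral>z. gauss 1 z * Re (autocorr f (s *\<^sub>R z)) \<partial>lborel)"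
    by (subst integral_Re[OF iz, symmetric]) (simp add: mult.commute)
  finally show "(\<integral>\<xi>. (norm (?F \<xi>))\<^sup>2 * gauss s \<xi> \<partial>lborel) =
    sqrt (2 * pi) ^ DIM('a) * (\<integral>z. gauss 1 z * Re (autocorr f (s *\<^sub>R z)) \<partial>lborel)" .
  show "integrable lborel (\<lambda>\<xi>. (norm (fourier_integral f \<xi>))\<^sup>2 * gauss s \<xi>)"
    by (rule Bochner_Integration.integrable_bound[OF integrable_mult_right[OF gi(1), of "?B\<^sup>2"]])
       (use FB gauss_pos[of s] in \<open>auto simp: abs_mult intro!: mult_right_mono power_mono\<close>)
qed

text \<open>Along \<open>s = 1 / (k + 1)\<close> the autocorrelation side has an integrable
  majorant. The frequency side has none yet, since square integrability of the transform is part of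
  the claim; there monotone convergence is used, and finiteness comes out of the identity.\<close>

theorem plancherel_L1_L2:
  fixes f :: "'a::euclidean_space \<Rightarrow> complex"
  assumes f: "f \<in> L2_borel" "integrable lborel f"
  shows "(\<integral>\<^sup>+\<xi>. ennreal ((norm (fourier_integral f \<xi>))\<^sup>2) \<partial>lborel)
    = ennreal ((2 * pi) ^ DIM('a)) * (\<integral>\<^sup>+x. ennreal ((norm (f x))\<^sup>2) \<partial>lborel)"
proof -
  let ?F = "fourier_integral f" and ?N = "\<integral>x. (norm (f x))\<^sup>2 \<partial>lborel"
  let ?s = "\<lambda>k. inverse (real (Suc k))"
  let ?u = "\<lambda>k \<xi>. ennreal ((norm (?F \<xi>))\<^sup>2 * gauss (?s k) \<xi>)"
  have [measurable]: "f \<in> borel_measurable borel" using L2_borelD f by auto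
  have [measurable]: "autocorr f \<in> borel_measurable borel" by (rule borel_measurable_autocorr) fact
  have g1: "(\<integral>z. gauss 1 z \<partial>(lborel::'a measure)) = sqrt (2 * pi) ^ DIM('a)"
    using integral_gauss[OF zero_less_one, where 'a='a] unfolding div_by_1 .
  have s0: "?s \<longlonglongrightarrow> 0" by (rule LIMSEQ_inverse_real_of_nat)
  have "(\<lambda>k. \<integral>z. gauss 1 z * Re (autocorr f (?s k *\<^sub>R z)) \<partial>lborel) \<longlonglongrightarrow> (\<integral>z. gauss 1 z * ?N \<partial>(lborel::'a measure))"
  proof (rule integral_dominated_convergence[where w="\<lambda>z::'a. gauss 1 z * ?N"])
    show "integrable lborel (\<lambda>z::'a. gauss 1 z * ?N)" using integrable_gauss[of 1] by auto
    show "AE z in lborel. norm (gauss 1 z * Re (autocorr f (?s k *\<^sub>R z))) \<le> gauss 1 z * ?N" for k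
      using Re_autocorr(1)[OF f(1)]
      by (intro AE_I2)
         (simp add: abs_mult abs_of_pos[OF gauss_pos] mult_left_mono less_imp_le[OF gauss_pos])
    show "AE z in lborel. (\<lambda>k. gauss 1 z * Re (autocorr f (?s k *\<^sub>R z))) \<longlonglongrightarrow> gauss 1 z * ?N"
    proof (rule AE_I2)
      fix z :: 'a
      have "(\<lambda>k. ?s k *\<^sub>R z) \<longlonglongrightarrow> 0 *\<^sub>R z" by (intro tendsto_intros s0)
      then have "(\<lambda>k. L2_dist2 (\<lambda>x. f (x + ?s k *\<^sub>R z)) f) \<longlonglongrightarrow> 0"
        by (intro translate_L2_tendsto f) simp
      then have "(\<lambda>k. L2_dist2 (\<lambda>x. f (x + ?s k *\<^sub>R z)) f) \<longlonglongrightarrow> ennreal 0"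
        by (simp only: ennreal_0)
      then have E: "(\<lambda>k. enn2real (L2_dist2 (\<lambda>x. f (x + ?s k *\<^sub>R z)) f)) \<longlonglongrightarrow> 0"
        by (rule tendsto_enn2real) simp
      have "(\<lambda>k. gauss 1 z * (?N - enn2real (L2_dist2 (\<lambda>x. f (x + ?s k *\<^sub>R z)) f) / 2)) \<longlonglongrightarrow> gauss 1 z * (?N - 0 / 2)"
        by (intro tendsto_mult tendsto_diff tendsto_divide tendsto_const E) simp
      then show "(\<lambda>k. gauss 1 z * Re (autocorr f (?s k *\<^sub>R z))) \<longlonglongrightarrow> gauss 1 z * ?N"
        unfolding Re_autocorr(2)[OF f(1)] by simp
    qed
  qed measurable
  then have "(\<lambda>k. sqrt (2 * pi) ^ DIM('a) * (\<integral>z. gauss 1 z * Re (autocorr f (?s k *\<^sub>R z)) \<partial>lborel))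
      \<longlonglongrightarrow> sqrt (2 * pi) ^ DIM('a) * (\<integral>z. gauss 1 z * ?N \<partial>(lborel::'a measure))"
    by (intro tendsto_mult tendsto_const)
  also have "sqrt (2 * pi) ^ DIM('a) * (\<integral>z. gauss 1 z * ?N \<partial>(lborel::'a measure)) = (sqrt (2 * pi) * sqrt (2 * pi)) ^ DIM('a) * ?N"
    by (simp only: integral_mult_left_zero g1 power_mult_distrib mult.assoc)
  also have "sqrt (2 * pi) * sqrt (2 * pi) = 2 * pi" by simp
  finally have *: "(\<lambda>k. sqrt (2 * pi) ^ DIM('a) * (\<integral>z. gauss 1 z * Re (autocorr f (?s k *\<^sub>R z)) \<partial>lborel)) \<longlonglongrightarrow> (2 * pi) ^ DIM('a) * ?N" .
  have pos: "0 < ?s k" for k by simp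
  have lim: "(\<lambda>k. \<integral>\<xi>. (norm (?F \<xi>))\<^sup>2 * gauss (?s k) \<xi> \<partial>lborel) \<longlonglongrightarrow> (2 * pi) ^ DIM('a) * ?N"
    unfolding fourier_gauss_weight(1)[OF f pos] by (rule *)
  have l1: "(\<lambda>k. \<integral>\<^sup>+\<xi>. ?u k \<xi> \<partial>lborel) \<longlonglongrightarrow> ennreal ((2 * pi) ^ DIM('a) * ?N)"
  proof -
    have "(\<integral>\<^sup>+\<xi>. ?u k \<xi> \<partial>lborel) = ennreal (\<integral>\<xi>. (norm (?F \<xi>))\<^sup>2 * gauss (?s k) \<xi> \<partial>lborel)" for k
      by (rule nn_integral_eq_integral[OF fourier_gauss_weight(2)[OF f pos]])
         (simp add: less_imp_le[OF gauss_pos])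
    then show ?thesis using tendsto_ennrealI[OF lim] by (simp only:)
  qed
  have l2: "(\<lambda>k. \<integral>\<^sup>+\<xi>. ?u k \<xi> \<partial>lborel) \<longlonglongrightarrow> (\<integral>\<^sup>+\<xi>. ennreal ((norm (?F \<xi>))\<^sup>2) \<partial>lborel)"
  proof (rule nn_integral_LIMSEQ)
    have mono: "gauss (?s k) \<xi> \<le> gauss (?s l) \<xi>" if "k \<le> l" for k l and \<xi> :: 'a
    proof -
      have "?s l * norm \<xi> \<le> ?s k * norm \<xi>" using that by (intro mult_right_mono) (auto simp: field_simps)
      then have "(?s l * norm \<xi>)\<^sup>2 \<le> (?s k * norm \<xi>)\<^sup>2" by (intro power_mono) auto
      then show ?thesis by (simp add: gauss_def)
    qed
    show "incseq ?u"
      by (intro incseq_SucI le_funI ennreal_leI mult_left_mono mono le_SucI order_refl zero_le_power2)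
    show "(\<lambda>k. ?u k \<xi>) \<longlonglongrightarrow> ennreal ((norm (?F \<xi>))\<^sup>2)" for \<xi>
    proof -
      have "(\<lambda>k. (norm (?F \<xi>))\<^sup>2 * gauss (?s k) \<xi>) \<longlonglongrightarrow> (norm (?F \<xi>))\<^sup>2 * exp (- (0 * norm \<xi>)\<^sup>2 / 2)"
        unfolding gauss_def
        by (intro tendsto_mult tendsto_const tendsto_exp tendsto_divide tendsto_minus tendsto_power s0) simp
      from tendsto_ennrealI[OF this] show ?thesis by simp
    qed
  qed measurable
  have "(\<integral>\<^sup>+\<xi>. ennreal ((norm (?F \<xi>))\<^sup>2) \<partial>lborel) = ennreal ((2 * pi) ^ DIM('a) * ?N)"
    by (rule LIMSEQ_unique[OF l2 l1])
  then show ?thesis by (simp add: L2_borelD(5)[OF f(1)] ennreal_mult)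
qed


section \<open>The Fourier transform on \<open>L\<^sup>2\<close>\<close>

lemma L2_spaceD:
  assumes "f \<in> L2_space"
  shows "f \<in> borel_measurable lebesgue" "integrable lebesgue (\<lambda>x. (norm (f x))\<^sup>2)"
    "(\<integral>\<^sup>+x. ennreal ((norm (f x))\<^sup>2) \<partial>lebesgue) < \<infinity>"
    "(\<integral>\<^sup>+x. ennreal ((norm (f x))\<^sup>2) \<partial>lebesgue) = ennreal ((L2_norm f)\<^sup>2)"
proof -
  show *: "f \<in> borel_measurable lebesgue" "integrable lebesgue (\<lambda>x. (norm (f x))\<^sup>2)"
    using assms by (auto simp: L2_space_def)
  show **: "(\<integral>\<^sup>+x. ennreal ((norm (f x))\<^sup>2) \<partial>lebesgue) = ennreal ((L2_norm f)\<^sup>2)"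
    unfolding L2_norm_def using * by (subst nn_integral_eq_integral) auto
  show "(\<integral>\<^sup>+x. ennreal ((norm (f x))\<^sup>2) \<partial>lebesgue) < \<infinity>" unfolding ** by simp
qed

lemma L2_spaceI:
  assumes [measurable]: "f \<in> borel_measurable lebesgue" and "(\<integral>\<^sup>+x. ennreal ((norm (f x))\<^sup>2) \<partial>lebesgue) < \<infinity>"
  shows "f \<in> L2_space"
  using assms by (auto simp: L2_space_def integrable_iff_bounded)

lemma L2_borel_imp_L2_space: "f \<in> L2_borel \<Longrightarrow> f \<in> L2_space"
  by (intro L2_spaceI) (auto simp: nn_integral_completion dest: L2_borelD)

lemma L2_space_AE_eq_borel:
  assumes f: "f \<in> L2_space"
  obtains g where "g \<in> L2_borel" "AE x in lebesgue. f x = g x"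
proof -
  obtain g where g: "g \<in> borel_measurable borel" and fg: "AE x in lebesgue. f x = g x"
    using lebesgue_AE_eq_borel[OF L2_spaceD(1)[OF f]] .
  have "(\<integral>\<^sup>+x. ennreal ((norm (g x))\<^sup>2) \<partial>lborel) = (\<integral>\<^sup>+x. ennreal ((norm (f x))\<^sup>2) \<partial>lebesgue)"
    unfolding nn_integral_completion[symmetric, of lborel] using fg by (intro nn_integral_cong_AE) auto
  then show ?thesis using that[OF L2_borelI[OF g] fg] L2_spaceD(3)[OF f] by simp
qed

lemma L2_dist2_cong_AE:
  assumes "AE x in lebesgue. f x = f' x" "AE x in lebesgue. g x = g' x"
  shows "L2_dist2 f g = L2_dist2 f' g'"
  unfolding L2_dist2_def using assms by (intro nn_integral_cong_AE) auto

section \<open>Truncations and linear combinations\<close>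

abbreviation trunc :: "real \<Rightarrow> ('a::euclidean_space \<Rightarrow> complex) \<Rightarrow> 'a \<Rightarrow> complex" where
  "trunc R f \<equiv> (\<lambda>x. indicator (cball 0 R) x * f x)"

lemma indicator_cball_borel [measurable]:
  "(indicator (cball (a::'a::euclidean_space) R) :: 'a \<Rightarrow> complex) \<in> borel_measurable borel"
  by (intro borel_measurable_indicator) simp

lemma trunc_lebesgue:
  assumes "f \<in> borel_measurable lebesgue"
  shows "trunc R f \<in> borel_measurable lebesgue"
  by (intro borel_measurable_times borel_measurable_lebesgueI assms) measurable

lemma norm_trunc_le: "norm (trunc R f x) \<le> norm (f x)"
  by (simp add: indicator_def norm_mult)

text \<open>A truncation is a product of two square integrable functions, one of them the indicator
  of a ball, and so it is integrable and has a convergent Fourier integral.\<close>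

lemma trunc_L2_borel:
  fixes f :: "'a::euclidean_space \<Rightarrow> complex"
  assumes f: "f \<in> L2_borel"
  shows "trunc R f \<in> L2_borel" "integrable lborel (trunc R f)"
proof -
  have [measurable]: "f \<in> borel_measurable borel" using L2_borelD f by auto
  have "(\<integral>\<^sup>+x. ennreal ((norm (trunc R f x))\<^sup>2) \<partial>lborel) \<le> (\<integral>\<^sup>+x. ennreal ((norm (f x))\<^sup>2) \<partial>lborel)"
    by (intro nn_integral_mono ennreal_leI power_mono norm_trunc_le) auto
  then show *: "trunc R f \<in> L2_borel" using L2_borelD(4)[OF f] by (intro L2_borelI) auto
  have "(\<integral>\<^sup>+x. ennreal ((norm (indicator (cball (0::'a) R) x :: complex))\<^sup>2) \<partial>lborel) = emeasure lborel (cball (0::'a) R)"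
  proof -
    have "(\<integral>\<^sup>+x. ennreal ((norm (indicator (cball (0::'a) R) x :: complex))\<^sup>2) \<partial>lborel) = (\<integral>\<^sup>+x. indicator (cball (0::'a) R) x \<partial>lborel)"
      by (intro nn_integral_cong) (simp split: split_indicator)
    then show ?thesis by simp
  qed
  then have "(\<lambda>x. indicator (cball (0::'a) R) x :: complex) \<in> L2_borel"
    using emeasure_lborel_cball_finite[of "0::'a" R] by (intro L2_borelI) auto
  then show "integrable lborel (trunc R f)" using f by (rule integrable_mult_L2)
qed

lemma fourier_trunc_L2_borel:
  assumes f: "f \<in> L2_borel"
  shows "fourier_integral (trunc R f) \<in> L2_borel"
proof -
  have [measurable]: "f \<in> borel_measurable borel" using L2_borelD f by auto
  show ?thesis
    using plancherel_L1_L2[OF trunc_L2_borel[OF f], of R] L2_borelD(4)[OF trunc_L2_borel(1)[OF f]]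
    by (intro L2_borelI) (auto simp: ennreal_mult_less_top)
qed

lemma fourier_integral_diff_cmult:
  assumes f: "integrable lborel f" and g: "integrable lborel g"
  shows "fourier_integral (\<lambda>x. f x - c * g x) \<xi> = fourier_integral f \<xi> - c * fourier_integral g \<xi>"
proof -
  have [measurable]: "f \<in> borel_measurable borel" "g \<in> borel_measurable borel" using f g by auto
  have "fourier_integral (\<lambda>x. f x - c * g x) \<xi> = (\<integral>x. exp (- \<i> * complex_of_real (x \<bullet> \<xi>)) * (f x - c * g x) \<partial>lborel)"
    by (rule fourier_integral_lborel) measurable
  also have "\<dots> = (\<integral>x. exp (- \<i> * complex_of_real (x \<bullet> \<xi>)) * f x - c * (exp (- \<i> * complex_of_real (x \<bullet> \<xi>)) * g x) \<partial>lborel)"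
    by (simp only: right_diff_distrib mult.left_commute)
  also have "\<dots> = (\<integral>x. exp (- \<i> * complex_of_real (x \<bullet> \<xi>)) * f x \<partial>lborel) - c * (\<integral>x. exp (- \<i> * complex_of_real (x \<bullet> \<xi>)) * g x \<partial>lborel)"
    by (subst Bochner_Integration.integral_diff)
       (intro integrable_fourier_integrand integrable_mult_right f g | simp only: integral_mult_right_zero)+
  also have "\<dots> = fourier_integral f \<xi> - c * fourier_integral g \<xi>"
    unfolding fourier_integral_lborel[OF \<open>f \<in> borel_measurable borel\<close>] fourier_integral_lborel[OF \<open>g \<in> borel_measurable borel\<close>] ..
  finally show ?thesis .
qed

lemma L2_dist2_fourier_integral:
  fixes f g :: "'a::euclidean_space \<Rightarrow> complex"
  assumes f: "f \<in> L2_borel" "integrable lborel f" and g: "g \<in> L2_borel" "integrable lborel g"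
  shows "L2_dist2 (fourier_integral f) (fourier_integral g) = ennreal ((2 * pi) ^ DIM('a)) * L2_dist2 f g"
proof -
  have [measurable]: "f \<in> borel_measurable borel" "g \<in> borel_measurable borel" using f g by auto
  have "L2_dist2 f g \<le> 2 * L2_dist2 f (\<lambda>x. 0) + 2 * L2_dist2 (\<lambda>x. 0) g"
    by (intro L2_dist2_triangle borel_measurable_lebesgueI) measurable
  also have "\<dots> < \<infinity>"
    using L2_borelD(4)[OF f(1)] L2_borelD(4)[OF g(1)]
    by (auto simp: L2_dist2_lborel ennreal_mult_less_top)
  finally have d: "(\<lambda>x. f x - 1 * g x) \<in> L2_borel"
    by (intro L2_borelI) (auto simp: L2_dist2_lborel)
  have "(\<lambda>\<xi>. fourier_integral (\<lambda>x. f x - 1 * g x) \<xi>) = (\<lambda>\<xi>. fourier_integral f \<xi> - 1 * fourier_integral g \<xi>)"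
    by (intro ext fourier_integral_diff_cmult f g)
  moreover have "(\<integral>\<^sup>+\<xi>. ennreal ((norm (fourier_integral (\<lambda>x. f x - 1 * g x) \<xi>))\<^sup>2) \<partial>lborel)
      = ennreal ((2 * pi) ^ DIM('a)) * (\<integral>\<^sup>+x. ennreal ((norm (f x - 1 * g x))\<^sup>2) \<partial>lborel)"
    using f g by (intro plancherel_L1_L2 d) auto
  ultimately show ?thesis by (simp add: L2_dist2_lborel fun_eq_iff)
qed

lemma L2_dist2_trunc_tendsto:
  fixes f :: "'a::euclidean_space \<Rightarrow> complex"
  assumes f: "f \<in> L2_space"
  shows "((\<lambda>R. L2_dist2 (trunc R f) f) \<longlongrightarrow> 0) at_top"
proof (rule tendsto_at_topI_sequentially)
  fix X :: "nat \<Rightarrow> real" assume X: "filterlim X at_top sequentially"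
  note m = L2_spaceD(1)[OF f] trunc_lebesgue[OF L2_spaceD(1)[OF f]]
  have "(\<lambda>k. L2_dist2 (trunc (X k) f) f) \<longlonglongrightarrow> (\<integral>\<^sup>+x. 0 \<partial>(lebesgue :: 'a measure))"
    unfolding L2_dist2_def
  proof (rule nn_integral_dominated_convergence[where w="\<lambda>x. ennreal ((norm (f x))\<^sup>2)"])
    show "AE x in lebesgue. ennreal ((norm (trunc (X k) f x - f x))\<^sup>2) \<le> ennreal ((norm (f x))\<^sup>2)" for k
      by (intro AE_I2 ennreal_leI power_mono) (auto simp: indicator_def)
    show "AE x in lebesgue. (\<lambda>k. ennreal ((norm (trunc (X k) f x - f x))\<^sup>2)) \<longlonglongrightarrow> 0"
    proof (rule AE_I2)
      fix x :: 'a
      have "\<forall>\<^sub>F k in sequentially. norm x \<le> X k" using X by (simp add: filterlim_at_top)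
      then have "\<forall>\<^sub>F k in sequentially. ennreal ((norm (trunc (X k) f x - f x))\<^sup>2) = 0"
        by eventually_elim (simp add: indicator_def)
      then show "(\<lambda>k. ennreal ((norm (trunc (X k) f x - f x))\<^sup>2)) \<longlonglongrightarrow> 0" by (rule tendsto_eventually)
    qed
  qed (use m L2_spaceD(3)[OF f] in \<open>auto intro!: borel_measurable_diff\<close>)
  then show "(\<lambda>k. L2_dist2 (trunc (X k) f) f) \<longlonglongrightarrow> 0" by simp
qed

text \<open>The truncations converge to \<open>f\<close> in the mean, and Plancherel's identity for
  differences carries this convergence to their Fourier integrals.\<close>

lemma has_fourier_L2_L1:
  fixes f :: "'a::euclidean_space \<Rightarrow> complex"
  assumes f: "f \<in> L2_borel" "integrable lborel f"
  shows "has_fourier_L2 f (fourier_integral f)"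
  unfolding has_fourier_L2_def L2_tendsto_iff
proof (intro conjI)
  have [measurable]: "f \<in> borel_measurable borel" using L2_borelD f by auto
  show "f \<in> L2_space" by (rule L2_borel_imp_L2_space[OF f(1)])
  have "fourier_integral f \<in> L2_borel"
    using plancherel_L1_L2[OF f] L2_borelD(4)[OF f(1)]
    by (intro L2_borelI) (auto simp: ennreal_mult_less_top)
  then show "fourier_integral f \<in> L2_space" by (rule L2_borel_imp_L2_space)
  have "((\<lambda>R. ennreal ((2 * pi) ^ DIM('a)) * L2_dist2 (trunc R f) f) \<longlongrightarrow> ennreal ((2 * pi) ^ DIM('a)) * 0) at_top"
    by (intro ennreal_tendsto_cmult L2_dist2_trunc_tendsto L2_borel_imp_L2_space f) auto
  then show "((\<lambda>R. L2_dist2 (fourier_integral (trunc R f)) (fourier_integral f)) \<longlongrightarrow> 0) at_top"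
    by (subst L2_dist2_fourier_integral[OF trunc_L2_borel[OF f(1)] f]) simp
qed

lemma has_fourier_L2_cong:
  assumes "AE x in lebesgue. f x = f' x" "f' \<in> borel_measurable lebesgue"
    "AE x in lebesgue. g x = g' x" "g' \<in> borel_measurable lebesgue"
    and fg: "has_fourier_L2 f g"
  shows "has_fourier_L2 f' g'"
proof -
  have fgL: "f \<in> L2_space" "g \<in> L2_space" and lim: "((\<lambda>R. L2_dist2 (fourier_integral (trunc R f)) g) \<longlongrightarrow> 0) at_top"
    using fg by (auto simp: has_fourier_L2_def L2_tendsto_iff)
  have cong: "h' \<in> L2_space" if "AE x in lebesgue. h x = h' x" "h' \<in> borel_measurable lebesgue" "h \<in> L2_space" for h h' :: "'a \<Rightarrow> complex"
  proof (rule L2_spaceI)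
    have "(\<integral>\<^sup>+x. ennreal ((norm (h' x))\<^sup>2) \<partial>lebesgue) = (\<integral>\<^sup>+x. ennreal ((norm (h x))\<^sup>2) \<partial>lebesgue)"
      using that(1) by (intro nn_integral_cong_AE) auto
    then show "(\<integral>\<^sup>+x. ennreal ((norm (h' x))\<^sup>2) \<partial>lebesgue) < \<infinity>" using L2_spaceD(3)[OF that(3)] by simp
  qed fact
  have tr: "fourier_integral (trunc R f) = fourier_integral (trunc R f')" for R
    using assms(1,2) L2_spaceD(1)[OF fgL(1)]
    by (intro fourier_integral_cong_AE trunc_lebesgue) auto
  have "L2_dist2 (fourier_integral (trunc R f)) g = L2_dist2 (fourier_integral (trunc R f')) g'" for R
    unfolding tr using assms(3) by (intro L2_dist2_cong_AE) auto
  then show ?thesis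
    using lim cong[OF assms(1,2) fgL(1)] cong[OF assms(3,4) fgL(2)]
    by (simp add: has_fourier_L2_def L2_tendsto_iff)
qed

lemma L2_space_diff_cmult:
  assumes f: "f \<in> L2_space" and g: "g \<in> L2_space"
  shows "(\<lambda>x. f x - c * g x) \<in> L2_space"
proof (rule L2_spaceI)
  note [measurable] = L2_spaceD(1)[OF f] L2_spaceD(1)[OF g]
  show "(\<lambda>x. f x - c * g x) \<in> borel_measurable lebesgue" by measurable
  have "L2_dist2 f (\<lambda>x. c * g x) \<le> 2 * L2_dist2 f (\<lambda>x. 0) + 2 * L2_dist2 (\<lambda>x. 0) (\<lambda>x. c * g x)"
    by (intro L2_dist2_triangle) measurable
  also have "L2_dist2 (\<lambda>x. 0) (\<lambda>x. c * g x) = ennreal ((norm c)\<^sup>2) * (\<integral>\<^sup>+x. ennreal ((norm (g x))\<^sup>2) \<partial>lebesgue)"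
    unfolding L2_dist2_def by (subst nn_integral_cmult[symmetric]) (auto simp: norm_mult power_mult_distrib ennreal_mult)
  also have "2 * L2_dist2 f (\<lambda>x. 0) + 2 * \<dots> < \<infinity>"
    using L2_spaceD(3)[OF f] L2_spaceD(3)[OF g] by (auto simp: L2_dist2_def ennreal_mult_less_top)
  finally show "(\<integral>\<^sup>+x. ennreal ((norm (f x - c * g x))\<^sup>2) \<partial>lebesgue) < \<infinity>"
    by (simp add: L2_dist2_def)
qed

lemma L2_dist2_diff_cmult_le:
  assumes [measurable]: "f \<in> borel_measurable lebesgue" "g \<in> borel_measurable lebesgue"
    "f' \<in> borel_measurable lebesgue" "g' \<in> borel_measurable lebesgue"
  shows "L2_dist2 (\<lambda>x. f x - c * g x) (\<lambda>x. f' x - c * g' x) \<le> 2 * L2_dist2 f f' + 2 * (ennreal ((norm c)\<^sup>2) * L2_dist2 g g')"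
proof -
  have "L2_dist2 (\<lambda>x. f x - c * g x) (\<lambda>x. f' x - c * g' x)
      \<le> 2 * L2_dist2 (\<lambda>x. f x - c * g x) (\<lambda>x. f' x - c * g x) + 2 * L2_dist2 (\<lambda>x. f' x - c * g x) (\<lambda>x. f' x - c * g' x)"
    by (intro L2_dist2_triangle) measurable
  also have "L2_dist2 (\<lambda>x. f x - c * g x) (\<lambda>x. f' x - c * g x) = L2_dist2 f f'"
    by (simp add: L2_dist2_def)
  also have "L2_dist2 (\<lambda>x. f' x - c * g x) (\<lambda>x. f' x - c * g' x) = ennreal ((norm c)\<^sup>2) * L2_dist2 g g'"
    unfolding L2_dist2_def
    by (subst nn_integral_cmult[symmetric])
       (auto simp: ennreal_mult[symmetric] power_mult_distrib[symmetric] norm_mult[symmetric] right_diff_distrib norm_minus_commute)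
  finally show ?thesis .
qed

text \<open>The form \<open>f - c * g\<close> covers two uses of linearity: \<open>c = 1\<close>
  gives uniqueness of the transform, and \<open>c\<close> the mean of \<open>u1\<close> gives the
  transform of the difference in the final estimate.\<close>

lemma has_fourier_L2_diff_cmult:
  fixes f g :: "'a::euclidean_space \<Rightarrow> complex"
  assumes f: "has_fourier_L2 f f'" and g: "has_fourier_L2 g g'"
  shows "has_fourier_L2 (\<lambda>x. f x - c * g x) (\<lambda>\<xi>. f' \<xi> - c * g' \<xi>)"
proof -
  have L: "f \<in> L2_space" "f' \<in> L2_space" "g \<in> L2_space" "g' \<in> L2_space"
    and lim: "((\<lambda>R. L2_dist2 (fourier_integral (trunc R f)) f') \<longlongrightarrow> 0) at_top"
      "((\<lambda>R. L2_dist2 (fourier_integral (trunc R g)) g') \<longlongrightarrow> 0) at_top"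
    using f g by (auto simp: has_fourier_L2_def L2_tendsto_iff)
  obtain fb gb where b: "fb \<in> L2_borel" "AE x in lebesgue. f x = fb x" "gb \<in> L2_borel" "AE x in lebesgue. g x = gb x"
    using L2_space_AE_eq_borel L(1,3) by metis
  have [measurable]: "fb \<in> borel_measurable borel" "gb \<in> borel_measurable borel" using b L2_borelD(1) by auto
  have mf: "fourier_integral (trunc R f) \<in> borel_measurable lebesgue"
    if "f \<in> L2_space" "fb \<in> L2_borel" "AE x in lebesgue. f x = fb x" for R f and fb :: "'a \<Rightarrow> complex"
  proof -
    have [measurable]: "fb \<in> borel_measurable borel" using L2_borelD that by auto
    have "fourier_integral (trunc R f) = fourier_integral (trunc R fb)"
      using that L2_spaceD(1) L2_borelD(2) by (intro fourier_integral_cong_AE trunc_lebesgue) auto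
    then show ?thesis by (auto intro!: borel_measurable_lebesgueI)
  qed
  have eq: "fourier_integral (trunc R (\<lambda>x. f x - c * g x)) = (\<lambda>\<xi>. fourier_integral (trunc R f) \<xi> - c * fourier_integral (trunc R g) \<xi>)" for R
  proof -
    note [measurable] = L2_spaceD(1)[OF L(1)] L2_spaceD(1)[OF L(3)]
    have m: "(\<lambda>x. f x - c * g x) \<in> borel_measurable lebesgue" by measurable
    have mb: "(\<lambda>x. fb x - c * gb x) \<in> borel_measurable lebesgue" by (rule borel_measurable_lebesgueI) measurable
    have "fourier_integral (trunc R (\<lambda>x. f x - c * g x)) = fourier_integral (trunc R (\<lambda>x. fb x - c * gb x))"
      using b by (intro fourier_integral_cong_AE trunc_lebesgue m mb) auto
    also have "\<dots> = fourier_integral (\<lambda>x. trunc R fb x - c * trunc R gb x)" by (simp add: algebra_simps)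
    also have "\<dots> = (\<lambda>\<xi>. fourier_integral (trunc R fb) \<xi> - c * fourier_integral (trunc R gb) \<xi>)"
      by (intro ext fourier_integral_diff_cmult trunc_L2_borel b)
    also have "fourier_integral (trunc R fb) = fourier_integral (trunc R f)"
      using b L2_borelD(2) L2_spaceD(1) L by (intro fourier_integral_cong_AE trunc_lebesgue) auto
    also have "fourier_integral (trunc R gb) = fourier_integral (trunc R g)"
      using b L2_borelD(2) L2_spaceD(1) L by (intro fourier_integral_cong_AE trunc_lebesgue) auto
    finally show ?thesis .
  qed
  have "((\<lambda>R. L2_dist2 (fourier_integral (trunc R (\<lambda>x. f x - c * g x))) (\<lambda>\<xi>. f' \<xi> - c * g' \<xi>)) \<longlongrightarrow> 0) at_top"
  proof (rule tendsto_sandwich[OF _ _ tendsto_const])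
    show "\<forall>\<^sub>F R in at_top. L2_dist2 (fourier_integral (trunc R (\<lambda>x. f x - c * g x))) (\<lambda>\<xi>. f' \<xi> - c * g' \<xi>)
        \<le> 2 * L2_dist2 (fourier_integral (trunc R f)) f' + 2 * (ennreal ((norm c)\<^sup>2) * L2_dist2 (fourier_integral (trunc R g)) g')"
      unfolding eq
      by (intro always_eventually allI L2_dist2_diff_cmult_le mf[OF L(1) b(1,2)] mf[OF L(3) b(3,4)] L2_spaceD(1)[OF L(2)] L2_spaceD(1)[OF L(4)])
    have "((\<lambda>R. 2 * L2_dist2 (fourier_integral (trunc R f)) f' + 2 * (ennreal ((norm c)\<^sup>2) * L2_dist2 (fourier_integral (trunc R g)) g'))
        \<longlongrightarrow> 2 * 0 + 2 * (ennreal ((norm c)\<^sup>2) * 0)) at_top"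
      by (intro tendsto_add ennreal_tendsto_cmult lim) auto
    then show "((\<lambda>R. 2 * L2_dist2 (fourier_integral (trunc R f)) f' + 2 * (ennreal ((norm c)\<^sup>2) * L2_dist2 (fourier_integral (trunc R g)) g'))
        \<longlongrightarrow> 0) at_top" by simp
  qed simp
  then show ?thesis
    using L by (auto simp: has_fourier_L2_def L2_tendsto_iff intro!: L2_space_diff_cmult)
qed


section \<open>Existence of the transform by completeness\<close>

lemma L2_fast_Cauchy_AE_convergent:
  fixes F :: "nat \<Rightarrow> 'a::euclidean_space \<Rightarrow> complex"
  assumes [measurable]: "\<And>k. F k \<in> borel_measurable borel"
    and d: "\<And>k. L2_dist2 (F (Suc k)) (F k) \<le> ennreal ((1/8) ^ k)"
  shows "AE x in lborel. convergent (\<lambda>k. F k x)"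
proof -
  let ?a = "\<lambda>k x. ennreal (2 ^ k * (norm (F (Suc k) x - F k x))\<^sup>2)"
  \<comment> \<open>The weights \<open>2\<^sup>k\<close> make \<open>\<Sum>\<^sub>k a\<^sub>k(x) < \<infinity>\<close> imply summability of the increments without squares.\<close>
  have "(\<integral>\<^sup>+x. (\<Sum>k. ?a k x) \<partial>lborel) = (\<Sum>k. \<integral>\<^sup>+x. ?a k x \<partial>lborel)"
    by (intro nn_integral_suminf) measurable
  also have "\<dots> \<le> (\<Sum>k. ennreal ((1/4) ^ k))"
  proof (intro suminf_le)
    fix k
    have "(\<integral>\<^sup>+x. ?a k x \<partial>lborel) = ennreal (2 ^ k) * L2_dist2 (F (Suc k)) (F k)"
      unfolding L2_dist2_lborel by (simp add: ennreal_mult nn_integral_cmult)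
    also have "\<dots> \<le> ennreal (2 ^ k) * ennreal ((1/8) ^ k)"
      by (intro mult_left_mono d) simp
    also have "\<dots> = ennreal (2 ^ k * (1/8) ^ k)" by (simp add: ennreal_mult)
    also have "(2 ^ k * (1/8) ^ k :: real) = (1/4) ^ k" by (subst power_mult_distrib[symmetric]) simp
    finally show "(\<integral>\<^sup>+x. ?a k x \<partial>lborel) \<le> ennreal ((1/4) ^ k)" .
  qed simp_all
  also have "\<dots> = ennreal (\<Sum>k. (1/4) ^ k)"
    by (intro suminf_ennreal2 summable_geometric) simp_all
  also have "\<dots> < \<infinity>" by simp
  finally have "AE x in lborel. (\<Sum>k. ?a k x) \<noteq> \<infinity>"
    by (intro nn_integral_PInf_AE) auto
  then show ?thesis
  proof eventually_elim
    case (elim x)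
    define S where "S = (\<Sum>k. ?a k x)"
    have "S \<noteq> top" using elim unfolding S_def infinity_ennreal_def .
    then obtain C where C: "S = ennreal C" "0 \<le> C"
      by (cases S) auto
    have B: "norm (F (Suc k) x - F k x) \<le> sqrt C * (1 / sqrt 2) ^ k" for k
    proof -
      have "(\<Sum>j\<in>{k}. ?a j x) \<le> S" unfolding S_def by (rule sum_le_suminf) simp_all
      then have "?a k x \<le> ennreal C" unfolding C(1) by simp
      then have "2 ^ k * (norm (F (Suc k) x - F k x))\<^sup>2 \<le> C"
        unfolding ennreal_le_iff[OF C(2)] .
      then have "(norm (F (Suc k) x - F k x))\<^sup>2 \<le> C / 2 ^ k"
        by (simp add: pos_le_divide_eq mult.commute)
      then have "norm (F (Suc k) x - F k x) \<le> sqrt (C / 2 ^ k)" by (rule real_le_rsqrt)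
      also have "sqrt (C / 2 ^ k) = sqrt C * (1 / sqrt 2) ^ k"
        by (simp add: real_sqrt_divide real_sqrt_power power_one_over)
      finally show ?thesis .
    qed
    have "summable (\<lambda>k. sqrt C * (1 / sqrt 2) ^ k)"
      by (intro summable_mult summable_geometric) simp
    then have "summable (\<lambda>k. F (Suc k) x - F k x)"
      by (rule summable_comparison_test') (rule B)
    then have "(\<lambda>n. \<Sum>k<n. F (Suc k) x - F k x) \<longlonglongrightarrow> (\<Sum>k. F (Suc k) x - F k x)"
      by (rule summable_LIMSEQ)
    then have "(\<lambda>n. F n x - F 0 x) \<longlonglongrightarrow> (\<Sum>k. F (Suc k) x - F k x)"
      by (simp only: sum_lessThan_telescope[of "\<lambda>k. F k x"])
    from tendsto_add[OF this tendsto_const[of "F 0 x"]]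
    have "(\<lambda>n. F n x) \<longlonglongrightarrow> (\<Sum>k. F (Suc k) x - F k x) + F 0 x"
      by (simp only: diff_add_cancel)
    then show ?case by (rule convergentI)
  qed
qed

text \<open>The Riesz-Fischer argument for the family of transformed truncations: radii with rapidly
  decreasing distances give a pointwise limit \<open>g\<close>, and Fatou's lemma shows that the
  whole family converges to \<open>g\<close> in the mean.\<close>

lemma has_fourier_L2_ex_borel:
  fixes f :: "'a::euclidean_space \<Rightarrow> complex"
  assumes f: "f \<in> L2_borel"
  shows "\<exists>g. has_fourier_L2 f g"
proof -
  let ?F = "\<lambda>R. fourier_integral (trunc R f)"
  \<comment> \<open>\<open>\<Theta>\<close> is chosen so that \<open>\<Theta> R + \<Theta> S\<close>
    bounds the squared distance of two transformed truncations: the power of \<open>2 * pi\<close>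
    is Plancherel's factor and the 2 comes from the triangle inequality.\<close>
  define \<Theta> where "\<Theta> R = ennreal ((2 * pi) ^ DIM('a)) * (2 * L2_dist2 (trunc R f) f)" for R
  have [measurable]: "f \<in> borel_measurable borel" using L2_borelD f by auto
  note FB = fourier_trunc_L2_borel[OF f]
  have "(\<Theta> \<longlongrightarrow> ennreal ((2 * pi) ^ DIM('a)) * (2 * 0)) at_top"
    unfolding \<Theta>_def by (intro ennreal_tendsto_cmult L2_dist2_trunc_tendsto L2_borel_imp_L2_space f) auto
  then have \<Theta>0: "(\<Theta> \<longlongrightarrow> 0) at_top" by simp
  have \<Theta>_le: "L2_dist2 (?F R) (?F S) \<le> \<Theta> R + \<Theta> S" for R S
  proof -
    have "L2_dist2 (?F R) (?F S) = ennreal ((2 * pi) ^ DIM('a)) * L2_dist2 (trunc R f) (trunc S f)"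
      by (intro L2_dist2_fourier_integral trunc_L2_borel f)
    also have "\<dots> \<le> ennreal ((2 * pi) ^ DIM('a)) * (2 * L2_dist2 (trunc R f) f + 2 * L2_dist2 f (trunc S f))"
      by (intro mult_left_mono L2_dist2_triangle L2_borelD(2) trunc_L2_borel f) simp
    also have "\<dots> = \<Theta> R + \<Theta> S"
      unfolding \<Theta>_def L2_dist2_commute[of f] distrib_left ..
    finally show ?thesis .
  qed
  have "\<exists>R. \<Theta> R < ennreal ((1/8) ^ Suc k)" for k
    using order_tendstoD(2)[OF \<Theta>0, of "ennreal ((1/8) ^ Suc k)"]
    by (auto simp: eventually_at_top_linorder)
  then obtain \<rho> where \<rho>: "\<And>k. \<Theta> (\<rho> k) < ennreal ((1/8) ^ Suc k)"
    by (atomize_elim, intro choice allI)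
  have d: "L2_dist2 (?F (\<rho> (Suc k))) (?F (\<rho> k)) \<le> ennreal ((1/8) ^ k)" for k
  proof -
    have "L2_dist2 (?F (\<rho> (Suc k))) (?F (\<rho> k)) \<le> ennreal ((1/8) ^ Suc (Suc k)) + ennreal ((1/8) ^ Suc k)"
      by (rule order_trans[OF \<Theta>_le add_mono[OF less_imp_le[OF \<rho>] less_imp_le[OF \<rho>]]])
    also have "\<dots> = ennreal ((1/8) ^ Suc (Suc k) + (1/8) ^ Suc k)" by (rule ennreal_plus[symmetric]) auto
    also have "\<dots> \<le> ennreal ((1/8) ^ k)" by (intro ennreal_leI) simp
    finally show ?thesis .
  qed
  define g where "g x = lim (\<lambda>k. ?F (\<rho> k) x)" for x
  have [measurable]: "g \<in> borel_measurable borel" unfolding g_def by measurable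
  have "AE x in lborel. convergent (\<lambda>k. ?F (\<rho> k) x)"
    using d by (intro L2_fast_Cauchy_AE_convergent) auto
  then have lim: "AE x in lborel. (\<lambda>k. ?F (\<rho> k) x) \<longlonglongrightarrow> g x"
    by (simp add: g_def convergent_LIMSEQ_iff)
  \<comment> \<open>Letting \<open>S\<close> run through the radii \<open>\<rho> k\<close> in the
    Cauchy estimate, Fatou's lemma replaces the second truncation by the pointwise limit, while
    \<open>\<Theta> (\<rho> k)\<close> vanishes.\<close>
  have le: "L2_dist2 (?F R) g \<le> \<Theta> R" for R
  proof -
    have "L2_dist2 (?F R) g = (\<integral>\<^sup>+x. liminf (\<lambda>k. ennreal ((norm (?F R x - ?F (\<rho> k) x))\<^sup>2)) \<partial>lborel)"
      unfolding L2_dist2_lborel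
    proof (rule nn_integral_cong_AE)
      show "AE x in lborel. ennreal ((norm (?F R x - g x))\<^sup>2) = liminf (\<lambda>k. ennreal ((norm (?F R x - ?F (\<rho> k) x))\<^sup>2))"
        using lim
      proof eventually_elim
        case (elim x)
        have "(\<lambda>k. (norm (?F R x - ?F (\<rho> k) x))\<^sup>2) \<longlonglongrightarrow> (norm (?F R x - g x))\<^sup>2"
          by (intro tendsto_intros elim)
        from lim_imp_Liminf[OF _ tendsto_ennrealI[OF this]] show ?case by simp
      qed
    qed
    also have "\<dots> \<le> liminf (\<lambda>k. L2_dist2 (?F R) (?F (\<rho> k)))"
      unfolding L2_dist2_lborel by (intro nn_integral_liminf) measurable
    also have "\<dots> \<le> liminf (\<lambda>k. \<Theta> R + ennreal ((1/8) ^ Suc k))"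
      by (intro Liminf_mono always_eventually allI)
         (rule order_trans[OF \<Theta>_le add_left_mono[OF less_imp_le[OF \<rho>]]])
    also have "\<dots> = \<Theta> R + ennreal 0"
    proof (rule lim_imp_Liminf)
      have "(\<lambda>k. (1/8::real) ^ Suc k) \<longlonglongrightarrow> 0" by (rule LIMSEQ_Suc[OF LIMSEQ_power_zero]) simp
      from tendsto_ennrealI[OF this]
      show "(\<lambda>k. \<Theta> R + ennreal ((1/8) ^ Suc k)) \<longlonglongrightarrow> \<Theta> R + ennreal 0"
        by (intro tendsto_add tendsto_const)
    qed simp
    finally show ?thesis by simp
  qed
  have "(\<integral>\<^sup>+x. ennreal ((norm (g x))\<^sup>2) \<partial>lborel) = L2_dist2 g (\<lambda>x. 0)" by (simp add: L2_dist2_lborel)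
  also have "\<dots> \<le> 2 * L2_dist2 g (?F (\<rho> 0)) + 2 * L2_dist2 (?F (\<rho> 0)) (\<lambda>x. 0)"
    by (intro L2_dist2_triangle borel_measurable_lebesgueI) measurable
  also have "\<dots> < \<infinity>"
  proof -
    have "L2_dist2 g (?F (\<rho> 0)) < \<infinity>"
      unfolding L2_dist2_commute[of g] infinity_ennreal_def
      by (rule le_less_trans[OF le less_trans[OF \<rho> ennreal_less_top]])
    moreover have "L2_dist2 (?F (\<rho> 0)) (\<lambda>x. 0) < \<infinity>"
      using L2_borelD(4)[OF FB[of "\<rho> 0"]] by (simp add: L2_dist2_lborel)
    ultimately show ?thesis by (simp add: ennreal_mult_less_top)
  qed
  finally have "g \<in> L2_borel" by (intro L2_borelI) auto
  moreover have "((\<lambda>R. L2_dist2 (?F R) g) \<longlongrightarrow> 0) at_top"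
    by (rule tendsto_sandwich[OF _ _ tendsto_const \<Theta>0]) (use le in auto)
  ultimately show ?thesis
    using f by (auto simp: has_fourier_L2_def L2_tendsto_iff intro!: L2_borel_imp_L2_space)
qed

lemma has_fourier_L2_ex:
  assumes "f \<in> L2_space"
  shows "\<exists>g. has_fourier_L2 f g"
proof -
  obtain fb where fb: "fb \<in> L2_borel" "AE x in lebesgue. f x = fb x"
    using L2_space_AE_eq_borel[OF assms] .
  obtain g where g: "has_fourier_L2 fb g" using has_fourier_L2_ex_borel[OF fb(1)] by blast
  have "has_fourier_L2 f g"
    by (rule has_fourier_L2_cong[OF _ _ _ _ g])
       (use fb assms g in \<open>auto simp: has_fourier_L2_def dest: L2_spaceD(1)\<close>)
  then show ?thesis by blast
qed

section \<open>Plancherel's identity and uniqueness on the whole space\<close>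

lemma nn_L2_trunc_tendsto:
  fixes f :: "'a::euclidean_space \<Rightarrow> complex"
  assumes f: "f \<in> L2_space"
  shows "((\<lambda>R. \<integral>\<^sup>+x. ennreal ((norm (trunc R f x))\<^sup>2) \<partial>lebesgue) \<longlongrightarrow> (\<integral>\<^sup>+x. ennreal ((norm (f x))\<^sup>2) \<partial>lebesgue)) at_top"
proof (rule tendsto_at_topI_sequentially)
  fix X :: "nat \<Rightarrow> real" assume X: "filterlim X at_top sequentially"
  note m = L2_spaceD(1)[OF f] trunc_lebesgue[OF L2_spaceD(1)[OF f]]
  show "(\<lambda>k. \<integral>\<^sup>+x. ennreal ((norm (trunc (X k) f x))\<^sup>2) \<partial>lebesgue) \<longlonglongrightarrow> (\<integral>\<^sup>+x. ennreal ((norm (f x))\<^sup>2) \<partial>lebesgue)"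
  proof (rule nn_integral_dominated_convergence[where w="\<lambda>x. ennreal ((norm (f x))\<^sup>2)"])
    show "AE x in lebesgue. ennreal ((norm (trunc (X k) f x))\<^sup>2) \<le> ennreal ((norm (f x))\<^sup>2)" for k
      by (intro AE_I2 ennreal_leI power_mono norm_trunc_le) auto
    show "AE x in lebesgue. (\<lambda>k. ennreal ((norm (trunc (X k) f x))\<^sup>2)) \<longlonglongrightarrow> ennreal ((norm (f x))\<^sup>2)"
    proof (rule AE_I2)
      fix x :: 'a
      have "\<forall>\<^sub>F k in sequentially. norm x \<le> X k" using X by (simp add: filterlim_at_top)
      then have "\<forall>\<^sub>F k in sequentially. ennreal ((norm (trunc (X k) f x))\<^sup>2) = ennreal ((norm (f x))\<^sup>2)"
        by eventually_elim (simp add: indicator_def)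
      then show "(\<lambda>k. ennreal ((norm (trunc (X k) f x))\<^sup>2)) \<longlonglongrightarrow> ennreal ((norm (f x))\<^sup>2)" by (rule tendsto_eventually)
    qed
  qed (use m L2_spaceD(3)[OF f] in \<open>auto intro!: borel_measurable_diff\<close>)
qed

text \<open>The triangle inequality with factor 2 would lose the exact constant in Plancherel's
  identity. Splitting the mixed term as \<open>2 * p * q \<le> e * p\<^sup>2 + q\<^sup>2 / e\<close>
  leaves a factor arbitrarily close to 1 in front of the norm of \<open>b\<close>.\<close>

lemma nn_L2_le:
  fixes a b :: "'a::euclidean_space \<Rightarrow> complex"
  assumes [measurable]: "a \<in> borel_measurable lebesgue" "b \<in> borel_measurable lebesgue" and e: "0 < e"
  shows "(\<integral>\<^sup>+x. ennreal ((norm (a x))\<^sup>2) \<partial>lebesgue) \<le>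
    ennreal (1 + e) * (\<integral>\<^sup>+x. ennreal ((norm (b x))\<^sup>2) \<partial>lebesgue) + ennreal (1 + 1 / e) * L2_dist2 a b"
proof -
  have "(\<integral>\<^sup>+x. ennreal ((norm (a x))\<^sup>2) \<partial>lebesgue)
      \<le> (\<integral>\<^sup>+x. ennreal (1 + e) * ennreal ((norm (b x))\<^sup>2) + ennreal (1 + 1 / e) * ennreal ((norm (a x - b x))\<^sup>2) \<partial>lebesgue)"
  proof (rule nn_integral_mono)
    fix x
    let ?p = "norm (b x)" and ?q = "norm (a x - b x)"
    have "norm (a x) \<le> ?p + ?q" using norm_triangle_ineq[of "b x" "a x - b x"] by simp
    then have "(norm (a x))\<^sup>2 \<le> (?p + ?q)\<^sup>2" by (intro power_mono) auto
    moreover have "0 \<le> (e * ?p - ?q)\<^sup>2 / e" using e by simp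
    then have "2 * ?p * ?q \<le> e * ?p\<^sup>2 + ?q\<^sup>2 / e"
      using e by (simp add: power2_diff power_mult_distrib field_simps power2_eq_square)
    ultimately have "(norm (a x))\<^sup>2 \<le> (1 + e) * ?p\<^sup>2 + (1 + 1 / e) * ?q\<^sup>2"
      by (simp add: power2_sum distrib_right)
    then have "ennreal ((norm (a x))\<^sup>2) \<le> ennreal ((1 + e) * ?p\<^sup>2 + (1 + 1 / e) * ?q\<^sup>2)"
      by (rule ennreal_leI)
    then show "ennreal ((norm (a x))\<^sup>2) \<le> ennreal (1 + e) * ennreal (?p\<^sup>2) + ennreal (1 + 1 / e) * ennreal (?q\<^sup>2)"
      using e by (simp add: ennreal_plus ennreal_mult del: ennreal_plus[symmetric])
  qed
  also have "\<dots> = ennreal (1 + e) * (\<integral>\<^sup>+x. ennreal ((norm (b x))\<^sup>2) \<partial>lebesgue) + ennreal (1 + 1 / e) * L2_dist2 a b"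
    unfolding L2_dist2_def by (simp add: nn_integral_add nn_integral_cmult)
  finally show ?thesis .
qed

lemma ennreal_le_of_le_factor:
  assumes "\<And>e::real. 0 < e \<Longrightarrow> A \<le> ennreal (1 + e) * B"
  shows "A \<le> B"
proof (cases "B = \<infinity>")
  case False
  have "(\<lambda>k. 1 + inverse (real (Suc k))) \<longlonglongrightarrow> 1 + 0"
    by (intro tendsto_add tendsto_const LIMSEQ_inverse_real_of_nat)
  from tendsto_ennrealI[OF this] have "(\<lambda>k. B * ennreal (1 + inverse (real (Suc k)))) \<longlonglongrightarrow> B * ennreal (1 + 0)"
    using False by (intro ennreal_tendsto_cmult) (auto simp: less_top)
  then have "(\<lambda>k. B * ennreal (1 + inverse (real (Suc k)))) \<longlonglongrightarrow> B" by simp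
  then show ?thesis
    by (rule LIMSEQ_le_const) (use assms in \<open>auto simp: mult.commute\<close>)
qed simp

text \<open>Continuity of the norm under convergence in the mean: \<open>nn_L2_le\<close> is used in
  both directions, with \<open>R\<close> tending to infinity before \<open>e\<close> tends to
  0.\<close>

lemma nn_L2_limit_unique:
  fixes a :: "real \<Rightarrow> 'a::euclidean_space \<Rightarrow> complex"
  assumes m: "\<And>R. a R \<in> borel_measurable lebesgue" "b \<in> borel_measurable lebesgue"
    and d: "((\<lambda>R. L2_dist2 (a R) b) \<longlongrightarrow> 0) at_top"
    and A: "((\<lambda>R. \<integral>\<^sup>+x. ennreal ((norm (a R x))\<^sup>2) \<partial>lebesgue) \<longlongrightarrow> A) at_top"
  shows "(\<integral>\<^sup>+x. ennreal ((norm (b x))\<^sup>2) \<partial>lebesgue) = A"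
proof (rule antisym; rule ennreal_le_of_le_factor)
  fix e :: real assume e: "0 < e"
  let ?b = "\<integral>\<^sup>+x. ennreal ((norm (b x))\<^sup>2) \<partial>lebesgue" and ?a = "\<lambda>R. \<integral>\<^sup>+x. ennreal ((norm (a R x))\<^sup>2) \<partial>lebesgue"
  have d': "((\<lambda>R. ennreal (1 + 1 / e) * L2_dist2 (a R) b) \<longlongrightarrow> 0) at_top"
    using ennreal_tendsto_cmult[OF _ d, of "ennreal (1 + 1/e)"] by simp
  have "((\<lambda>R. ennreal (1 + e) * ?a R + ennreal (1 + 1 / e) * L2_dist2 (a R) b) \<longlongrightarrow> ennreal (1 + e) * A + 0) at_top"
    by (intro tendsto_add ennreal_tendsto_cmult A d') auto
  from tendsto_le[OF trivial_limit_at_top_linorder this tendsto_const]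
  show "?b \<le> ennreal (1 + e) * A"
    using nn_L2_le[OF m(2) m(1) e] by (simp add: L2_dist2_commute)
  have "((\<lambda>R. ennreal (1 + e) * ?b + ennreal (1 + 1 / e) * L2_dist2 (a R) b) \<longlongrightarrow> ennreal (1 + e) * ?b + 0) at_top"
    by (intro tendsto_add tendsto_const d')
  from tendsto_le[OF trivial_limit_at_top_linorder this A]
  show "A \<le> ennreal (1 + e) * ?b"
    using nn_L2_le[OF m(1) m(2) e] by simp
qed

theorem plancherel_L2:
  fixes f g :: "'a::euclidean_space \<Rightarrow> complex"
  assumes fg: "has_fourier_L2 f g"
  shows "(\<integral>\<^sup>+\<xi>. ennreal ((norm (g \<xi>))\<^sup>2) \<partial>lebesgue)
    = ennreal ((2 * pi) ^ DIM('a)) * (\<integral>\<^sup>+x. ennreal ((norm (f x))\<^sup>2) \<partial>lebesgue)"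
proof (rule nn_L2_limit_unique)
  have f: "f \<in> L2_space" and g: "g \<in> L2_space"
    and lim: "((\<lambda>R. L2_dist2 (fourier_integral (trunc R f)) g) \<longlongrightarrow> 0) at_top"
    using fg by (auto simp: has_fourier_L2_def L2_tendsto_iff)
  obtain fb where fb: "fb \<in> L2_borel" "AE x in lebesgue. f x = fb x"
    using L2_space_AE_eq_borel[OF f] .
  have [measurable]: "fb \<in> borel_measurable borel" using L2_borelD fb by auto
  have tr: "fourier_integral (trunc R f) = fourier_integral (trunc R fb)" for R
    using fb L2_spaceD(1)[OF f] L2_borelD(2)[OF fb(1)]
    by (intro fourier_integral_cong_AE trunc_lebesgue) auto
  show "fourier_integral (trunc R f) \<in> borel_measurable lebesgue" for R
    unfolding tr by (rule L2_borelD(2)[OF fourier_trunc_L2_borel[OF fb(1)]])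
  show "g \<in> borel_measurable lebesgue" by (rule L2_spaceD(1)[OF g])
  show "((\<lambda>R. L2_dist2 (fourier_integral (trunc R f)) g) \<longlongrightarrow> 0) at_top" by (rule lim)
  have "(\<integral>\<^sup>+\<xi>. ennreal ((norm (fourier_integral (trunc R f) \<xi>))\<^sup>2) \<partial>lebesgue)
      = ennreal ((2 * pi) ^ DIM('a)) * (\<integral>\<^sup>+x. ennreal ((norm (trunc R f x))\<^sup>2) \<partial>lebesgue)" for R
  proof -
    have "(\<integral>\<^sup>+x. ennreal ((norm (trunc R f x))\<^sup>2) \<partial>lebesgue) = (\<integral>\<^sup>+x. ennreal ((norm (trunc R fb x))\<^sup>2) \<partial>lebesgue)"
      using fb(2) by (intro nn_integral_cong_AE) auto
    then show ?thesis
      unfolding tr by (simp add: nn_integral_completion plancherel_L1_L2[OF trunc_L2_borel[OF fb(1)]])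
  qed
  then show "((\<lambda>R. \<integral>\<^sup>+\<xi>. ennreal ((norm (fourier_integral (trunc R f) \<xi>))\<^sup>2) \<partial>lebesgue)
      \<longlongrightarrow> ennreal ((2 * pi) ^ DIM('a)) * (\<integral>\<^sup>+x. ennreal ((norm (f x))\<^sup>2) \<partial>lebesgue)) at_top"
    using ennreal_tendsto_cmult[OF _ nn_L2_trunc_tendsto[OF f], of "ennreal ((2 * pi) ^ DIM('a))"] by simp
qed

text \<open>The difference of two transforms is a transform of \<open>f - f\<close>, so its norm is
  0 by Plancherel. This is what identifies the function chosen by \<open>fourier_L2\<close> with one
  that has been computed.\<close>

lemma has_fourier_L2_unique:
  fixes f g :: "'a::euclidean_space \<Rightarrow> complex"
  assumes "has_fourier_L2 f g" "has_fourier_L2 f g'"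
  shows "AE \<xi> in lebesgue. g \<xi> = g' \<xi>"
proof -
  have *: "has_fourier_L2 (\<lambda>x. f x - 1 * f x) (\<lambda>\<xi>. g \<xi> - 1 * g' \<xi>)"
    by (rule has_fourier_L2_diff_cmult[OF assms])
  then have m: "(\<lambda>\<xi>. g \<xi> - g' \<xi>) \<in> borel_measurable lebesgue"
    by (auto simp: has_fourier_L2_def dest: L2_spaceD(1))
  have "(\<integral>\<^sup>+\<xi>. ennreal ((norm (g \<xi> - g' \<xi>))\<^sup>2) \<partial>lebesgue) = 0"
    using plancherel_L2[OF *] by simp
  then show ?thesis using m by (subst (asm) nn_integral_0_iff_AE) auto
qed

lemma has_fourier_L2_fourier_L2: "f \<in> L2_space \<Longrightarrow> has_fourier_L2 f (fourier_L2 f)"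
  unfolding fourier_L2_def using has_fourier_L2_ex by (rule someI_ex)

section \<open>Inversion for integrable and square integrable kernels\<close>

lemma fourier_integral_cnj:
  assumes [measurable]: "f \<in> borel_measurable borel"
  shows "fourier_integral (\<lambda>x. cnj (f x)) \<xi> = cnj (fourier_integral f (- \<xi>))"
proof -
  have "fourier_integral (\<lambda>x. cnj (f x)) \<xi> = (\<integral>x. exp (- \<i> * complex_of_real (x \<bullet> \<xi>)) * cnj (f x) \<partial>lborel)"
    by (rule fourier_integral_lborel) measurable
  also have "\<dots> = (\<integral>x. cnj (exp (- \<i> * complex_of_real (x \<bullet> (- \<xi>))) * f x) \<partial>lborel)"
    by (simp add: exp_cnj)
  also have "\<dots> = cnj (fourier_integral f (- \<xi>))"
    unfolding fourier_integral_lborel[OF assms] by (rule Bochner_Integration.integral_cnj)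
  finally show ?thesis .
qed

lemma integral_plancherel_L1_L2:
  fixes f :: "'a::euclidean_space \<Rightarrow> complex"
  assumes f: "f \<in> L2_borel" "integrable lborel f"
  shows "fourier_integral f \<in> L2_borel"
    and "(\<integral>\<xi>. (norm (fourier_integral f \<xi>))\<^sup>2 \<partial>lborel) = (2 * pi) ^ DIM('a) * (\<integral>x. (norm (f x))\<^sup>2 \<partial>lborel)"
proof -
  have [measurable]: "f \<in> borel_measurable borel" using L2_borelD f by auto
  show F: "fourier_integral f \<in> L2_borel"
    using plancherel_L1_L2[OF f] L2_borelD(4)[OF f(1)]
    by (intro L2_borelI) (auto simp: ennreal_mult_less_top)
  have "ennreal (\<integral>\<xi>. (norm (fourier_integral f \<xi>))\<^sup>2 \<partial>lborel) = ennreal ((2 * pi) ^ DIM('a) * (\<integral>x. (norm (f x))\<^sup>2 \<partial>lborel))"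
    using plancherel_L1_L2[OF f] unfolding L2_borelD(5)[OF F] L2_borelD(5)[OF f(1)] by (simp add: ennreal_mult)
  then show "(\<integral>\<xi>. (norm (fourier_integral f \<xi>))\<^sup>2 \<partial>lborel) = (2 * pi) ^ DIM('a) * (\<integral>x. (norm (f x))\<^sup>2 \<partial>lborel)"
    by (subst (asm) ennreal_inj) auto
qed

text \<open>The witness is the usual inversion integral, but no pointwise inversion formula enters.
  The squared distance of the transformed truncation to \<open>K\<close> equals the squared norm of
  \<open>K\<close> minus \<open>(2 * pi)\<^sup>n\<close> times that of the truncation, and
  Plancherel for \<open>K\<close> makes this tend to 0. It is applied to
  \<open>profile t\<close>.\<close>

theorem fourier_inversion_L1_L2:
  fixes K :: "'a::euclidean_space \<Rightarrow> complex"
  assumes K: "K \<in> L2_borel" "integrable lborel K"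
  shows "\<exists>f. has_fourier_L2 f K"
proof -
  let ?c = "(2 * pi) ^ DIM('a)"
  define f where "f x = fourier_integral K (- x) / complex_of_real ?c" for x
  have c: "0 < ?c" by simp
  have [measurable]: "K \<in> borel_measurable borel" using L2_borelD K by auto
  have [measurable]: "f \<in> borel_measurable borel" unfolding f_def by measurable
  note FK = integral_plancherel_L1_L2[OF K]
  have fsq: "(norm (f x))\<^sup>2 = (norm (fourier_integral K (0 + (-1) *\<^sub>R x)))\<^sup>2 / ?c\<^sup>2" for x
    unfolding f_def norm_divide norm_of_real power_divide power2_abs by simp
  have f: "f \<in> L2_borel"
    unfolding L2_borel_def using L2_borelD(3)[OF FK(1)]
      lborel_integrable_affine[where t=0 and c="-1" and f="\<lambda>x. (norm (fourier_integral K x))\<^sup>2"]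
    by (simp add: fsq)
  have "(\<integral>x. (norm (fourier_integral K x))\<^sup>2 \<partial>lborel) = \<bar>-1\<bar> ^ DIM('a) *\<^sub>R (\<integral>x. (norm (fourier_integral K (0 + (-1) *\<^sub>R x)))\<^sup>2 \<partial>lborel)"
    by (rule lborel_integral_affine) auto
  then have "(\<integral>x. (norm (f x))\<^sup>2 \<partial>lborel) = (?c * (\<integral>x. (norm (K x))\<^sup>2 \<partial>lborel)) / ?c\<^sup>2"
    unfolding fsq FK(2)[symmetric] by simp
  then have Nf: "?c * (\<integral>x. (norm (f x))\<^sup>2 \<partial>lborel) = (\<integral>x. (norm (K x))\<^sup>2 \<partial>lborel)"
    using c by (simp add: power2_eq_square)
  let ?T = "\<lambda>R. \<integral>x. (norm (trunc R f x))\<^sup>2 \<partial>lborel"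
  \<comment> \<open>Expanding the square, the cross term is computed by the multiplication formula, since the
    transform of \<open>cnj K\<close> is a multiple of \<open>cnj f\<close>.\<close>
  have "L2_dist2 (fourier_integral (trunc R f)) K = ennreal ((\<integral>x. (norm (K x))\<^sup>2 \<partial>lborel) - ?c * ?T R)" for R
  proof -
    let ?F = "fourier_integral (trunc R f)"
    note FR = integral_plancherel_L1_L2[OF trunc_L2_borel[OF f, of R]]
    have Kc: "(\<lambda>\<xi>. cnj (K \<xi>)) \<in> L2_borel" "integrable lborel (\<lambda>\<xi>. cnj (K \<xi>))"
      using L2_borel_cnj K by auto
    have i: "integrable lborel (\<lambda>\<xi>. ?F \<xi> * cnj (K \<xi>))" by (rule integrable_mult_L2[OF FR(1) Kc(1)])
    have FKc: "fourier_integral (\<lambda>\<xi>. cnj (K \<xi>)) x = complex_of_real ?c * cnj (f x)" for x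
      by (subst fourier_integral_cnj) (simp_all add: f_def)
    have "(\<integral>\<xi>. ?F \<xi> * cnj (K \<xi>) \<partial>lborel) = (\<integral>x. trunc R f x * (complex_of_real ?c * cnj (f x)) \<partial>lborel)"
      unfolding fourier_integral_multiplication[OF trunc_L2_borel(2)[OF f] Kc(2)] FKc ..
    also have "\<dots> = (\<integral>x. complex_of_real (?c * (norm (trunc R f x))\<^sup>2) \<partial>lborel)"
      by (intro Bochner_Integration.integral_cong refl)
         (simp add: complex_norm_square[unfolded of_real_power] split: split_indicator)
    also have "\<dots> = complex_of_real (?c * ?T R)" by (simp only: integral_complex_of_real integral_mult_right_zero)
    finally have M: "(\<integral>\<xi>. Re (?F \<xi> * cnj (K \<xi>)) \<partial>lborel) = ?c * ?T R"
      by (subst integral_Re[OF i]) simp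
    have pt: "(norm (a - b))\<^sup>2 = (norm a)\<^sup>2 + (norm b)\<^sup>2 - 2 * Re (a * cnj b)" for a b :: complex
      unfolding cmod_power2 by (simp add: power2_eq_square algebra_simps)
    have sq1: "integrable lborel (\<lambda>\<xi>. (norm (?F \<xi>))\<^sup>2)" "integrable lborel (\<lambda>\<xi>. (norm (K \<xi>))\<^sup>2)"
      using L2_borelD(3)[OF FR(1)] L2_borelD(3)[OF K(1)] by auto
    have sq: "integrable lborel (\<lambda>\<xi>. (norm (?F \<xi>))\<^sup>2)" "integrable lborel (\<lambda>\<xi>. (norm (K \<xi>))\<^sup>2)" "integrable lborel (\<lambda>\<xi>. 2 * Re (?F \<xi> * cnj (K \<xi>)))"
      by (intro sq1 integrable_mult_right integrable_Re i)+
    have "L2_dist2 ?F K = ennreal (\<integral>\<xi>. (norm (?F \<xi> - K \<xi>))\<^sup>2 \<partial>lborel)"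
      unfolding L2_dist2_lborel
    proof (rule nn_integral_eq_integral)
      show "integrable lborel (\<lambda>\<xi>. (norm (?F \<xi> - K \<xi>))\<^sup>2)"
        unfolding pt by (intro Bochner_Integration.integrable_diff Bochner_Integration.integrable_add sq)
    qed simp
    also have "(\<integral>\<xi>. (norm (?F \<xi> - K \<xi>))\<^sup>2 \<partial>lborel) = ?c * ?T R + (\<integral>x. (norm (K x))\<^sup>2 \<partial>lborel) - 2 * (\<integral>\<xi>. Re (?F \<xi> * cnj (K \<xi>)) \<partial>lborel)"
      unfolding pt FR(2)[symmetric]
      by (simp only: Bochner_Integration.integral_diff[OF Bochner_Integration.integrable_add[OF sq(1,2)] sq(3)]
          Bochner_Integration.integral_add[OF sq(1,2)] integral_mult_right_zero)
    finally show ?thesis unfolding M by (simp add: algebra_simps)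
  qed
  moreover have "((\<lambda>R. ennreal ((\<integral>x. (norm (K x))\<^sup>2 \<partial>lborel) - ?c * ?T R)) \<longlongrightarrow> ennreal 0) at_top"
  proof (rule tendsto_ennrealI)
    have "((\<lambda>R. \<integral>\<^sup>+x. ennreal ((norm (trunc R f x))\<^sup>2) \<partial>lborel) \<longlongrightarrow> (\<integral>\<^sup>+x. ennreal ((norm (f x))\<^sup>2) \<partial>lborel)) at_top"
      using nn_L2_trunc_tendsto[OF L2_borel_imp_L2_space[OF f]] unfolding nn_integral_completion .
    then have "((\<lambda>R. enn2real (ennreal (?T R))) \<longlongrightarrow> (\<integral>x. (norm (f x))\<^sup>2 \<partial>lborel)) at_top"
      unfolding L2_borelD(5)[OF f] L2_borelD(5)[OF trunc_L2_borel(1)[OF f]] by (rule tendsto_enn2real) simp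
    then have T: "(?T \<longlongrightarrow> (\<integral>x. (norm (f x))\<^sup>2 \<partial>lborel)) at_top" by simp
    have "((\<lambda>R. (\<integral>x. (norm (K x))\<^sup>2 \<partial>lborel) - ?c * ?T R) \<longlongrightarrow> (\<integral>x. (norm (K x))\<^sup>2 \<partial>lborel) - ?c * (\<integral>x. (norm (f x))\<^sup>2 \<partial>lborel)) at_top"
      by (intro tendsto_diff tendsto_mult tendsto_const T)
    then show "((\<lambda>R. (\<integral>x. (norm (K x))\<^sup>2 \<partial>lborel) - ?c * ?T R) \<longlongrightarrow> 0) at_top" by (simp only: Nf diff_self)
  qed
  ultimately have "has_fourier_L2 f K"
    using f K by (simp add: has_fourier_L2_def L2_tendsto_iff L2_borel_imp_L2_space)
  then show ?thesis by blast
qed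


section \<open>The damped oscillator\<close>

lemma exponential_ode_unique:
  fixes y :: "real \<Rightarrow> complex"
  assumes y: "\<And>t. 0 \<le> t \<Longrightarrow> (y has_vector_derivative r * y t) (at t within {0..})" and t: "0 \<le> t"
  shows "y t = y 0 * exp (r * complex_of_real t)"
proof -
  let ?E = "\<lambda>t. exp (t *\<^sub>R (- r))"
  have "((\<lambda>t. y t * ?E t) has_vector_derivative 0) (at s within {0..})" if "s \<in> {0..}" for s
  proof -
    have E: "(?E has_vector_derivative - r * ?E s) (at s within {0..})"
      by (rule has_vector_derivative_at_within[OF exp_scaleR_has_vector_derivative_left])
    have "((\<lambda>t. y t * ?E t) has_vector_derivative y s * (- r * ?E s) + r * y s * ?E s) (at s within {0..})"
      using that by (intro has_vector_derivative_mult y E) auto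
    then show ?thesis by (simp add: algebra_simps)
  qed
  then obtain c where c: "\<And>s. s \<in> {0..} \<Longrightarrow> y s * ?E s = c"
    using has_vector_derivative_zero_constant[of "{0..}" "\<lambda>t. y t * ?E t"] by auto
  have "y t * ?E t = y 0" using c[of t] c[of 0] t by simp
  then show ?thesis by (simp add: exp_minus field_simps scaleR_conv_of_real)
qed

text \<open>The second-order operator factors through its characteristic roots:
  \<open>w - r1 * v\<close> solves the first-order equation with rate \<open>r2\<close>, and vice
  versa. Subtracting the two solutions eliminates \<open>w\<close>. The factor
  \<open>r2 - r1\<close> is kept on the left so that real and complex roots are treated
  together.\<close>

lemma damped_oscillator_roots:
  fixes v w :: "real \<Rightarrow> complex" and r1 r2 :: complex
  assumes v: "\<And>t. 0 \<le> t \<Longrightarrow> (v has_vector_derivative w t) (at t within {0..})"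
    and w: "\<And>t. 0 \<le> t \<Longrightarrow> (w has_vector_derivative - l * v t - l * w t) (at t within {0..})"
    and v0: "v 0 = 0" and r: "r1 + r2 = - l" "r1 * r2 = l" and t: "0 \<le> t"
  shows "(r2 - r1) * v t = w 0 * (exp (r2 * complex_of_real t) - exp (r1 * complex_of_real t))"
proof -
  have *: "w t - a * v t = w 0 * exp (b * complex_of_real t)" if ab: "a + b = - l" "a * b = l" for a b
  proof -
    have "w t - a * v t = (w 0 - a * v 0) * exp (b * complex_of_real t)"
    proof (rule exponential_ode_unique[OF _ t])
      fix s :: real assume s: "0 \<le> s"
      have "((\<lambda>s. w s - a * v s) has_vector_derivative (- l * v s - l * w s) - a * w s) (at s within {0..})"
        using s by (intro has_vector_derivative_diff has_vector_derivative_mult_right v w)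
      also have "(- l * v s - l * w s) - a * w s = b * (w s - a * v s)"
      proof -
        have "- l * v s - l * w s - a * w s = - (a * b) * v s + (a + b) * w s - a * w s" using ab by simp
        then show ?thesis by (simp add: algebra_simps)
      qed
      finally show "((\<lambda>s. w s - a * v s) has_vector_derivative b * (w s - a * v s)) (at s within {0..})" .
    qed
    then show ?thesis using v0 by simp
  qed
  have "(r2 - r1) * v t = (w t - r1 * v t) - (w t - r2 * v t)" by (simp add: algebra_simps)
  also have "\<dots> = w 0 * (exp (r2 * complex_of_real t) - exp (r1 * complex_of_real t))"
    using *[of r1 r2] *[of r2 r1] r by (simp add: algebra_simps)
  finally show ?thesis .
qed

lemma damped_oscillator_underdamped:
  fixes v w :: "real \<Rightarrow> complex" and l :: real
  assumes v: "\<And>t. 0 \<le> t \<Longrightarrow> (v has_vector_derivative w t) (at t within {0..})"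
    and w: "\<And>t. 0 \<le> t \<Longrightarrow> (w has_vector_derivative - complex_of_real l * v t - complex_of_real l * w t) (at t within {0..})"
    and v0: "v 0 = 0" and l: "0 < l" "l < 4" and t: "0 \<le> t"
  defines "\<omega> \<equiv> sqrt (l - l\<^sup>2 / 4)"
  shows "v t = w 0 * complex_of_real (exp (- l * t / 2) * (sin (t * \<omega>) / \<omega>))"
proof -
  have "l * l < 4 * l" using l by simp
  then have pos: "0 < l - l\<^sup>2 / 4" by (simp add: power2_eq_square)
  then have \<omega>: "0 < \<omega>" "\<omega> * \<omega> = l - l\<^sup>2 / 4" unfolding \<omega>_def by simp_all
  let ?r = "\<lambda>\<epsilon>. complex_of_real (- l / 2) + \<i> * complex_of_real (\<epsilon> * \<omega>)"
  have L: "(?r 1 - ?r (-1)) * v t = w 0 * (exp (?r 1 * complex_of_real t) - exp (?r (-1) * complex_of_real t))"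
  proof (rule damped_oscillator_roots[OF v w v0 _ _ t])
    show "?r (-1) + ?r 1 = - complex_of_real l" by (simp add: complex_eq_iff)
    have "?r (-1) * ?r 1 = complex_of_real (l\<^sup>2 / 4 + \<omega> * \<omega>)"
      by (simp add: complex_eq_iff power2_eq_square)
    then show "?r (-1) * ?r 1 = complex_of_real l" unfolding \<omega>(2) by simp
  qed
  have E: "exp (?r \<epsilon> * complex_of_real t) = complex_of_real (exp (- l * t / 2)) * cis (t * (\<epsilon> * \<omega>))" for \<epsilon>
    by (simp add: cis_conv_exp exp_of_real[symmetric] exp_add[symmetric] algebra_simps)
  have "2 * \<i> * complex_of_real \<omega> * v t = (?r 1 - ?r (-1)) * v t" by (simp add: algebra_simps)
  also have "\<dots> = w 0 * (complex_of_real (exp (- l * t / 2)) * (cis (t * \<omega>) - cis (- (t * \<omega>))))"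
    unfolding L E by (simp add: right_diff_distrib)
  also have "cis (t * \<omega>) - cis (- (t * \<omega>)) = 2 * \<i> * complex_of_real (sin (t * \<omega>))"
    by (simp add: complex_eq_iff)
  finally have "(2 * \<i> * complex_of_real \<omega>) * v t = (2 * \<i> * complex_of_real \<omega>) * (w 0 * complex_of_real (exp (- l * t / 2) * (sin (t * \<omega>) / \<omega>)))"
    using \<omega>(1) by (simp add: field_simps)
  moreover have "2 * \<i> * complex_of_real \<omega> \<noteq> 0" using \<omega>(1) by simp
  ultimately show ?thesis by (rule mult_left_cancel[THEN iffD1, rotated])
qed

lemma abs_sin_div_le:
  assumes "0 < (a::real)" "0 \<le> t"
  shows "\<bar>sin (t * a) / a\<bar> \<le> t" "\<bar>sin (t * a) / a\<bar> \<le> 1 / a"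
proof -
  have "\<bar>sin (t * a)\<bar> \<le> t * a" using abs_sin_x_le_abs_x[of "t * a"] assms by simp
  then show "\<bar>sin (t * a) / a\<bar> \<le> t" using assms by (simp add: pos_divide_le_eq)
  show "\<bar>sin (t * a) / a\<bar> \<le> 1 / a" using assms by (simp add: divide_right_mono)
qed

text \<open>For \<open>l < 4\<close> the rate is \<open>l / 2\<close>; for \<open>l > 4\<close> the
  slower root increases to -1 as \<open>l\<close> grows, so it is always at most -1. Both cases give
  rate \<open>l0 / 2\<close> only because \<open>l0 \<le> 2\<close>. At \<open>l = 4\<close> the
  roots coincide and the formula by roots gives no information.\<close>

lemma damped_oscillator_decay:
  fixes v w :: "real \<Rightarrow> complex" and l :: real
  assumes v: "\<And>t. 0 \<le> t \<Longrightarrow> (v has_vector_derivative w t) (at t within {0..})"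
    and w: "\<And>t. 0 \<le> t \<Longrightarrow> (w has_vector_derivative - complex_of_real l * v t - complex_of_real l * w t) (at t within {0..})"
    and v0: "v 0 = 0" and l: "0 < l0" "l0 \<le> 2" "l0 \<le> l" "l \<noteq> 4" and t: "0 \<le> t"
  shows "norm (v t) \<le> norm (w 0) * (t * exp (- l0 * t / 2))"
proof (cases "l < 4")
  case True
  have "l * l < 4 * l" using l True by simp
  then have pos: "0 < sqrt (l - l\<^sup>2 / 4)" by (simp add: power2_eq_square)
  have eq: "v t = w 0 * complex_of_real (exp (- l * t / 2) * (sin (t * sqrt (l - l\<^sup>2 / 4)) / sqrt (l - l\<^sup>2 / 4)))"
    by (rule damped_oscillator_underdamped[OF v w v0 _ True t]) (use l in auto)
  have "l0 * t \<le> l * t" using l t by (intro mult_right_mono) auto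
  then have "exp (- l * t / 2) * \<bar>sin (t * sqrt (l - l\<^sup>2 / 4)) / sqrt (l - l\<^sup>2 / 4)\<bar> \<le> exp (- l0 * t / 2) * t"
    using abs_sin_div_le(1)[OF pos t] t by (intro mult_mono) auto
  then show ?thesis
    unfolding eq norm_mult norm_of_real abs_mult[of "exp _"] abs_exp_cancel
    by (intro mult_left_mono) (simp_all add: mult.commute)
next
  case False
  then have l4: "4 < l" using l by simp
  define s where "s = sqrt (l\<^sup>2 / 4 - l)"
  have "4 * l < l * l" using l4 by simp
  then have s: "0 < s" "s * s = l\<^sup>2 / 4 - l" unfolding s_def by (simp_all add: power2_eq_square)
  \<comment> \<open>Completing the square, \<open>l\<^sup>2 / 4 - l\<close> is
    \<open>(l / 2 - 1)\<^sup>2 - 1\<close>; this places the slower root \<open>- l / 2 + s\<close>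
    at or below -1.\<close>
  have "s \<le> sqrt ((l / 2 - 1)\<^sup>2)" unfolding s_def by (intro real_sqrt_le_mono) (simp add: power2_diff power_divide)
  then have s1: "s \<le> l / 2 - 1" using l4 by simp
  let ?r = "\<lambda>\<epsilon>. - l / 2 + \<epsilon> * s"
  have "(complex_of_real (?r 1) - complex_of_real (?r (-1))) * v t = w 0 * (exp (complex_of_real (?r 1) * complex_of_real t) - exp (complex_of_real (?r (-1)) * complex_of_real t))"
  proof (rule damped_oscillator_roots[OF v w v0 _ _ t])
    show "complex_of_real (?r (-1)) + complex_of_real (?r 1) = - complex_of_real l" by (simp add: complex_eq_iff)
    have "?r (-1) * ?r 1 = l\<^sup>2 / 4 - s * s" by (simp add: algebra_simps power2_eq_square)
    then have "?r (-1) * ?r 1 = l" unfolding s(2) by simp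
    then show "complex_of_real (?r (-1)) * complex_of_real (?r 1) = complex_of_real l" by (metis of_real_mult)
  qed
  then have "complex_of_real (2 * s) * v t = w 0 * complex_of_real (exp (?r 1 * t) - exp (?r (-1) * t))"
    by (simp add: exp_of_real[symmetric])
  then have "norm (complex_of_real (2 * s) * v t) = norm (w 0 * complex_of_real (exp (?r 1 * t) - exp (?r (-1) * t)))" by simp
  then have eq: "2 * s * norm (v t) = norm (w 0) * \<bar>exp (?r 1 * t) - exp (?r (-1) * t)\<bar>"
    using s(1) by (simp only: norm_mult norm_of_real abs_mult abs_numeral abs_of_pos)
  have le: "\<bar>exp (?r 1 * t) - exp (?r (-1) * t)\<bar> \<le> 2 * s * (t * exp (- l0 * t / 2))"
  proof -
    \<comment> \<open>With the slower exponential factored out, the rest is at most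
      \<open>2 * s * t\<close>. Its factor \<open>2 * s\<close> cancels the distance of the roots,
      so the bound does not deteriorate as \<open>l\<close> approaches 4.\<close>
    have "exp (?r (-1) * t) = exp (?r 1 * t) * exp (- (2 * s * t))"
      by (simp add: exp_add[symmetric] algebra_simps)
    then have "exp (?r 1 * t) - exp (?r (-1) * t) = exp (?r 1 * t) * (1 - exp (- (2 * s * t)))"
      by (simp only: right_diff_distrib mult_1_right)
    then have "\<bar>exp (?r 1 * t) - exp (?r (-1) * t)\<bar> = exp (?r 1 * t) * \<bar>1 - exp (- (2 * s * t))\<bar>"
      by (simp only: abs_mult abs_exp_cancel)
    also have "\<dots> \<le> exp (- l0 * t / 2) * (2 * s * t)"
    proof (intro mult_mono)
      have "?r 1 * t \<le> (- l0 / 2) * t" using s1 l t by (intro mult_right_mono) auto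
      then show "exp (?r 1 * t) \<le> exp (- l0 * t / 2)" by simp
      show "\<bar>1 - exp (- (2 * s * t))\<bar> \<le> 2 * s * t"
        using exp_ge_add_one_self[of "- (2 * s * t)"] s t by simp
    qed simp_all
    finally show ?thesis by (simp add: mult_ac)
  qed
  have "(2 * s) * norm (v t) \<le> (2 * s) * (norm (w 0) * (t * exp (- l0 * t / 2)))"
    unfolding eq using mult_left_mono[OF le, of "norm (w 0)"] by (simp add: mult_ac)
  then show ?thesis using s by (simp only: mult_le_cancel_left_pos)
qed

section \<open>Estimates of the symbols\<close>

lemma ln_one_plus_bounds:
  assumes "0 \<le> (r::real)" "r \<le> 1 / 8"
  shows "ln (1 + r) \<le> r" "8 * r / 9 \<le> ln (1 + r)"
proof -
  show "ln (1 + r) \<le> r" using assms by (intro ln_add_one_self_le_self)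
  have "ln (1 / (1 + r)) \<le> 1 / (1 + r) - 1" using assms by (intro ln_le_minus_one) auto
  then have *: "r / (1 + r) \<le> ln (1 + r)" using assms by (simp add: ln_div field_simps)
  have "8 * r / 9 = r / (9 / 8)" by simp
  also have "\<dots> \<le> r / (1 + r)" using assms by (intro divide_left_mono) auto
  also note *
  finally show "8 * r / 9 \<le> ln (1 + r)" .
qed

lemma abs_sin_diff_le: "\<bar>sin a - sin b\<bar> \<le> \<bar>a - (b::real)\<bar>"
proof -
  have "\<bar>sin a - sin b\<bar> = 2 * \<bar>sin ((a - b) / 2)\<bar> * \<bar>cos ((a + b) / 2)\<bar>"
    by (simp add: sin_diff_sin abs_mult)
  also have "\<dots> \<le> 2 * \<bar>(a - b) / 2\<bar> * 1"
    by (intro mult_mono abs_sin_x_le_abs_x) auto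
  finally show ?thesis by simp
qed

text \<open>The solution and the profile share the damping \<open>exp (- l * t / 2)\<close>. An
  error growing like \<open>1 + l * t\<close> is allowed to cost \<open>exp (l * t / 4)\<close>,
  which spends half of that exponent and leaves the other half for Gaussian decay. The constant 5/4
  is common to both bounds, so that the mean and the first moment enter the estimate through their
  sum.\<close>

lemma low_frequency_symbol:
  fixes r t :: real
  assumes r: "0 < r" "r \<le> 1 / 8" and t: "0 \<le> t"
  defines "l \<equiv> ln (1 + r)"
  defines "\<sigma> \<equiv> sqrt l" and "\<omega> \<equiv> sqrt (l - l\<^sup>2 / 4)"
  shows "sqrt r * \<bar>sin (t * \<omega>) / \<omega>\<bar> \<le> 5 / 4"
    and "\<bar>sin (t * \<omega>) / \<omega> - sin (t * \<sigma>) / \<sigma>\<bar> \<le> 5 / 4 * exp (l * t / 4)"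
proof -
  have l: "0 < l" "l \<le> 1 / 8" "8 * r / 9 \<le> l"
    using ln_one_plus_bounds[of r] r by (auto simp: l_def)
  \<comment> \<open>\<open>c\<close> is the ratio of \<open>\<omega>\<close> to
    \<open>\<sigma>\<close>. From \<open>l \<le> 1 / 8\<close> one has
    \<open>1 - l / 4 \<ge> 31 / 32\<close>, which exceeds the square of
    \<open>49 / 50\<close>.\<close>
  define c where "c = sqrt (1 - l / 4)"
  have c2: "c * c = 1 - l / 4" "0 \<le> c" "c \<le> 1" using l by (auto simp: c_def)
  have "sqrt ((49/50)\<^sup>2) \<le> c" unfolding c_def by (intro real_sqrt_le_mono) (use l in \<open>simp add: power2_eq_square\<close>)
  then have c: "49 / 50 \<le> c" by simp
  have \<sigma>: "0 < \<sigma>" "\<sigma> * \<sigma> = l" using l by (auto simp: \<sigma>_def)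
  have \<omega>c: "\<omega> = \<sigma> * c"
    unfolding \<omega>_def \<sigma>_def c_def real_sqrt_mult[symmetric] by (simp add: power2_eq_square algebra_simps)
  have \<omega>: "0 < \<omega>" using \<sigma> c by (simp add: \<omega>c)
  \<comment> \<open>\<open>r\<close> is at most \<open>9 / 8 * l\<close>, and 9/8 is below the
    square of 11/10. Combined with \<open>c \<ge> 49 / 50\<close> this leaves the ratio of
    \<open>sqrt r\<close> to \<open>\<omega>\<close> below 5/4.\<close>
  have "r \<le> (11/10 * \<sigma>)\<^sup>2" using l \<sigma> by (simp add: power2_eq_square power_mult_distrib)
  then have r\<sigma>: "sqrt r \<le> 11/10 * \<sigma>" using \<sigma> by (intro real_le_lsqrt) auto
  have r\<omega>: "sqrt r \<le> 5/4 * \<omega>"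
  proof -
    have "\<sigma> * (49 / 50) \<le> \<omega>" unfolding \<omega>c using c \<sigma> by (intro mult_left_mono) auto
    then show ?thesis using r\<sigma> \<sigma> by linarith
  qed
  have "sqrt r * \<bar>sin (t * \<omega>) / \<omega>\<bar> \<le> (5/4 * \<omega>) * (1 / \<omega>)"
    using r\<omega> abs_sin_div_le(2)[OF \<omega> t] \<omega> by (intro mult_mono) auto
  then show "sqrt r * \<bar>sin (t * \<omega>) / \<omega>\<bar> \<le> 5 / 4" using \<omega> by simp
  have "\<sigma> \<le> sqrt ((1/2)\<^sup>2)" unfolding \<sigma>_def using l by (intro real_sqrt_le_mono) (simp add: power2_eq_square)
  then have \<sigma>h: "\<sigma> \<le> 1 / 2" by (simp add: real_sqrt_divide)
  have "c * c \<le> c * 1" using c2 by (intro mult_left_mono) auto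
  then have c3: "1 - c \<le> l / 4" using c2 by simp
  \<comment> \<open>The change of phase inside the sine is separated from the change of the
    denominator; each is proportional to \<open>1 - c\<close>, which is at most
    \<open>1 - c * c = l / 4\<close>.\<close>
  have "sin (t * \<omega>) / \<omega> - sin (t * \<sigma>) / \<sigma> = (sin (t * \<omega>) - sin (t * \<sigma>)) / \<omega> + sin (t * \<sigma>) / \<sigma> * ((1 - c) / c)"
    using \<sigma> c by (simp add: \<omega>c field_simps)
  then have "\<bar>sin (t * \<omega>) / \<omega> - sin (t * \<sigma>) / \<sigma>\<bar> \<le> \<bar>sin (t * \<omega>) - sin (t * \<sigma>)\<bar> / \<omega> + \<bar>sin (t * \<sigma>) / \<sigma>\<bar> * ((1 - c) / c)"
    using \<omega> c c2 by (simp add: abs_mult order_trans[OF abs_triangle_ineq])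
  also have "\<dots> \<le> (t * \<sigma> * (1 - c)) / \<omega> + 1 / \<sigma> * ((1 - c) / c)"
  proof (intro add_mono divide_right_mono mult_right_mono abs_sin_div_le(2) \<sigma> t)
    have "t * \<omega> - t * \<sigma> = - (t * \<sigma> * (1 - c))" by (simp add: \<omega>c algebra_simps)
    then have "\<bar>t * \<omega> - t * \<sigma>\<bar> = t * \<sigma> * (1 - c)"
      using t \<sigma> c2 by (simp only: abs_minus_cancel) (simp add: abs_of_nonneg)
    then show "\<bar>sin (t * \<omega>) - sin (t * \<sigma>)\<bar> \<le> t * \<sigma> * (1 - c)"
      using abs_sin_diff_le[of "t * \<omega>" "t * \<sigma>"] by simp
  qed (use \<omega> c c2 in auto)
  also have "\<dots> = (t + 1 / \<sigma>) * ((1 - c) / c)" using \<sigma> c by (simp add: \<omega>c field_simps)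
  also have "\<dots> \<le> (t + 1 / \<sigma>) * (l / 4 / (49 / 50))"
    using t \<sigma> c c3 l by (intro mult_left_mono frac_le add_nonneg_nonneg) auto
  \<comment> \<open>\<open>l / \<sigma>\<close> is \<open>\<sigma>\<close>, so the singular factor
    \<open>1 / \<sigma>\<close> is absorbed and leaves a term bounded by means of
    \<open>\<sigma> \<le> 1 / 2\<close>.\<close>
  also have "\<dots> = 50 / 49 * (l * t / 4) + 50 / 49 * (\<sigma> / 4)"
    using \<sigma> by (simp add: field_simps)
  also have "\<dots> \<le> 5 / 4 * (1 + l * t / 4)"
  proof -
    have "0 \<le> l * t" using l t by simp
    then show ?thesis using \<sigma>h by argo
  qed
  also have "\<dots> \<le> 5 / 4 * exp (l * t / 4)" using exp_ge_add_one_self[of "l * t / 4"] by (intro mult_left_mono) simp_all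
  finally show "\<bar>sin (t * \<omega>) / \<omega> - sin (t * \<sigma>) / \<sigma>\<bar> \<le> 5 / 4 * exp (l * t / 4)" .
qed

text \<open>Each of the \<open>DIM('a)\<close> factors \<open>1 + |x|^2\<close> dominates one factor
  \<open>1 + (x \<bullet> b)\<^sup>2\<close>, which reduces the claim to the one-dimensional
  integral. The function serves as integrable majorant for powers of
  \<open>exp (- L_symbol \<xi>)\<close>.\<close>

lemma integrable_inverse_one_plus_norm_power:
  "integrable lborel (\<lambda>x::'a::euclidean_space. inverse ((1 + (norm x)\<^sup>2) ^ DIM('a)))"
proof -
  have 1: "integrable lborel (\<lambda>y::real. inverse (1 + y\<^sup>2))"
    using integrable_inverse_1_plus_square by (simp add: set_integrable_def einterval_eq)
  have "integrable lborel (\<lambda>x::'a. \<Prod>b\<in>Basis. inverse (1 + (x \<bullet> b)\<^sup>2))"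
    using 1 by (intro lborel_integrable_prod(1))
  then show ?thesis
  proof (rule Bochner_Integration.integrable_bound)
    have le: "inverse ((1 + (norm x)\<^sup>2) ^ DIM('a)) \<le> (\<Prod>b\<in>Basis. inverse (1 + (x \<bullet> b)\<^sup>2))" for x :: 'a
    proof -
      have "(x \<bullet> b)\<^sup>2 \<le> (norm x)\<^sup>2" if "b \<in> Basis" for b
        using power_mono[OF Basis_le_norm[OF that, of x], of 2] by simp
      then have "(\<Prod>b\<in>(Basis::'a set). inverse (1 + (norm x)\<^sup>2)) \<le> (\<Prod>b\<in>Basis. inverse (1 + (x \<bullet> b)\<^sup>2))"
        by (intro prod_mono) (auto intro!: le_imp_inverse_le add_pos_nonneg)
      then show ?thesis by (simp add: power_inverse)
    qed
    show "AE x in (lborel :: 'a measure). norm (inverse ((1 + (norm x)\<^sup>2) ^ DIM('a))) \<le> norm (\<Prod>b\<in>Basis. inverse (1 + (x \<bullet> b)\<^sup>2))"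
    proof (rule AE_I2)
      fix x :: 'a
      have "0 \<le> inverse ((1 + (norm x)\<^sup>2) ^ DIM('a))" by simp
      then show "norm (inverse ((1 + (norm x)\<^sup>2) ^ DIM('a))) \<le> norm (\<Prod>b\<in>Basis. inverse (1 + (x \<bullet> b)\<^sup>2))"
        using le[of x] by (simp only: real_norm_def abs_of_nonneg)
    qed
  qed measurable
qed


lemma norm_exp_minus_ii_minus_1_le: "norm (exp (- \<i> * complex_of_real \<theta>) - 1) \<le> \<bar>\<theta>\<bar>"
  using iexp_approx1[of "- \<theta>" 0] by simp

lemma norm_fourier_integral_minus_mean_le:
  assumes f: "integrable lborel f" "integrable lborel (\<lambda>x. norm x * norm (f x))"
  shows "norm (fourier_integral f \<xi> - (\<integral>x. f x \<partial>lborel)) \<le> norm \<xi> * (\<integral>x. norm x * norm (f x) \<partial>lborel)"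
proof -
  have [measurable]: "f \<in> borel_measurable borel" using f by auto
  have "fourier_integral f \<xi> - (\<integral>x. f x \<partial>lborel) = (\<integral>x. exp (- \<i> * complex_of_real (x \<bullet> \<xi>)) * f x - f x \<partial>lborel)"
    unfolding fourier_integral_lborel[OF \<open>f \<in> borel_measurable borel\<close>]
    by (rule Bochner_Integration.integral_diff[symmetric, OF integrable_fourier_integrand[OF f(1)] f(1)])
  also have "norm \<dots> \<le> (\<integral>x. norm \<xi> * (norm x * norm (f x)) \<partial>lborel)"
  proof (rule Bochner_Integration.integral_norm_bound_integral)
    show "integrable lborel (\<lambda>x. exp (- \<i> * complex_of_real (x \<bullet> \<xi>)) * f x - f x)"
      by (intro Bochner_Integration.integrable_diff integrable_fourier_integrand f)
    show "integrable lborel (\<lambda>x. norm \<xi> * (norm x * norm (f x)))" by (intro integrable_mult_right f)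
    fix x
    have "norm (exp (- \<i> * complex_of_real (x \<bullet> \<xi>)) * f x - f x) = norm (exp (- \<i> * complex_of_real (x \<bullet> \<xi>)) - 1) * norm (f x)"
      unfolding norm_mult[symmetric] by (simp add: left_diff_distrib)
    also have "\<dots> \<le> (norm x * norm \<xi>) * norm (f x)"
      by (intro mult_right_mono order_trans[OF norm_exp_minus_ii_minus_1_le Cauchy_Schwarz_ineq2]) simp
    finally show "norm (exp (- \<i> * complex_of_real (x \<bullet> \<xi>)) * f x - f x) \<le> norm \<xi> * (norm x * norm (f x))"
      by (simp add: mult_ac)
  qed
  finally show ?thesis by simp
qed

text \<open>At \<open>\<xi> = 0\<close> the quotient is \<open>0 / 0 = 0\<close> rather than its limit \<open>t\<close>.\<close>

definition profile :: "real \<Rightarrow> 'a::euclidean_space \<Rightarrow> complex" where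
  "profile t \<xi> = complex_of_real ((1 + (norm \<xi>)\<^sup>2) powr (- t / 2) *
     (sin (t * sqrt (ln (1 + (norm \<xi>)\<^sup>2))) / sqrt (ln (1 + (norm \<xi>)\<^sup>2))))"

lemma borel_measurable_profile [measurable]: "profile t \<in> borel_measurable borel"
  unfolding profile_def by measurable

lemma norm_profile_le:
  assumes t: "0 \<le> t"
  shows "norm (profile t \<xi>) \<le> t * exp (- L_symbol \<xi> * t / 2)"
proof -
  have l0: "0 \<le> L_symbol \<xi>" by (simp add: L_symbol_def)
  have e: "(1 + (norm \<xi>)\<^sup>2) powr (- t / 2) = exp (- L_symbol \<xi> * t / 2)"
  proof -
    have "1 + (norm \<xi>)\<^sup>2 \<noteq> 0" by (metis add_pos_nonneg less_irrefl zero_le_power2 zero_less_one)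
    then show ?thesis by (simp add: powr_def L_symbol_def)
  qed
  have "\<bar>sin (t * sqrt (L_symbol \<xi>)) / sqrt (L_symbol \<xi>)\<bar> \<le> t"
    using abs_sin_div_le(1)[of "sqrt (L_symbol \<xi>)" t] l0 t by (cases "L_symbol \<xi> = 0") auto
  then have "\<bar>exp (- L_symbol \<xi> * t / 2) * (sin (t * sqrt (L_symbol \<xi>)) / sqrt (L_symbol \<xi>))\<bar> \<le> exp (- L_symbol \<xi> * t / 2) * t"
    unfolding abs_mult[of "exp _"] abs_exp_cancel by (intro mult_left_mono) auto
  then show ?thesis
    unfolding profile_def norm_of_real e unfolding L_symbol_def[symmetric] by (simp add: mult.commute)
qed

text \<open>Since \<open>exp (L_symbol \<xi>)\<close> is \<open>1 + |\<xi>|^2\<close>, the time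
  \<open>t\<close> is split: an amount \<open>DIM('a)\<close> is spent on integrability in
  \<open>\<xi>\<close>, and the remaining time gives decay at rate \<open>c\<close>. With
  \<open>c = 0\<close> it is a plain majorant.\<close>

lemma exp_L_symbol_le:
  fixes \<xi> :: "'a::euclidean_space"
  assumes t: "real DIM('a) \<le> t" and c: "0 \<le> c" "c \<le> L_symbol \<xi>"
  shows "exp (- L_symbol \<xi> * t) \<le> exp (- c * (t - real DIM('a))) * inverse ((1 + (norm \<xi>)\<^sup>2) ^ DIM('a))"
proof -
  have pos: "0 < 1 + (norm \<xi>)\<^sup>2" by (simp add: add_pos_nonneg)
  have "c * (t - real DIM('a)) \<le> L_symbol \<xi> * (t - real DIM('a))" using t c by (intro mult_right_mono) auto
  then have "exp (- L_symbol \<xi> * t) \<le> exp (- c * (t - real DIM('a)) - real DIM('a) * L_symbol \<xi>)"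
    by (simp add: algebra_simps)
  also have "\<dots> = exp (- c * (t - real DIM('a))) * inverse (exp (L_symbol \<xi>) ^ DIM('a))"
    by (simp add: exp_diff exp_of_nat_mult divide_inverse)
  finally show ?thesis using pos by (simp add: L_symbol_def)
qed

text \<open>The decay of the kernel in frequency is that of \<open>(1 + |\<xi>|^2)\<close> to the
  power \<open>- t / 2\<close>. Comparison with the exponent \<open>- DIM('a)\<close> for the kernel
  itself asks for \<open>t \<ge> 2 * DIM('a)\<close>; its square then satisfies the weaker
  requirement \<open>t \<ge> DIM('a)\<close>.\<close>

lemma profile_L2_borel:
  assumes t: "2 * real DIM('a) \<le> t"
  shows "(profile t :: 'a::euclidean_space \<Rightarrow> complex) \<in> L2_borel" "integrable lborel (profile t :: 'a \<Rightarrow> complex)"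
proof -
  have t0: "0 \<le> t" "real DIM('a) \<le> t" "real DIM('a) \<le> t / 2" using t by auto
  have l0: "0 \<le> L_symbol \<xi>" for \<xi> :: 'a by (simp add: L_symbol_def)
  have b1: "norm (profile t \<xi>) \<le> t * inverse ((1 + (norm \<xi>)\<^sup>2) ^ DIM('a))" for \<xi> :: 'a
    using norm_profile_le[OF t0(1), of \<xi>] mult_left_mono[OF exp_L_symbol_le[OF t0(3) order_refl l0[of \<xi>]] t0(1)] by simp
  have b2: "(norm (profile t \<xi>))\<^sup>2 \<le> t\<^sup>2 * inverse ((1 + (norm \<xi>)\<^sup>2) ^ DIM('a))" for \<xi> :: 'a
  proof -
    have "(norm (profile t \<xi>))\<^sup>2 \<le> (t * exp (- L_symbol \<xi> * t / 2))\<^sup>2" by (intro power_mono norm_profile_le t0) auto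
    also have "\<dots> = t\<^sup>2 * exp (- L_symbol \<xi> * t)" by (simp add: power_mult_distrib exp_double[symmetric])
    also have "\<dots> \<le> t\<^sup>2 * inverse ((1 + (norm \<xi>)\<^sup>2) ^ DIM('a))"
      using exp_L_symbol_le[OF t0(2) order_refl l0[of \<xi>]] by (intro mult_left_mono) auto
    finally show ?thesis .
  qed
  note i = integrable_mult_right[OF integrable_inverse_one_plus_norm_power[where 'a='a]]
  show "integrable lborel (profile t :: 'a \<Rightarrow> complex)"
    by (rule Bochner_Integration.integrable_bound[OF i[of t]]) (use b1 t0 in \<open>auto intro!: AE_I2 order_trans[OF b1 abs_ge_self]\<close>)
  show "(profile t :: 'a \<Rightarrow> complex) \<in> L2_borel"
    unfolding L2_borel_def mem_Collect_eq
    by (intro conjI borel_measurable_profile Bochner_Integration.integrable_bound[OF i[of "t\<^sup>2"]])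
       (auto intro!: AE_I2 b2)
qed

lemma AE_norm_ne: "AE \<xi> in lebesgue. norm (\<xi>::'a::euclidean_space) \<noteq> c"
proof -
  have "negligible (sphere (0::'a) c)" by (rule negligible_sphere)
  then have "AE \<xi> in lebesgue. \<xi> \<notin> sphere (0::'a) c" unfolding negligible_iff_null_sets by (rule AE_not_in)
  then show ?thesis by (simp add: dist_norm)
qed

lemma L_symbol_pos: "\<xi> \<noteq> 0 \<Longrightarrow> 0 < L_symbol \<xi>"
  unfolding L_symbol_def by (intro ln_gt_zero) simp

text \<open>The frequencies with a double characteristic root form a sphere.\<close>

lemma AE_L_symbol_ne_4: "AE \<xi>::'a::euclidean_space in lebesgue. L_symbol \<xi> \<noteq> 4"
  using AE_norm_ne[of "sqrt (exp 4 - 1)"]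
proof eventually_elim
  case (elim \<xi>)
  show ?case
  proof
    assume "L_symbol \<xi> = 4"
    then have "exp (ln (1 + (norm \<xi>)\<^sup>2)) = exp 4" by (simp add: L_symbol_def)
    moreover have "0 < 1 + (norm \<xi>)\<^sup>2" by (simp add: add_pos_nonneg)
    ultimately have "(norm \<xi>)\<^sup>2 = exp 4 - 1" by simp
    then have "norm \<xi> = sqrt (exp 4 - 1)" by (metis norm_ge_zero real_sqrt_unique)
    with elim show False by simp
  qed
qed

text \<open>One bound for all frequencies whose three terms are integrable for different reasons.
  The Gaussian governs low frequencies. The second term bounds the solution at high frequencies and
  keeps \<open>norm (w 0)\<close>, the transform of \<open>u1\<close>, because its damping factor
  does not depend on \<open>\<xi>\<close> and square integrability must supply integrability. The
  third bounds the profile, which has its own decay in \<open>\<xi>\<close>. The rate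
  \<open>ln (9/8)\<close> is the value of \<open>L_symbol\<close> at the threshold; \<open>P\<close>
  is to be the mean of \<open>u1\<close>.\<close>

lemma fourier_difference_pointwise:
  fixes \<xi> :: "'a::euclidean_space" and v w :: "real \<Rightarrow> complex"
  assumes v: "\<And>t. 0 \<le> t \<Longrightarrow> (v has_vector_derivative w t) (at t within {0..})"
    and w: "\<And>t. 0 \<le> t \<Longrightarrow> (w has_vector_derivative
        - complex_of_real (L_symbol \<xi>) * v t - complex_of_real (L_symbol \<xi>) * w t) (at t within {0..})"
    and v0: "v 0 = 0" and \<xi>: "\<xi> \<noteq> 0" "L_symbol \<xi> \<noteq> 4" and t: "real DIM('a) \<le> t"
    and P: "norm (w 0 - P) \<le> norm \<xi> * M1" "norm P \<le> M0" and M: "0 \<le> M0" "0 \<le> M1"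
  shows "(norm (v t - P * profile t \<xi>))\<^sup>2 \<le> 25 / 16 * (M0 + M1)\<^sup>2 * gauss (sqrt (8 * t / 9)) \<xi>
    + 2 * t\<^sup>2 * exp (- ln (9/8) * t) * (norm (w 0))\<^sup>2
    + 2 * M0\<^sup>2 * t\<^sup>2 * exp (- ln (9/8) * (t - real DIM('a))) * inverse ((1 + (norm \<xi>)\<^sup>2) ^ DIM('a))"
    (is "_ \<le> ?A + ?B + ?C")
proof -
  let ?r = "(norm \<xi>)\<^sup>2" and ?l = "L_symbol \<xi>"
  have r: "0 < ?r" using \<xi> by simp
  have t0: "0 \<le> t" using t by linarith
  have l: "0 < ?l" by (rule L_symbol_pos[OF \<xi>(1)])
  have ABC: "0 \<le> ?A" "0 \<le> ?B" "0 \<le> ?C" by (auto intro!: mult_nonneg_nonneg less_imp_le[OF gauss_pos])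
  show ?thesis
  proof (cases "?r \<le> 1 / 8")
    case True
    note lb = ln_one_plus_bounds[OF less_imp_le[OF r] True, folded L_symbol_def]
    note low = low_frequency_symbol[OF r True t0, folded L_symbol_def]
    have l4: "?l < 4" using lb(1) True by linarith
    define \<omega> where "\<omega> = sqrt (?l - ?l\<^sup>2 / 4)"
    define E where "E = exp (- ?l * t / 2)"
    define q where "q = sin (t * \<omega>) / \<omega>"
    define p where "p = sin (t * sqrt ?l) / sqrt ?l"
    have vt: "v t = w 0 * complex_of_real (E * q)"
      unfolding E_def q_def \<omega>_def by (rule damped_oscillator_underdamped[OF v w v0 l l4 t0])
    have pr: "profile t \<xi> = complex_of_real (E * p)"
    proof -
      have "1 + ?r \<noteq> 0" using r by linarith
      then show ?thesis by (simp add: profile_def E_def p_def L_symbol_def powr_def)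
    qed
    \<comment> \<open>The error is split into replacing the transform \<open>w 0\<close> by its
      value \<open>P\<close> at the origin, and replacing the frequency \<open>\<omega>\<close> by
      the square root of the symbol.\<close>
    have "v t - P * profile t \<xi> = complex_of_real E * ((w 0 - P) * complex_of_real q + P * complex_of_real (q - p))"
      unfolding vt pr by (simp add: algebra_simps)
    then have "norm (v t - P * profile t \<xi>) = E * norm ((w 0 - P) * complex_of_real q + P * complex_of_real (q - p))"
      by (simp add: norm_mult E_def)
    also have "\<dots> \<le> E * (norm (w 0 - P) * \<bar>q\<bar> + norm P * \<bar>q - p\<bar>)"
      by (intro mult_left_mono order_trans[OF norm_triangle_ineq]) (simp_all add: norm_mult E_def del: of_real_diff)
    also have "\<dots> \<le> E * (M1 * (5/4) + M0 * (5 / 4 * exp (?l * t / 4)))"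
    proof (intro mult_left_mono add_mono)
      have "norm (w 0 - P) * \<bar>q\<bar> \<le> (norm \<xi> * M1) * \<bar>q\<bar>" using P by (intro mult_right_mono) auto
      also have "\<dots> = M1 * (sqrt ?r * \<bar>q\<bar>)" by simp
      also have "\<dots> \<le> M1 * (5/4)" using low(1) M by (intro mult_left_mono) (simp_all add: q_def \<omega>_def)
      finally show "norm (w 0 - P) * \<bar>q\<bar> \<le> M1 * (5/4)" .
      show "norm P * \<bar>q - p\<bar> \<le> M0 * (5 / 4 * exp (?l * t / 4))"
        using low(2) P M unfolding q_def p_def \<omega>_def by (intro mult_mono) auto
    qed (simp add: E_def)
    \<comment> \<open>The first-moment term is enlarged on purpose, so that both terms carry the
      same exponential and \<open>M0 + M1\<close> factors out.\<close>
    also have "\<dots> \<le> E * (M1 * (5/4 * exp (?l * t / 4)) + M0 * (5 / 4 * exp (?l * t / 4)))"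
    proof -
      have "1 \<le> exp (?l * t / 4)" using l t0 by simp
      then show ?thesis using M by (intro mult_left_mono add_mono) (simp_all add: E_def)
    qed
    also have "\<dots> = 5 / 4 * (M0 + M1) * (E * exp (?l * t / 4))" by (simp add: algebra_simps)
    also have "E * exp (?l * t / 4) = exp (- ?l * t / 4)" by (simp add: E_def exp_add[symmetric])
    finally have "(norm (v t - P * profile t \<xi>))\<^sup>2 \<le> (5 / 4 * (M0 + M1) * exp (- ?l * t / 4))\<^sup>2"
      by (intro power_mono) auto
    also have "\<dots> = 25 / 16 * (M0 + M1)\<^sup>2 * exp (- ?l * t / 2)"
      unfolding power_mult_distrib exp_double[symmetric] by (simp add: power_divide mult_ac)
    also have "\<dots> \<le> ?A"
    proof (intro mult_left_mono)
      \<comment> \<open>The exponent \<open>4 * t / 9 * |\<xi>|^2\<close> obtained here is half of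
        \<open>(s * |\<xi>|)^2\<close> with \<open>s = sqrt (8 * t / 9)\<close>.\<close>
      have "(8 * ?r / 9) * t \<le> ?l * t" using lb t0 by (intro mult_right_mono) auto
      then show "exp (- ?l * t / 2) \<le> gauss (sqrt (8 * t / 9)) \<xi>"
        using t0 by (simp add: gauss_def power_mult_distrib mult_ac)
    qed simp
    finally show ?thesis using ABC by linarith
  next
    case False
    have c: "ln (9 / 8) \<le> ?l" unfolding L_symbol_def using False by (subst ln_le_cancel_iff) auto
    have c0: "0 < ln (9 / 8 :: real)" "ln (9 / 8 :: real) \<le> 2"
      using ln_le_minus_one[of "9/8::real"] by auto
    have "norm (v t) \<le> norm (w 0) * (t * exp (- ln (9 / 8) * t / 2))"
      by (rule damped_oscillator_decay[OF v w v0 c0 c \<xi>(2) t0])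
    then have "(norm (v t))\<^sup>2 \<le> (norm (w 0) * (t * exp (- ln (9 / 8) * t / 2)))\<^sup>2" by (intro power_mono) auto
    also have "\<dots> = t\<^sup>2 * exp (- ln (9 / 8) * t) * (norm (w 0))\<^sup>2"
      by (simp add: power_mult_distrib exp_double[symmetric])
    finally have 1: "2 * (norm (v t))\<^sup>2 \<le> ?B" by simp
    have "norm (P * profile t \<xi>) \<le> M0 * (t * exp (- ?l * t / 2))"
      unfolding norm_mult using P M norm_profile_le[OF t0] by (intro mult_mono) auto
    then have "(norm (P * profile t \<xi>))\<^sup>2 \<le> (M0 * (t * exp (- ?l * t / 2)))\<^sup>2" by (intro power_mono) auto
    also have "\<dots> = M0\<^sup>2 * t\<^sup>2 * exp (- ?l * t)"
      by (simp add: power_mult_distrib exp_double[symmetric])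
    also have "\<dots> \<le> M0\<^sup>2 * t\<^sup>2 * (exp (- ln (9/8) * (t - real DIM('a))) * inverse ((1 + ?r) ^ DIM('a)))"
      by (intro mult_left_mono exp_L_symbol_le t c less_imp_le[OF c0(1)]) simp
    finally have 2: "2 * (norm (P * profile t \<xi>))\<^sup>2 \<le> ?C" by simp
    have "(norm (v t - P * profile t \<xi>))\<^sup>2 \<le> 2 * (norm (v t))\<^sup>2 + 2 * (norm (P * profile t \<xi>))\<^sup>2"
      using norm_add_square_le[of "v t" "- (P * profile t \<xi>)"] by simp
    then show ?thesis using 1 2 ABC by linarith
  qed
qed


lemma integral_lebesgue_cong_lborel:
  fixes f g :: "'a::euclidean_space \<Rightarrow> 'b::{banach,second_countable_topology}"
  assumes "AE x in lebesgue. f x = g x" "f \<in> borel_measurable lebesgue" "g \<in> borel_measurable borel"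
  shows "(\<integral>x. f x \<partial>lebesgue) = (\<integral>x. g x \<partial>lborel)"
    and "integrable lebesgue f \<Longrightarrow> integrable lborel g"
proof -
  have g: "g \<in> borel_measurable lborel" "g \<in> borel_measurable lebesgue"
    using assms(3) by (auto intro: measurable_completion)
  have "(\<integral>x. f x \<partial>lebesgue) = (\<integral>x. g x \<partial>lebesgue)"
    by (rule integral_cong_AE[OF assms(2) g(2) assms(1)])
  then show "(\<integral>x. f x \<partial>lebesgue) = (\<integral>x. g x \<partial>lborel)" using integral_completion[OF g(1)] by simp
  assume "integrable lebesgue f"
  then have "integrable lebesgue g" using integrable_cong_AE[OF assms(2) g(2) assms(1)] by simp
  then show "integrable lborel g" using integrable_completion[OF g(1)] by simp
qed

text \<open>7/32 is what 25/32 leaves of the constant 1. The power of \<open>t\<close> compensates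
  the factor \<open>t powr (- n / 2)\<close> taken out of the whole estimate; \<open>Q\<close> is to
  be the integral of the majorant divided by Plancherel's factor.\<close>

lemma eventually_remainder_small:
  fixes c p Q a :: real
  assumes c: "0 < c"
  shows "\<forall>\<^sub>F t in at_top. t powr p * (2 * t\<^sup>2 * exp (- c * t) + 2 * t\<^sup>2 * exp (- c * (t - a)) * Q) \<le> 7 / 32"
proof -
  have "((\<lambda>t. t powr p * t\<^sup>2 * exp (- c * t)) \<longlongrightarrow> 0) at_top" using c by real_asymp
  then have "((\<lambda>t. (t powr p * t\<^sup>2 * exp (- c * t)) * (2 + 2 * exp (c * a) * Q)) \<longlongrightarrow> 0 * (2 + 2 * exp (c * a) * Q)) at_top"
    by (intro tendsto_mult tendsto_const)
  then have "\<forall>\<^sub>F t in at_top. (t powr p * t\<^sup>2 * exp (- c * t)) * (2 + 2 * exp (c * a) * Q) < 7 / 32"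
    by (intro order_tendstoD(2)) auto
  then show ?thesis
  proof eventually_elim
    case (elim t)
    have "exp (- c * (t - a)) = exp (- c * t) * exp (c * a)" by (simp add: exp_add[symmetric] algebra_simps)
    then have "t powr p * (2 * t\<^sup>2 * exp (- c * t) + 2 * t\<^sup>2 * exp (- c * (t - a)) * Q) = (t powr p * t\<^sup>2 * exp (- c * t)) * (2 + 2 * exp (c * a) * Q)"
      by (simp only: distrib_left mult_ac)
    then show ?case using elim by linarith
  qed
qed

text \<open>The left side is the integral of \<open>gauss (sqrt (8 * t / 9))\<close> in dimension
  \<open>n\<close>, and \<open>(2 * pi) ^ n\<close> is Plancherel's factor. Per dimension the
  inequality amounts to \<open>9 \<le> 4 * pi\<close> and yields 1/2; as \<open>n \<ge> 1\<close>,
  the power of 1/2 is at most 1/2.\<close>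

lemma gauss_width_bound:
  fixes t :: real
  assumes t: "0 < t" and n: "0 < n"
  shows "(sqrt (2 * pi) / sqrt (8 * t / 9)) ^ n \<le> (2 * pi) ^ n * (1 / 2 * t powr (- real n / 2))"
proof -
  have p: "3 < pi" using pi_gt3 .
  have h: "t powr (- 1 / 2) = 1 / sqrt t"
    using powr_minus_divide[of t "1 / 2"] powr_half_sqrt[of t] t by simp
  have hn: "(t powr (- 1 / 2)) ^ n = t powr (- real n / 2)"
    using t by (subst powr_realpow[symmetric]) (simp_all add: powr_powr)
  have "9 * pi \<le> (4 * pi) * pi" using p by (intro mult_right_mono) auto
  then have "9 * (2 * pi) \<le> pi\<^sup>2 * 8" by (simp add: power2_eq_square)
  then have "(9 * (2 * pi)) / (8 * t) \<le> (pi\<^sup>2 * 8) / (8 * t)" using t by (intro divide_right_mono) auto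
  then have "(2 * pi) / (8 * t / 9) \<le> (pi / sqrt t)\<^sup>2" using t by (simp add: power_divide)
  then have "sqrt ((2 * pi) / (8 * t / 9)) \<le> pi / sqrt t" using t by (intro real_le_lsqrt) auto
  then have "sqrt (2 * pi) / sqrt (8 * t / 9) \<le> (2 * pi) * (1 / 2 * t powr (- 1 / 2))"
    unfolding h real_sqrt_divide by simp
  then have "(sqrt (2 * pi) / sqrt (8 * t / 9)) ^ n \<le> ((2 * pi) * (1 / 2 * t powr (- 1 / 2))) ^ n"
    using t by (intro power_mono) auto
  also have "\<dots> = (2 * pi) ^ n * ((1 / 2) ^ n * t powr (- real n / 2))"
    by (simp only: power_mult_distrib hn)
  also have "\<dots> \<le> (2 * pi) ^ n * (1 / 2 * t powr (- real n / 2))"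
    using power_decreasing[of 1 n "1/2::real"] n by (intro mult_left_mono mult_right_mono) auto
  finally show ?thesis .
qed

section \<open>The asymptotic estimate\<close>

lemma has_fourier_L2_zero: "has_fourier_L2 (\<lambda>x. 0) (\<lambda>x. 0)"
proof -
  have "has_fourier_L2 (\<lambda>x. 0) (fourier_integral (\<lambda>x::'a. 0))"
    by (rule has_fourier_L2_L1) (auto simp: L2_borel_def)
  moreover have "fourier_integral (\<lambda>x::'a. 0) = (\<lambda>x. 0)" by (simp add: fourier_integral_def fun_eq_iff)
  ultimately show ?thesis by simp
qed

text \<open>Membership in \<open>L2_space\<close> accompanies the bound because
  \<open>L2_norm\<close> is 0 for a function whose squared modulus has a divergent Bochner integral;
  the inequality alone could then hold for a trivial reason.\<close>

theorem diffusion_wave_asymptotics: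
  fixes u1 :: "'a::euclidean_space \<Rightarrow> complex" and u :: "real \<Rightarrow> 'a \<Rightarrow> complex"
  assumes u1: "u1 \<in> L2_space \<inter> L11_space" and mild: "mild_solution (\<lambda>x. 0) u1 u"
  shows "\<forall>\<^sub>F t in at_top.
      (\<lambda>x. u t x - (\<integral>y. u1 y \<partial>lebesgue) * inv_fourier_L2 (profile t) x) \<in> L2_space \<and>
      L2_norm (\<lambda>x. u t x - (\<integral>y. u1 y \<partial>lebesgue) * inv_fourier_L2 (profile t) x)
        \<le> (L2_norm u1 + (\<integral>x. (1 + norm x) * norm (u1 x) \<partial>lebesgue)) * t powr (- real DIM('a) / 4)"
proof -
  have u1L: "u1 \<in> L2_space" "integrable lebesgue u1" "integrable lebesgue (\<lambda>x. (1 + norm x) * norm (u1 x))"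
    using u1 by (auto simp: L11_space_def)
  obtain f where f: "f \<in> L2_borel" and uf: "AE x in lebesgue. u1 x = f x"
    using L2_space_AE_eq_borel[OF u1L(1)] .
  have fb [measurable]: "f \<in> borel_measurable borel" using L2_borelD f by auto
  note um = L2_spaceD(1)[OF u1L(1)]
  define P where "P = (\<integral>x. f x \<partial>lborel)"
  define M0 where "M0 = (\<integral>x. norm (f x) \<partial>lborel)"
  define M1 where "M1 = (\<integral>x. norm x * norm (f x) \<partial>lborel)"
  define N where "N = L2_norm u1"
  define F where "F = fourier_integral f"
  define I0 where "I0 = N + (M0 + M1)"
  have P: "(\<integral>y. u1 y \<partial>lebesgue) = P"
    unfolding P_def by (rule integral_lebesgue_cong_lborel(1)[OF uf um fb])
  have fi: "integrable lborel f"
    by (rule integral_lebesgue_cong_lborel(2)[OF uf um fb u1L(2)])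
  have w: "(\<integral>x. (1 + norm x) * norm (u1 x) \<partial>lebesgue) = (\<integral>x. (1 + norm x) * norm (f x) \<partial>lborel)"
    and wi: "integrable lborel (\<lambda>x. (1 + norm x) * norm (f x))"
  proof -
    have 1: "AE x in lebesgue. (1 + norm x) * norm (u1 x) = (1 + norm x) * norm (f x)"
      using uf by eventually_elim simp
    have 2: "(\<lambda>x. (1 + norm x) * norm (u1 x)) \<in> borel_measurable lebesgue"
      by (rule borel_measurable_integrable[OF u1L(3)])
    have 3: "(\<lambda>x. (1 + norm x) * norm (f x)) \<in> borel_measurable borel" by measurable
    show "(\<integral>x. (1 + norm x) * norm (u1 x) \<partial>lebesgue) = (\<integral>x. (1 + norm x) * norm (f x) \<partial>lborel)"
      by (rule integral_lebesgue_cong_lborel(1)[OF 1 2 3])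
    show "integrable lborel (\<lambda>x. (1 + norm x) * norm (f x))"
      by (rule integral_lebesgue_cong_lborel(2)[OF 1 2 3 u1L(3)])
  qed
  have n0: "integrable lborel (\<lambda>x. norm (f x))" using fi by simp
  have n1: "integrable lborel (\<lambda>x. norm x * norm (f x))"
    using Bochner_Integration.integrable_diff[OF wi n0] by (simp add: distrib_right)
  have wM: "(\<integral>x. (1 + norm x) * norm (u1 x) \<partial>lebesgue) = M0 + M1"
    unfolding w unfolding M0_def M1_def distrib_right mult_1_left by (rule Bochner_Integration.integral_add[OF n0 n1])
  have pos: "0 \<le> M0" "0 \<le> M1" "0 \<le> N" unfolding M0_def M1_def N_def L2_norm_def by simp_all
  then have I0: "0 \<le> I0" unfolding I0_def by simp
  have PM: "norm P \<le> M0" unfolding P_def M0_def by (rule integral_norm_bound)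
  have FP: "norm (F \<xi> - P) \<le> norm \<xi> * M1" for \<xi>
    unfolding F_def P_def M1_def by (rule norm_fourier_integral_minus_mean_le[OF fi n1])
  have N2: "N\<^sup>2 = (\<integral>x. (norm (f x))\<^sup>2 \<partial>lborel)"
  proof -
    have "(\<integral>x. (norm (u1 x))\<^sup>2 \<partial>lebesgue) = (\<integral>x. (norm (f x))\<^sup>2 \<partial>lborel)"
    proof (rule integral_lebesgue_cong_lborel(1))
      show "AE x in lebesgue. (norm (u1 x))\<^sup>2 = (norm (f x))\<^sup>2" using uf by eventually_elim simp
      show "(\<lambda>x. (norm (u1 x))\<^sup>2) \<in> borel_measurable lebesgue"
        by (rule borel_measurable_integrable[OF L2_spaceD(2)[OF u1L(1)]])
    qed measurable
    then show ?thesis unfolding N_def L2_norm_def by simp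
  qed
  note FF = integral_plancherel_L1_L2[OF f fi, folded F_def N2]
  have hF: "has_fourier_L2 u1 F"
    unfolding F_def
    by (rule has_fourier_L2_cong[OF _ um _ _ has_fourier_L2_L1[OF f fi]])
       (use uf in \<open>auto intro: borel_measurable_lebesgueI\<close>)
  have F1: "AE \<xi> in lebesgue. fourier_L2 u1 \<xi> = F \<xi>"
    by (rule has_fourier_L2_unique[OF has_fourier_L2_fourier_L2[OF u1L(1)] hF])
  have Z: "AE \<xi> in lebesgue. fourier_L2 (\<lambda>x::'a. 0) \<xi> = 0"
    by (rule has_fourier_L2_unique[OF has_fourier_L2_fourier_L2 has_fourier_L2_zero]) (simp add: L2_space_def)
  obtain v w where vw: "\<forall>t\<ge>0. AE \<xi> in lebesgue. v t \<xi> = fourier_L2 (u t) \<xi>"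
    "AE \<xi> in lebesgue.
           v 0 \<xi> = fourier_L2 (\<lambda>x. 0) \<xi> \<and> w 0 \<xi> = fourier_L2 u1 \<xi> \<and>
           (\<forall>t\<ge>0.
              ((\<lambda>s. v s \<xi>) has_vector_derivative w t \<xi>) (at t within {0..}) \<and>
              ((\<lambda>s. w s \<xi>) has_vector_derivative
                 - complex_of_real (L_symbol \<xi>) * v t \<xi>
                 - complex_of_real (L_symbol \<xi>) * w t \<xi>) (at t within {0..}))"
    using mild unfolding mild_solution_def by blast
  have uL: "u t \<in> L2_space" if "0 \<le> t" for t
    using mild that by (auto simp: mild_solution_def C1_L2_def C0_L2_def)
  let ?n = "DIM('a)" and ?c = "ln (9 / 8 :: real)"
  define J where "J = (\<lambda>\<xi>::'a. inverse ((1 + (norm \<xi>)\<^sup>2) ^ ?n))"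
  define C where "C = integral\<^sup>L lborel J"
  have J: "integrable lborel J" "\<And>\<xi>. 0 \<le> J \<xi>"
    unfolding J_def by (rule integrable_inverse_one_plus_norm_power) simp
  have C0: "0 \<le> C" unfolding C_def using J(2) by (intro integral_nonneg_AE) auto
  have "0 < ?c" by simp
  from eventually_remainder_small[OF this, of "real ?n / 2" "real ?n" "C / (2 * pi) ^ ?n"]
    eventually_ge_at_top[of "2 * real ?n"]
  show ?thesis
    unfolding P wM N_def[symmetric] I0_def[symmetric]
  proof eventually_elim
    case (elim t)
    have n1: "1 \<le> real ?n" using DIM_positive[where 'a='a] by linarith
    have t: "0 < t" "0 \<le> t" "real ?n \<le> t" using elim(2) n1 by linarith+
    let ?D = "\<lambda>x. u t x - P * inv_fourier_L2 (profile t) x"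
    define D' where "D' = (\<lambda>\<xi>. fourier_L2 (u t) \<xi> - P * profile t \<xi>)"
    have "has_fourier_L2 (inv_fourier_L2 (profile t :: 'a \<Rightarrow> complex)) (profile t)"
      \<comment> \<open>The choice in \<open>inv_fourier_L2\<close> is meaningful here because
        \<open>t\<close> is at least twice the dimension, which puts the kernel in the scope of the
        inversion theorem.\<close>
      unfolding inv_fourier_L2_def by (rule someI_ex[OF fourier_inversion_L1_L2[OF profile_L2_borel[OF elim(2)]]])
    then have hD: "has_fourier_L2 ?D D'"
      unfolding D'_def by (rule has_fourier_L2_diff_cmult[OF has_fourier_L2_fourier_L2[OF uL[OF t(2)]]])
    then have DL: "?D \<in> L2_space" by (simp add: has_fourier_L2_def)
    define a where "a = 25 / 16 * (M0 + M1)\<^sup>2"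
    define b where "b = 2 * t\<^sup>2 * exp (- ?c * t)"
    define d where "d = 2 * M0\<^sup>2 * t\<^sup>2 * exp (- ?c * (t - real ?n))"
    define s where "s = sqrt (8 * t / 9)"
    have s: "0 < s" using t by (simp add: s_def)
    define G where "G \<xi> = a * gauss s \<xi> + b * (norm (F \<xi>))\<^sup>2 + d * J \<xi>" for \<xi>
    have abd: "0 \<le> a" "0 \<le> b" "0 \<le> d" by (simp_all add: a_def b_def d_def)
    have Gi: "integrable lborel G"
      unfolding G_def
      by (intro Bochner_Integration.integrable_add integrable_mult_right integrable_gauss s L2_borelD(3)[OF FF(1)] J)
    have Gint: "integral\<^sup>L lborel G = a * (sqrt (2 * pi) / s) ^ ?n + b * ((2 * pi) ^ ?n * N\<^sup>2) + d * C"
      unfolding G_def C_def FF(2)[symmetric] integral_gauss[OF s, symmetric]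
      using integrable_gauss[OF s, where 'a='a] L2_borelD(3)[OF FF(1)] J(1) by simp
    have G0: "0 \<le> G \<xi>" for \<xi>
      unfolding G_def using abd J(2)[of \<xi>] less_imp_le[OF gauss_pos[of s \<xi>]] by auto
    \<comment> \<open>The null set where \<open>v t\<close> differs from the transform of
      \<open>u t\<close> depends on \<open>t\<close>, but \<open>t\<close> is fixed here. The
      oscillator equation holds for all times off a single null set, so both can be
      combined.\<close>
    have "AE \<xi> in lebesgue. (norm (D' \<xi>))\<^sup>2 \<le> G \<xi>"
      using vw(1)[rule_format, OF t(2)] vw(2) Z F1 AE_norm_ne[of 0] AE_L_symbol_ne_4
    proof eventually_elim
      case (elim \<xi>)
      have v0: "v 0 \<xi> = 0" and w0: "w 0 \<xi> = F \<xi>" and vt: "v t \<xi> = fourier_L2 (u t) \<xi>"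
        and ne: "\<xi> \<noteq> 0" "L_symbol \<xi> \<noteq> 4"
        using elim by simp_all
      have ode: "((\<lambda>s. v s \<xi>) has_vector_derivative w t \<xi>) (at t within {0..})"
        "((\<lambda>s. w s \<xi>) has_vector_derivative - complex_of_real (L_symbol \<xi>) * v t \<xi>
           - complex_of_real (L_symbol \<xi>) * w t \<xi>) (at t within {0..})" if "0 \<le> t" for t
        using elim that by blast+
      have "norm (w 0 \<xi> - P) \<le> norm \<xi> * M1" unfolding w0 by (rule FP)
      from fourier_difference_pointwise[where v="\<lambda>t. v t \<xi>" and w="\<lambda>t. w t \<xi>", OF ode v0 ne t(3) this PM pos(1,2)]
      show ?case
        unfolding vt w0 D'_def G_def a_def b_def d_def s_def J_def by (simp only: mult.assoc)
    qed
    then have "(\<integral>\<^sup>+\<xi>. ennreal ((norm (D' \<xi>))\<^sup>2) \<partial>lebesgue) \<le> (\<integral>\<^sup>+\<xi>. ennreal (G \<xi>) \<partial>lebesgue)"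
      by (intro nn_integral_mono_AE) (auto intro: ennreal_leI)
    also have "\<dots> = ennreal (integral\<^sup>L lborel G)"
      unfolding nn_integral_completion using G0 by (intro nn_integral_eq_integral Gi) auto
    finally have "ennreal ((2 * pi) ^ ?n * (L2_norm ?D)\<^sup>2) \<le> ennreal (integral\<^sup>L lborel G)"
      unfolding plancherel_L2[OF hD] L2_spaceD(4)[OF DL] by (simp add: ennreal_mult)
    then have "(2 * pi) ^ ?n * (L2_norm ?D)\<^sup>2 \<le> integral\<^sup>L lborel G"
      using G0 by (subst (asm) ennreal_le_iff) (auto intro!: integral_nonneg_AE)
    also have "\<dots> \<le> a * ((2 * pi) ^ ?n * (1 / 2 * t powr (- real ?n / 2))) + b * ((2 * pi) ^ ?n * N\<^sup>2) + d * C"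
      unfolding Gint s_def using gauss_width_bound[OF t(1), of ?n] abd by (intro add_mono mult_left_mono) auto
    also have "\<dots> = (2 * pi) ^ ?n * (a * (1 / 2 * t powr (- real ?n / 2)) + b * N\<^sup>2 + d * (C / (2 * pi) ^ ?n))"
    proof -
      have "a * (T * x) + b * (T * y) + d * C = T * (a * x + b * y + d * (C / T))" if "T \<noteq> 0" for T x y
        using that by (simp add: field_simps)
      then show ?thesis by this simp
    qed
    finally have "(L2_norm ?D)\<^sup>2 \<le> a * (1 / 2 * t powr (- real ?n / 2)) + b * N\<^sup>2 + d * (C / (2 * pi) ^ ?n)"
      by (subst (asm) mult_le_cancel_left_pos) auto
    \<comment> \<open>\<open>M0 + M1\<close>, \<open>N\<close> and \<open>M0\<close> are all at most
      \<open>I0\<close>, so every term carries the common factor \<open>I0\<^sup>2\<close>, and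
      \<open>25 / 16\<close> times \<open>1 / 2\<close> gives \<open>25 / 32\<close>.\<close>
    also have "\<dots> \<le> I0\<^sup>2 * (25 / 32 * t powr (- real ?n / 2)) + I0\<^sup>2 * b + I0\<^sup>2 * (2 * t\<^sup>2 * exp (- ?c * (t - real ?n)) * (C / (2 * pi) ^ ?n))"
    proof (intro add_mono)
      have "(M0 + M1)\<^sup>2 \<le> I0\<^sup>2" "N\<^sup>2 \<le> I0\<^sup>2" "M0\<^sup>2 \<le> I0\<^sup>2" using pos by (auto simp: I0_def intro!: power_mono)
      note * = this
      show "a * (1 / 2 * t powr (- real ?n / 2)) \<le> I0\<^sup>2 * (25 / 32 * t powr (- real ?n / 2))"
        using mult_right_mono[OF *(1), of "25 / 32 * t powr (- real ?n / 2)"] by (simp add: a_def)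
      show "b * N\<^sup>2 \<le> I0\<^sup>2 * b" using mult_right_mono[OF *(2) abd(2)] by (simp add: mult.commute)
      have "0 \<le> 2 * t\<^sup>2 * exp (- ?c * (t - real ?n)) * (C / (2 * pi) ^ ?n)" using C0 by simp
      from mult_right_mono[OF *(3) this]
      show "d * (C / (2 * pi) ^ ?n) \<le> I0\<^sup>2 * (2 * t\<^sup>2 * exp (- ?c * (t - real ?n)) * (C / (2 * pi) ^ ?n))"
        by (simp add: d_def mult_ac)
    qed
    \<comment> \<open>With the expected decay taken out, the bracket is 25/32 plus a remainder that
      is at most 7/32 for the times considered.\<close>
    also have "\<dots> = I0\<^sup>2 * t powr (- real ?n / 2) * (25 / 32 + t powr (real ?n / 2) * (2 * t\<^sup>2 * exp (- ?c * t) + 2 * t\<^sup>2 * exp (- ?c * (t - real ?n)) * (C / (2 * pi) ^ ?n)))"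
    proof -
      have "t powr (- real ?n / 2) * t powr (real ?n / 2) = 1" using t by (simp add: powr_add[symmetric])
      then have "t powr (- real ?n / 2) * (t powr (real ?n / 2) * x) = x" for x by (simp only: mult.assoc[symmetric] mult_1_left)
      then show ?thesis by (simp only: b_def distrib_left mult.assoc add.assoc)
    qed
    also have "\<dots> \<le> I0\<^sup>2 * t powr (- real ?n / 2) * 1"
      by (rule mult_left_mono) (use elim(1) in linarith, simp)
    also have "\<dots> = (I0 * t powr (- real ?n / 4))\<^sup>2"
      using t by (simp add: power_mult_distrib powr_power)
    finally have "L2_norm ?D \<le> I0 * t powr (- real ?n / 4)"
      by (rule power2_le_imp_le) (simp add: I0)
    with DL show ?case by blast
  qed
qed

theorem theorem1p1:
  fixes u1 :: "real ^ 'n \<Rightarrow> complex" and u :: "real \<Rightarrow> real ^ 'n \<Rightarrow> complex"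
  assumes "u1 \<in> L2_space \<inter> L11_space"
    and "mild_solution (\<lambda>x. 0) u1 u"
  defines "I0 \<equiv> L2_norm u1 + (\<integral>x. (1 + norm x) * norm (u1 x) \<partial>lebesgue)"
  defines "K \<equiv> (\<lambda>(t::real) (\<xi>::real ^ 'n). complex_of_real
      ((1 + (norm \<xi>)\<^sup>2) powr (- t / 2) *
       (sin (t * sqrt (ln (1 + (norm \<xi>)\<^sup>2))) / sqrt (ln (1 + (norm \<xi>)\<^sup>2)))))"
  defines "D \<equiv> (\<lambda>t x. u t x - (\<integral>y. u1 y \<partial>lebesgue) * inv_fourier_L2 (K t) x)"
  shows "\<forall>\<^sub>F t in at_top.
      D t \<in> L2_space \<and> L2_norm (D t) \<le> I0 * t powr (- real CARD('n) / 4)"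
proof -
  have "K = profile" unfolding K_def profile_def by (intro ext) (rule refl)
  then show ?thesis
    using diffusion_wave_asymptotics[OF assms(1,2)] unfolding D_def I0_def
    by (simp only: DIM_cart DIM_real mult_1_right)
qed

end
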